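(* Let $N\ge 3$, $0\le\mu<\bar\mu:=\left(\frac{N-2}{2}\right)^2$, and $q>2^*-1$, where $2^*=\frac{2N}{N-2}$. Then the problem $$-\Delta u-\mu\frac{u}{|x|^2}=u^{2^*-1}-u^q\ \text{ in }\mathbb{R}^N,\qquad u>0,\qquad u\in D^{1,2}(\mathbb{R}^N)\cap L^{q+1}(\mathbb{R}^N),$$ does not admit any solution.
   Context: $D^{1,2}(\mathbb{R}^N)$ is the closure of $C_0^\infty(\mathbb{R}^N)$ with respect to the norm $\left(\int_{\mathbb{R}^N}|\nabla u|^2dx\right)^{1/2}$. Solutions are understood in the weak sense. *)

theory Defs
  imports "HOL-Analysis.Analysis"
begin

fun times_cont_diff :: "nat \<Rightarrow> ('a::euclidean_space \<Rightarrow> real) \<Rightarrow> bool" where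
  "times_cont_diff 0 f \<longleftrightarrow> continuous_on UNIV f"
| "times_cont_diff (Suc k) f \<longleftrightarrow> f differentiable_on UNIV \<and>
     (\<forall>i\<in>Basis. times_cont_diff k (\<lambda>x. frechet_derivative f (at x) i))"

definition test_functions :: "('a::euclidean_space \<Rightarrow> real) set" where
  "test_functions = {\<phi>. (\<forall>k. times_cont_diff k \<phi>) \<and> compact (closure {x. \<phi> x \<noteq> 0})}"

definition gradient :: "('a::euclidean_space \<Rightarrow> real) \<Rightarrow> 'a \<Rightarrow> 'a" where
  "gradient f x = (\<Sum>i\<in>Basis. frechet_derivative f (at x) i *\<^sub>R i)"

(* Functions rather than equivalence classes; every notion below is invariant under
   modification on a null set. *)
definition Lp :: "real \<Rightarrow> ('a::euclidean_space \<Rightarrow> 'b::euclidean_space) set" where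
  "Lp p = {f. f \<in> borel_measurable lebesgue \<and> integrable lebesgue (\<lambda>x. norm (f x) powr p)}"

definition has_weak_gradient :: "('a::euclidean_space \<Rightarrow> real) \<Rightarrow> ('a \<Rightarrow> 'a) \<Rightarrow> bool" where
  "has_weak_gradient u G \<longleftrightarrow>
     (\<forall>K. compact K \<longrightarrow> u absolutely_integrable_on K \<and> G absolutely_integrable_on K) \<and>
     (\<forall>\<phi>\<in>test_functions.
        (LINT x|lebesgue. u x *\<^sub>R gradient \<phi> x) = - (LINT x|lebesgue. \<phi> x *\<^sub>R G x))"

definition critical_exponent :: "nat \<Rightarrow> real" where
  "critical_exponent N = 2 * real N / (real N - 2)"

(* The closure of the test functions in the gradient norm, meaningful for dimension at least 3.
   It is taken inside the space of functions in L^{2*} with weak gradient in L^2, on which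
   the gradient norm is a norm and not just a seminorm (nonzero constants are excluded).  By the
   Sobolev inequality every gradient-Cauchy sequence of test functions converges in L^{2*} to
   such a function, so this is the usual concrete realisation of the completion. *)
definition D12 :: "('a::euclidean_space \<Rightarrow> real) set" where
  "D12 = {u. u \<in> Lp (critical_exponent DIM('a)) \<and>
     (\<exists>G. has_weak_gradient u G \<and> G \<in> Lp 2 \<and>
        (\<exists>\<phi>. (\<forall>k::nat. \<phi> k \<in> test_functions) \<and>
           (\<lambda>k. LINT x|lebesgue. (norm (gradient (\<phi> k) x - G x))\<^sup>2) \<longlonglongrightarrow> 0))}"

(* Weak form of  - Laplacian u - mu u / |x|^2 = g(u)  on the whole space.
   The weak gradient G is unique up to a null set.  For dimension at least 3 and u in D12,
   both integrands on the left are integrable for every test function. *)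
definition weak_solution :: "real \<Rightarrow> (real \<Rightarrow> real) \<Rightarrow> ('a::euclidean_space \<Rightarrow> real) \<Rightarrow> bool" where
  "weak_solution \<mu> g u \<longleftrightarrow> (\<exists>G. has_weak_gradient u G \<and>
     (\<forall>\<phi>\<in>test_functions.
        (LINT x|lebesgue. G x \<bullet> gradient \<phi> x) - \<mu> * (LINT x|lebesgue. u x * \<phi> x / (norm x)\<^sup>2)
          = (LINT x|lebesgue. g (u x) * \<phi> x)))"

end

(*
Let b = 2N/(N-2) be the critical exponent and u_s(x) = s^((N-2)/2) u(s x).  This dilation preserves
the integrals of |grad u|^2, u^2/|x|^2 and u^b, but multiplies that of u^(q+1) by s^k with
k = (N-2)(q+1)/2 - N > 0.  Formally, differentiating the energy along u_s at s = 1 gives zero because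
u is a critical point, so the integral of u^(q+1) vanishes (Pohozaev).  Differentiating needs
regularity of u, which is avoided as follows: since q > b - 1, the function t^(q+1)/(q+1) - t^b/b
becomes convex after adding a multiple of t^2, so testing the equation with u_s - u, cut off to an
annulus, bounds the energy difference from below by -C times the square of the L^2 norm of u_s - u
on the annulus.  This is O((1-s)^2), as grad u is square integrable.  Dividing by 1 - s, letting s
tend to 1 from below and then letting the annulus exhaust the space gives the claim.
*)
theory Submission
  imports Defs "HOL-Probability.Probability_Measure"
begin

section \<open>Smooth functions\<close>

text \<open>The difference \<open>u_s - u\<close> is not a test function. Mollifications of
  \<open>u\<close> are dilated instead, and each term of the equation passes to the limit as a
  pairing of a convergent sequence with a fixed function of the dual exponent. The same
  mollifications carry the estimate of \<open>u_s - u\<close> over from smooth functions to weakly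
  differentiable ones. With h = 1 - s there are two kinds of error, and they dictate the order of
  the limits. The quadratic remainder is O(h^2) with a factor depending on the annulus; it is gone
  after division by h. The errors caused by the cutoff are only O(h) and survive, but |x| |grad eta|
  is bounded independently of the annulus, so they are a fixed multiple of the mass near its two
  ends. That mass contains u^2/|x|^2, for which no Hardy inequality is proved: near the ends it is
  controlled by a multiple of u^b and a small multiple of |x|^(-N), whose integral there is bounded
  by scale invariance. Taking s < 1 makes 1 - s^k positive, so the one-sided energy bound points in
  the useful direction.\<close>

definition smooth :: "('a::euclidean_space \<Rightarrow> real) \<Rightarrow> bool" where
  "smooth f \<longleftrightarrow> (\<forall>k. times_cont_diff k f)"

abbreviation pd :: "('a::euclidean_space \<Rightarrow> real) \<Rightarrow> 'a \<Rightarrow> 'a \<Rightarrow> real" where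
  "pd f i \<equiv> (\<lambda>x. frechet_derivative f (at x) i)"

lemma smooth_differentiable: "smooth f \<Longrightarrow> f differentiable at x"
  unfolding smooth_def using times_cont_diff.simps(2)[of 0 f]
  by (auto simp: differentiable_on_def)

lemma smooth_has_derivative: "smooth f \<Longrightarrow> (f has_derivative frechet_derivative f (at x)) (at x)"
  using smooth_differentiable frechet_derivative_works by blast

lemma smooth_continuous_on: "smooth f \<Longrightarrow> continuous_on S f"
  unfolding smooth_def using times_cont_diff.simps(1)[of f] continuous_on_subset by blast

lemma smooth_measurable: "smooth f \<Longrightarrow> f \<in> borel_measurable borel"
  by (simp add: smooth_continuous_on borel_measurable_continuous_onI)

lemma smooth_pd: "smooth f \<Longrightarrow> i \<in> Basis \<Longrightarrow> smooth (pd f i)"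
  unfolding smooth_def using times_cont_diff.simps(2) by blast

lemma pd_eqI: "(f has_derivative f') (at x) \<Longrightarrow> frechet_derivative f (at x) i = f' i"
  using frechet_derivative_at by metis

text \<open>Entry point of the inductions on the order of differentiability: the derivative may be
  given by any convenient formula, since uniqueness identifies it with
  \<open>frechet_derivative\<close>.\<close>

lemma times_cont_diff_SucI:
  assumes "\<And>x. (f has_derivative f' x) (at x)" "\<And>i. i \<in> Basis \<Longrightarrow> times_cont_diff k (\<lambda>x. f' x i)"
  shows "times_cont_diff (Suc k) f"
proof -
  have "f differentiable_on UNIV" using assms(1)
    by (auto simp: differentiable_on_def differentiable_def)
  moreover have "pd f i = (\<lambda>x. f' x i)" for i
    using pd_eqI[OF assms(1)] by blast
  ultimately show ?thesis using assms(2) by simp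
qed

lemma times_cont_diff_add:
  "times_cont_diff k f \<Longrightarrow> times_cont_diff k g \<Longrightarrow> times_cont_diff k (\<lambda>x. f x + g x)"
proof (induction k arbitrary: f g)
  case 0
  then show ?case by (auto intro: continuous_intros)
next
  case (Suc k)
  have "(f has_derivative frechet_derivative f (at x)) (at x)"
       "(g has_derivative frechet_derivative g (at x)) (at x)" for x
    using Suc.prems by (auto simp: differentiable_on_def frechet_derivative_works[symmetric])
  then show ?case using Suc
    by (intro times_cont_diff_SucI[where f' = "\<lambda>x h. frechet_derivative f (at x) h + frechet_derivative g (at x) h"])
       (auto intro!: has_derivative_add)
qed

lemma smooth_add: "smooth f \<Longrightarrow> smooth g \<Longrightarrow> smooth (\<lambda>x. f x + g x)"
  by (simp add: smooth_def times_cont_diff_add)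

lemma smooth_mult:
  fixes f g :: "'a::euclidean_space \<Rightarrow> real"
  assumes "smooth f" "smooth g" shows "smooth (\<lambda>x. f x * g x)"
proof -
  \<comment> \<open>Both factors are assumed smooth to all orders: the product rule yields products
    of one factor with a derivative of the other, and the class of factors must be closed under
    differentiation for the induction hypothesis to apply.\<close>
  have "times_cont_diff k (\<lambda>x. f x * g x)" if "smooth f" "smooth g" for k and f g :: "'a \<Rightarrow> real"
    using that
  proof (induction k arbitrary: f g)
    case 0
    then show ?case by (simp add: continuous_on_mult smooth_continuous_on)
  next
    case (Suc k)
    show ?case
      using Suc
      by (intro times_cont_diff_SucI[where f' = "\<lambda>x h. f x * frechet_derivative g (at x) h + frechet_derivative f (at x) h * g x"])
         (auto intro!: has_derivative_mult smooth_has_derivative times_cont_diff_add smooth_pd)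
  qed
  from this[OF assms] show ?thesis by (simp add: smooth_def)
qed

lemma smooth_const: "smooth (\<lambda>x::'a::euclidean_space. c)"
proof -
  have "times_cont_diff k (\<lambda>x::'a. c)" for k c
  proof (induction k arbitrary: c)
    case 0
    then show ?case by simp
  next
    case (Suc k)
    then show ?case by (intro times_cont_diff_SucI[where f' = "\<lambda>x h. 0"]) auto
  qed
  then show ?thesis by (auto simp: smooth_def)
qed

lemma smooth_inner: "smooth (\<lambda>x::'a::euclidean_space. x \<bullet> b)"
  unfolding smooth_def
proof
  fix k show "times_cont_diff k (\<lambda>x::'a. x \<bullet> b)"
  proof (cases k)
    case 0
    then show ?thesis by (auto intro!: continuous_intros)
  next
    case (Suc k)
    show ?thesis unfolding Suc
      using smooth_const
      by (intro times_cont_diff_SucI[where f' = "\<lambda>x h. h \<bullet> b"])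
         (auto simp: smooth_def intro!: derivative_eq_intros)
  qed
qed

lemma smooth_affine:
  fixes f :: "'a::euclidean_space \<Rightarrow> real"
  assumes "smooth f" shows "smooth (\<lambda>x. f (c *\<^sub>R x + b))"
proof -
  have "times_cont_diff k (\<lambda>x. f (c *\<^sub>R x + b))" if "smooth f" for k and f :: "'a \<Rightarrow> real"
    using that
  proof (induction k arbitrary: f)
    case 0
    then show ?case
      by (auto intro!: continuous_on_compose2[OF smooth_continuous_on[of f UNIV]] continuous_intros)
  next
    case (Suc k)
    \<comment> \<open>The factor \<open>c\<close> from the chain rule is absorbed into the function,
      so that the derivative again has the form covered by the induction hypothesis.\<close>
    have sc: "smooth (\<lambda>x. c * pd f i x)" if "i \<in> Basis" for i
      using that Suc.prems by (intro smooth_mult smooth_const smooth_pd)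
    have "times_cont_diff k (\<lambda>x. c * pd f i (c *\<^sub>R x + b))" if "i \<in> Basis" for i
      by (rule Suc.IH[OF sc[OF that]])
    moreover have "((\<lambda>x. f (c *\<^sub>R x + b)) has_derivative (\<lambda>h. c * frechet_derivative f (at (c *\<^sub>R x + b)) h)) (at x)" for x
    proof -
      have l: "linear (frechet_derivative f (at (c *\<^sub>R x + b)))"
        using Suc.prems smooth_differentiable linear_frechet_derivative by blast
      have "((\<lambda>x. f (c *\<^sub>R x + b)) has_derivative (\<lambda>h. frechet_derivative f (at (c *\<^sub>R x + b)) (c *\<^sub>R h))) (at x)"
        by (rule has_derivative_compose[where f = "\<lambda>x. c *\<^sub>R x + b" and g = f])
           (auto intro!: derivative_eq_intros smooth_has_derivative Suc.prems)
      then show ?thesis by (simp add: linear_cmul[OF l])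
    qed
    ultimately show ?case
      by (intro times_cont_diff_SucI) auto
  qed
  then show ?thesis using assms unfolding smooth_def[of "\<lambda>x. f (c *\<^sub>R x + b)"] by blast
qed

section \<open>Test functions: closure properties and bounds\<close>

text \<open>Compactness of a closure amounts to boundedness of the set; later arguments use the
  support condition in this form.\<close>

lemma test_functions_iff:
  "\<phi> \<in> test_functions \<longleftrightarrow> smooth \<phi> \<and> (\<exists>R. \<forall>x. norm x > R \<longrightarrow> \<phi> x = 0)"
proof -
  have "compact (closure {x. \<phi> x \<noteq> 0}) \<longleftrightarrow> (\<exists>R. \<forall>x. norm x > R \<longrightarrow> \<phi> x = 0)"
    unfolding compact_closure bounded_iff mem_Collect_eq Ball_def by (meson not_le)
  then show ?thesis by (auto simp: test_functions_def smooth_def)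
qed

lemma test_smooth: "\<phi> \<in> test_functions \<Longrightarrow> smooth \<phi>"
  by (simp add: test_functions_iff)

lemma test_affine:
  assumes "\<phi> \<in> test_functions" "c \<noteq> 0" shows "(\<lambda>x. \<phi> (c *\<^sub>R x + b)) \<in> test_functions"
proof -
  obtain R where R: "\<And>x. norm x > R \<Longrightarrow> \<phi> x = 0" using assms(1) by (auto simp: test_functions_iff)
  have "\<phi> (c *\<^sub>R x + b) = 0" if "norm x > (R + norm b) / \<bar>c\<bar>" for x
  proof (rule R)
    have "\<bar>c\<bar> * norm x > R + norm b" using that assms(2) by (simp add: field_simps)
    moreover have "norm (c *\<^sub>R x) \<le> norm (c *\<^sub>R x + b) + norm b"
      by (metis add_diff_cancel_right' norm_triangle_ineq4)
    ultimately show "norm (c *\<^sub>R x + b) > R" by simp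
  qed
  then show ?thesis using assms smooth_affine by (auto simp: test_functions_iff)
qed

lemma test_mult_smooth: "\<phi> \<in> test_functions \<Longrightarrow> smooth f \<Longrightarrow> (\<lambda>x. \<phi> x * f x) \<in> test_functions"
  by (auto simp: test_functions_iff smooth_mult)

lemma test_add: "\<phi> \<in> test_functions \<Longrightarrow> \<psi> \<in> test_functions \<Longrightarrow> (\<lambda>x. \<phi> x + \<psi> x) \<in> test_functions"
  by (auto simp: test_functions_iff smooth_add)
     (metis add.right_neutral max_less_iff_conj)

lemma test_pd:
  assumes "\<phi> \<in> test_functions" "i \<in> Basis" shows "pd \<phi> i \<in> test_functions"
proof -
  obtain R where R: "\<And>x. norm x > R \<Longrightarrow> \<phi> x = 0" using assms(1) by (auto simp: test_functions_iff)
  have "pd \<phi> i x = 0" if x: "norm x > R" for x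
  proof -
    have "open {y::'a. norm y > R}"
      by (intro open_Collect_less continuous_intros)
    then have "(\<phi> has_derivative (\<lambda>_. 0)) (at x)"
      using x R by (intro has_derivative_transform_within_open[of "\<lambda>_. 0" _ x UNIV "{y. norm y > R}" \<phi>]) auto
    from pd_eqI[OF this] show ?thesis .
  qed
  then show ?thesis using assms by (auto simp: test_functions_iff smooth_pd)
qed

lemma test_bounded:
  assumes "\<phi> \<in> test_functions"
  obtains B where "B > 0" "\<And>x. \<bar>\<phi> x\<bar> \<le> B"
proof -
  obtain R where R: "\<And>x. norm x > R \<Longrightarrow> \<phi> x = 0" using assms(1) by (auto simp: test_functions_iff)
  have "compact (\<phi> ` cball 0 R)"
    using assms by (intro compact_continuous_image smooth_continuous_on) (auto simp: test_smooth)
  then obtain B where B: "\<And>x. x \<in> cball 0 R \<Longrightarrow> \<bar>\<phi> x\<bar> \<le> B"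
    using compact_imp_bounded bounded_iff by (metis (no_types, lifting) imageI real_norm_def)
  have "\<bar>\<phi> x\<bar> \<le> max 1 B" for x
    using B[of x] R[of x] by (cases "norm x > R") auto
  then show ?thesis using that[of "max 1 B"] by auto
qed

lemma pd_linear: "smooth f \<Longrightarrow> linear (frechet_derivative f (at x))"
  using smooth_differentiable linear_frechet_derivative by blast

lemma pd_expand:
  assumes "smooth f"
  shows "frechet_derivative f (at x) h = (\<Sum>i\<in>Basis. (h \<bullet> i) * pd f i x)"
proof -
  have "frechet_derivative f (at x) h = frechet_derivative f (at x) (\<Sum>i\<in>Basis. (h \<bullet> i) *\<^sub>R i)"
    by (simp add: euclidean_representation)
  also have "\<dots> = (\<Sum>i\<in>Basis. (h \<bullet> i) * pd f i x)"
    by (simp add: linear_sum[OF pd_linear[OF assms]] linear_cmul[OF pd_linear[OF assms]])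
  finally show ?thesis .
qed

text \<open>One constant for all points and directions, from expanding \<open>h\<close> in the
  basis: each partial derivative is itself a test function and hence bounded.\<close>

lemma pd_bound:
  assumes "\<phi> \<in> test_functions"
  obtains B where "B > 0" "\<And>x h. \<bar>frechet_derivative \<phi> (at x) h\<bar> \<le> B * norm h"
proof -
  have "\<exists>B>0. \<forall>x. \<bar>pd \<phi> i x\<bar> \<le> B" if "i \<in> Basis" for i
    by (metis assms test_pd that test_bounded)
  then obtain B where B: "\<And>i. i \<in> Basis \<Longrightarrow> B i > 0" "\<And>i x. i \<in> Basis \<Longrightarrow> \<bar>pd \<phi> i x\<bar> \<le> B i"
    by metis
  have "\<bar>frechet_derivative \<phi> (at x) h\<bar> \<le> (\<Sum>i\<in>Basis. B i) * norm h" for x h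
  proof -
    have "\<bar>frechet_derivative \<phi> (at x) h\<bar> \<le> (\<Sum>i\<in>Basis. norm h * B i)"
      by (subst pd_expand[OF test_smooth[OF assms]], rule order_trans[OF sum_abs])
         (auto simp: abs_mult intro!: sum_mono mult_mono Basis_le_norm B)
    then show ?thesis by (simp add: sum_distrib_left mult.commute)
  qed
  moreover have "(\<Sum>i\<in>Basis. B i) > 0" using B by (intro sum_pos) auto
  ultimately show ?thesis using that by blast
qed

section \<open>Gradient calculus for smooth functions\<close>

lemma gradient_inner: "i \<in> Basis \<Longrightarrow> gradient f x \<bullet> i = pd f i x"
  by (simp add: gradient_def)

lemma inner_gradient: "smooth f \<Longrightarrow> gradient f x \<bullet> h = frechet_derivative f (at x) h"
  by (subst pd_expand) (simp_all add: gradient_def inner_sum_left inner_commute[of h] mult.commute)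

lemma gradient_eqI: "(f has_derivative (\<lambda>h. g \<bullet> h)) (at x) \<Longrightarrow> gradient f x = g"
  by (rule euclidean_eqI) (simp add: gradient_inner pd_eqI)

lemma smooth_gradient_derivative: "smooth f \<Longrightarrow> (f has_derivative (\<lambda>h. gradient f x \<bullet> h)) (at x)"
  using smooth_has_derivative[of f x] by (simp add: inner_gradient)

lemma gradient_affine:
  assumes "smooth f" shows "gradient (\<lambda>x. f (c *\<^sub>R x + b)) x = c *\<^sub>R gradient f (c *\<^sub>R x + b)"
proof (rule gradient_eqI)
  show "((\<lambda>x. f (c *\<^sub>R x + b)) has_derivative (\<lambda>h. c *\<^sub>R gradient f (c *\<^sub>R x + b) \<bullet> h)) (at x)"
    by (rule has_derivative_eq_rhs[OF has_derivative_compose[where f = "\<lambda>x. c *\<^sub>R x + b" and g = f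
          and f' = "\<lambda>h. c *\<^sub>R h", OF _ smooth_gradient_derivative[OF assms]]])
       (auto intro!: derivative_eq_intros)
qed

lemma gradient_mult:
  assumes "smooth f" "smooth g" shows "gradient (\<lambda>x. f x * g x) x = f x *\<^sub>R gradient g x + g x *\<^sub>R gradient f x"
proof (rule gradient_eqI)
  show "((\<lambda>x. f x * g x) has_derivative (\<lambda>h. (f x *\<^sub>R gradient g x + g x *\<^sub>R gradient f x) \<bullet> h)) (at x)"
    by (rule has_derivative_eq_rhs[OF has_derivative_mult[OF
          smooth_gradient_derivative[OF assms(1)] smooth_gradient_derivative[OF assms(2)]]])
       (auto simp: algebra_simps inner_simps)
qed

lemma gradient_add:
  assumes "smooth f" "smooth g" shows "gradient (\<lambda>x. f x + g x) x = gradient f x + gradient g x"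
  by (rule gradient_eqI)
     (auto simp: inner_add_left intro!: has_derivative_add smooth_gradient_derivative assms)

lemma gradient_cmult:
  assumes "smooth f" shows "gradient (\<lambda>x. c * f x) x = c *\<^sub>R gradient f x"
  using gradient_mult[OF smooth_const[of c] assms, of x] gradient_eqI[of "\<lambda>_. c" 0 x] by simp

lemma gradient_measurable: "smooth f \<Longrightarrow> gradient f \<in> borel_measurable borel"
  unfolding gradient_def by (intro borel_measurable_sum borel_measurable_scaleR smooth_measurable smooth_pd) auto

section \<open>A mollifier\<close>

text \<open>Differentiating exp(-1/t) produces powers of 1/t. Allowing an arbitrary such power from
  the outset gives a family whose linear span is closed under differentiation, so that smoothness
  can be proved by induction.\<close>

definition flat :: "nat \<Rightarrow> real \<Rightarrow> real" where
  "flat m t = (if t > 0 then exp (- (1 / t)) / t ^ m else 0)"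

text \<open>A single term of the exponential series at 1/t, the one of order \<open>m + 2\<close>,
  already beats \<open>t ^ m\<close> with a factor t^2 to spare. This makes the difference quotient
  at 0 vanish for every \<open>m\<close>.\<close>

lemma flat_bound: "\<bar>flat m t\<bar> \<le> fact (m + 2) * t\<^sup>2"
proof (cases "t > 0")
  case True
  have "(\<Sum>n\<in>{m+2}. inverse (fact n) * (1/t) ^ n) \<le> exp (1 / t)"
    unfolding exp_def real_scaleR_def using True
    by (intro sum_le_suminf summable_exp[of "1/t"]) auto
  then have "inverse (fact (m + 2)) * (1/t) ^ (m+2) \<le> exp (1 / t)" by simp
  then have "1 \<le> exp (1 / t) * (t^(m+2) * fact (m+2))"
    using True unfolding power_divide power_one by (simp add: divide_simps mult_ac del: power_add_numeral fact_Suc power_Suc add_2_eq_Suc' split: if_splits)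
  then have "exp (-(1 / t)) * 1 \<le> exp (-(1 / t)) * (exp (1 / t) * (t^(m+2) * fact (m+2)))"
    by (intro mult_left_mono) auto
  also have "\<dots> = t^(m+2) * fact (m+2)"
    by (simp add: mult.assoc[symmetric] flip: exp_add del: power_add_numeral fact_Suc power_Suc add_2_eq_Suc')
  finally have "exp (-(1 / t)) \<le> t^(m+2) * fact (m+2)" by simp
  then show ?thesis using True
    by (simp add: flat_def divide_simps power_add power2_eq_square mult_ac del: fact_Suc add_2_eq_Suc')
qed (simp add: flat_def)

text \<open>Only the junction at 0 needs an argument beyond the usual rules: there
  \<open>flat_bound\<close> forces the derivative 0, which is also the value of the right-hand
  side.\<close>

lemma flat_derivative:
  "(flat m has_field_derivative (flat (m + 2) t - real m * flat (m + 1) t)) (at t)"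
proof -
  consider "t > 0" | "t < 0" | "t = 0" by linarith
  then show ?thesis
  proof cases
    case 1
    have "((\<lambda>t. exp (- (1 / t)) / t ^ m) has_field_derivative (flat (m + 2) t - real m * flat (m + 1) t)) (at t)"
    proof -
      have a: "((\<lambda>t. exp (- (1 / t))) has_field_derivative exp (- (1 / t)) * (1 / t\<^sup>2)) (at t)"
        using 1 by (auto intro!: derivative_eq_intros simp: power2_eq_square)
      have b: "((\<lambda>t. t ^ m) has_field_derivative real m * t ^ (m - 1)) (at t)"
        using DERIV_pow[of m t] by simp
      have "(exp (- (1 / t)) * (1 / t\<^sup>2) * t ^ m - exp (- (1 / t)) * (real m * t ^ (m - 1))) / (t ^ m * t ^ m)
          = flat (m + 2) t - real m * flat (m + 1) t"
        using 1 by (cases m) (simp_all add: flat_def diff_divide_distrib power2_eq_square mult_ac)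
      then show ?thesis using DERIV_divide[OF a b] 1 by (simp add: mult_ac)
    qed
    then show ?thesis
      by (rule has_field_derivative_transform_within_open[of _ _ _ "{0<..}"]) (use 1 in \<open>auto simp: flat_def\<close>)
  next
    case 2
    have "((\<lambda>t. 0) has_field_derivative (flat (m + 2) t - real m * flat (m + 1) t)) (at t)"
      using 2 by (simp add: flat_def)
    then show ?thesis
      by (rule has_field_derivative_transform_within_open[of _ _ _ "{..<0}"]) (use 2 in \<open>auto simp: flat_def\<close>)
  next
    case 3
    have "((\<lambda>y. (flat m y - flat m 0) / (y - 0)) \<longlongrightarrow> 0) (at 0)"
    proof (rule Lim_null_comparison)
      have "norm ((flat m y - flat m 0) / (y - 0)) \<le> fact (m + 2) * \<bar>y\<bar>" for y
      proof (cases "y = 0")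
        case False
        have "\<bar>flat m y\<bar> / \<bar>y\<bar> \<le> (fact (m + 2) * y\<^sup>2) / \<bar>y\<bar>"
          by (intro divide_right_mono flat_bound) auto
        also have "\<dots> = fact (m + 2) * \<bar>y\<bar>" using False
          by (simp add: divide_simps power2_eq_square del: fact_Suc add_2_eq_Suc')
        finally show ?thesis by (simp add: flat_def[of m 0])
      qed simp
      then show "\<forall>\<^sub>F y in at 0. norm ((flat m y - flat m 0) / (y - 0)) \<le> fact (m + 2) * \<bar>y\<bar>" by simp
      show "((\<lambda>y. fact (m + 2) * \<bar>y\<bar>) \<longlongrightarrow> 0) (at (0::real))"
        by (rule tendsto_eq_intros refl | simp)+
    qed
    then show ?thesis using 3 by (simp add: has_field_derivative_iff flat_def)
  qed
qed

lemma smooth_flat: "smooth (\<lambda>x::'a::euclidean_space. flat m (1 - x \<bullet> x))"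
proof -
  \<comment> \<open>Generalised to all \<open>m\<close> and to a smooth coefficient
    \<open>s\<close>, since one differentiation brings in \<open>flat (m + 1)\<close>,
    \<open>flat (m + 2)\<close> and factors \<open>x \<bullet> i\<close>.\<close>
  have "times_cont_diff k (\<lambda>x. s x * flat m (1 - x \<bullet> x))" if "smooth s" for k m and s :: "'a \<Rightarrow> real"
    using that
  proof (induction k arbitrary: s m)
    case 0
    have "continuous_on UNIV (flat m)" using flat_derivative
      by (meson DERIV_isCont continuous_at_imp_continuous_on)
    then have "continuous_on UNIV (\<lambda>x::'a. flat m (1 - x \<bullet> x))"
      by (rule continuous_on_compose2[OF _ continuous_on_diff[OF continuous_on_const
            continuous_on_inner[OF continuous_on_id continuous_on_id]]]) auto
    with 0 show ?case by (simp add: continuous_on_mult smooth_continuous_on)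
  next
    case (Suc k)
    have d: "((\<lambda>x. s x * flat m (1 - x \<bullet> x)) has_derivative
        (\<lambda>h. s x * (-2 * (x \<bullet> h)) * flat (m+2) (1 - x \<bullet> x)
          + (s x * (2 * real m * (x \<bullet> h)) * flat (m+1) (1 - x \<bullet> x)
          + frechet_derivative s (at x) h * flat m (1 - x \<bullet> x)))) (at x)" for x
    proof -
      have "((\<lambda>x. flat m (1 - x \<bullet> x)) has_derivative
        (\<lambda>h. (-2 * (x \<bullet> h)) * (flat (m + 2) (1 - x \<bullet> x) - real m * flat (m + 1) (1 - x \<bullet> x)))) (at x)"
      proof (rule DERIV_compose_FDERIV[OF flat_derivative])
        have "((\<lambda>x. x \<bullet> x) has_derivative (\<lambda>h. x \<bullet> h + h \<bullet> x)) (at x)"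
          by (rule has_derivative_inner[OF has_derivative_ident has_derivative_ident])
        from has_derivative_diff[OF has_derivative_const this]
        show "((\<lambda>x. 1 - x \<bullet> x) has_derivative (\<lambda>h. -2 * (x \<bullet> h))) (at x)"
          by (simp add: inner_commute[of _ x])
      qed
      from has_derivative_mult[OF smooth_has_derivative[OF Suc.prems] this] show ?thesis
        by (rule has_derivative_eq_rhs) (auto simp: algebra_simps)
    qed
    have s: "smooth (\<lambda>x. s x * (c * (x \<bullet> i)))" for c i
      by (intro smooth_mult Suc.prems smooth_const smooth_inner)
    show ?case
    proof (rule times_cont_diff_SucI[OF d])
      fix i :: 'a assume i: "i \<in> Basis"
      show "times_cont_diff k (\<lambda>x. s x * (-2 * (x \<bullet> i)) * flat (m+2) (1 - x \<bullet> x)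
          + (s x * (2 * real m * (x \<bullet> i)) * flat (m+1) (1 - x \<bullet> x)
          + frechet_derivative s (at x) i * flat m (1 - x \<bullet> x)))"
        by (intro times_cont_diff_add Suc.IH[OF s] Suc.IH[OF smooth_pd[OF Suc.prems i]])
    qed
  qed
  from this[OF smooth_const[of 1]] show ?thesis by (simp add: smooth_def)
qed

lemma integrable_bounded_support:
  fixes f :: "'a::euclidean_space \<Rightarrow> real"
  assumes [measurable]: "f \<in> borel_measurable borel" and "\<And>x. \<bar>f x\<bar> \<le> B" "\<And>x. norm x > R \<Longrightarrow> f x = 0"
  shows "integrable lborel f"
proof (rule Bochner_Integration.integrable_bound)
  show "integrable lborel (\<lambda>x::'a. B * indicator (cball 0 R) x :: real)"
    by (intro integrable_mult_right integrable_real_indicator emeasure_lborel_cball_finite) auto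
  show "AE x in lborel. norm (f x) \<le> norm (B * indicator (cball 0 R) x :: real)"
    using assms(2,3) by (auto simp: indicator_def not_le intro: order_trans[OF _ abs_ge_self])
qed auto

lemma test_integrable: "\<phi> \<in> test_functions \<Longrightarrow> integrable lborel \<phi>"
proof -
  assume a: "\<phi> \<in> test_functions"
  obtain B where "\<And>x. \<bar>\<phi> x\<bar> \<le> B" using test_bounded[OF a] by blast
  moreover obtain R where "\<And>x. norm x > R \<Longrightarrow> \<phi> x = 0" using a by (auto simp: test_functions_iff)
  ultimately show ?thesis
    using integrable_bounded_support[of \<phi> B R] smooth_measurable[OF test_smooth[OF a]] by blast
qed

text \<open>The classical bump exp(-1/(1 - |x|^2)) divided by its integral, which is nonzero because
  the bump is positive on a ball of positive measure.\<close>

lemma mollifier_exists: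
  obtains \<rho> :: "'a::euclidean_space \<Rightarrow> real"
  where "\<rho> \<in> test_functions" "\<And>x. \<rho> x \<ge> 0" "\<And>x. norm x \<ge> 1 \<Longrightarrow> \<rho> x = 0" "(LINT x|lborel. \<rho> x) = 1"
proof -
  define b where "b = (\<lambda>x::'a. flat 0 (1 - x \<bullet> x))"
  have nn: "b x \<ge> 0" for x by (simp add: b_def flat_def)
  have z: "b x = 0" if "norm x \<ge> 1" for x
    using power_mono[OF that, of 2] by (simp add: b_def flat_def not_less flip: power2_norm_eq_inner)
  have pos: "b x > 0" if "norm x < 1" for x
    using that by (simp add: b_def flat_def power_less_one_iff abs_square_less_1 flip: power2_norm_eq_inner)
  have "smooth b" unfolding b_def by (rule smooth_flat)
  with z have t: "b \<in> test_functions"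
    by (auto simp: test_functions_iff intro!: exI[of _ 1])
  have i: "integrable lborel b" by (rule test_integrable[OF t])
  have "(LINT x|lborel. b x) \<noteq> 0"
  proof
    assume "(LINT x|lborel. b x) = 0"
    then have "AE x in lborel. b x = 0" using i nn integral_nonneg_eq_0_iff_AE[of lborel b] by auto
    then have "AE x in lborel. x \<notin> ball (0::'a) 1" by eventually_elim (use pos in \<open>auto simp: less_le\<close>)
    then have "ball (0::'a) 1 \<in> null_sets lborel" by (simp only: AE_iff_null_sets sets_lborel open_ball borel_open)
    then have "measure lborel (ball (0::'a) 1) = 0" by (rule measure_eq_0_null_sets)
    then show False using content_ball_pos[OF zero_less_one, of "0::'a"] by linarith
  qed
  moreover have "(LINT x|lborel. b x) \<ge> 0" using nn by simp
  ultimately have I: "(LINT x|lborel. b x) > 0" by linarith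
  show ?thesis
  proof (rule that[of "\<lambda>x. b x * (1 / (LINT x|lborel. b x))"])
    show "(\<lambda>x. b x * (1 / (LINT x|lborel. b x))) \<in> test_functions"
      by (intro test_mult_smooth t smooth_const)
  qed (use I nn z in auto)
qed

section \<open>Convergence in the mean of order \<open>r\<close>\<close>

lemma nn_integral_affine:
  fixes f :: "'a::euclidean_space \<Rightarrow> ennreal"
  assumes [measurable]: "f \<in> borel_measurable borel" and "c \<noteq> 0"
  shows "(\<integral>\<^sup>+x. f x \<partial>lborel) = ennreal (\<bar>c\<bar> ^ DIM('a)) * (\<integral>\<^sup>+x. f (t + c *\<^sub>R x) \<partial>lborel)"
  by (subst lborel_affine[OF assms(2), of t])
     (simp add: nn_integral_density nn_integral_distr nn_integral_cmult)

lemma nn_integral_shift: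
  fixes f :: "'a::euclidean_space \<Rightarrow> ennreal"
  assumes "f \<in> borel_measurable borel"
  shows "(\<integral>\<^sup>+x. f (x - h) \<partial>lborel) = (\<integral>\<^sup>+x. f x \<partial>lborel)"
  using nn_integral_affine[OF assms, of 1 "-h"] by simp

lemma integrable_affine:
  fixes f :: "'a::euclidean_space \<Rightarrow> real"
  assumes f: "integrable lborel f" and c: "c \<noteq> 0"
  shows "integrable lborel (\<lambda>x. f (t + c *\<^sub>R x))"
proof -
  have m [measurable]: "f \<in> borel_measurable borel" using f by simp
  have "(\<integral>\<^sup>+x. ennreal (norm (f x)) \<partial>lborel) < \<infinity>" using f by (simp add: integrable_iff_bounded)
  then have "ennreal (\<bar>c\<bar> ^ DIM('a)) * (\<integral>\<^sup>+x. ennreal (norm (f (t + c *\<^sub>R x))) \<partial>lborel) < \<infinity>"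
    by (subst (asm) nn_integral_affine[OF _ c, of _ t]) auto
  then show ?thesis using c
    by (auto simp: integrable_iff_bounded ennreal_mult_less_top)
qed

lemma integral_affine:
  fixes f :: "'a::euclidean_space \<Rightarrow> real"
  assumes [measurable]: "f \<in> borel_measurable borel" and c: "c \<noteq> 0"
  shows "(LINT x|lborel. f x) = \<bar>c\<bar> ^ DIM('a) * (LINT x|lborel. f (t + c *\<^sub>R x))"
  by (subst lborel_affine[OF assms(2), of t])
     (simp add: integral_density integral_distr)

text \<open>The L^r norm to the power \<open>r\<close>, without the root. Values in
  \<open>ennreal\<close> allow Tonelli and monotonicity before finiteness is known; the place of the
  triangle inequality is taken by \<open>nnr_add\<close>, with its factor 2^r.\<close>

definition nnr :: "real \<Rightarrow> ('a::euclidean_space \<Rightarrow> real) \<Rightarrow> ennreal" where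
  "nnr r f = (\<integral>\<^sup>+x. ennreal (\<bar>f x\<bar> powr r) \<partial>lborel)"

text \<open>The sum is at most twice the larger term. No convexity enters, so every exponent
  \<open>r \<ge> 0\<close> is allowed.\<close>

lemma powr_add_bound:
  fixes a b :: real assumes "r \<ge> 0"
  shows "\<bar>a + b\<bar> powr r \<le> 2 powr r * \<bar>a\<bar> powr r + 2 powr r * \<bar>b\<bar> powr r"
proof -
  have "\<bar>a + b\<bar> powr r \<le> (2 * max \<bar>a\<bar> \<bar>b\<bar>) powr r"
    using assms by (intro powr_mono2) auto
  also have "\<dots> = 2 powr r * (max \<bar>a\<bar> \<bar>b\<bar>) powr r" by (simp add: powr_mult)
  also have "\<dots> \<le> 2 powr r * (\<bar>a\<bar> powr r + \<bar>b\<bar> powr r)"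
    by (intro mult_left_mono) (auto simp: max_def)
  finally show ?thesis by (simp add: distrib_left)
qed

lemma nnr_add:
  assumes [measurable]: "f \<in> borel_measurable borel" "g \<in> borel_measurable borel" and r: "r \<ge> 0"
  shows "nnr r (\<lambda>x. f x + g x) \<le> ennreal (2 powr r) * (nnr r f + nnr r g)"
proof -
  have "nnr r (\<lambda>x. f x + g x) \<le> (\<integral>\<^sup>+x. ennreal (2 powr r) * ennreal (\<bar>f x\<bar> powr r) + ennreal (2 powr r) * ennreal (\<bar>g x\<bar> powr r) \<partial>lborel)"
    unfolding nnr_def using powr_add_bound[OF r]
    by (intro nn_integral_mono) (simp flip: ennreal_mult ennreal_plus)
  also have "\<dots> = ennreal (2 powr r) * (nnr r f + nnr r g)"
    by (subst nn_integral_add) (auto simp: nnr_def nn_integral_cmult distrib_left)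
  finally show ?thesis .
qed

lemma nnr_affine:
  fixes f :: "'a::euclidean_space \<Rightarrow> real"
  assumes [measurable]: "f \<in> borel_measurable borel" and "c \<noteq> 0"
  shows "nnr r f = ennreal (\<bar>c\<bar> ^ DIM('a)) * nnr r (\<lambda>x. f (t + c *\<^sub>R x))"
  unfolding nnr_def using assms(2) by (intro nn_integral_affine) auto

lemma nnr_shift:
  assumes [measurable]: "f \<in> borel_measurable borel"
  shows "nnr r (\<lambda>x. f (x - h)) = nnr r f"
  unfolding nnr_def by (rule nn_integral_shift[where f="\<lambda>x. ennreal (\<bar>f x\<bar> powr r)"]) auto

lemma nnr_uminus: "nnr r (\<lambda>x. - f x) = nnr r f"
  by (simp add: nnr_def)

lemma nnr_diff:
  assumes "f \<in> borel_measurable borel" "g \<in> borel_measurable borel" and r: "r \<ge> 0"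
  shows "nnr r (\<lambda>x. f x - g x) \<le> ennreal (2 powr r) * (nnr r f + nnr r g)"
  using nnr_add[of f "\<lambda>x. - g x" r] assms by (simp add: nnr_uminus)

lemma nnr_dominated:
  fixes f :: "'a::euclidean_space \<Rightarrow> real"
  assumes [measurable]: "\<And>n. F n \<in> borel_measurable borel" "f \<in> borel_measurable borel" "w \<in> borel_measurable borel"
    and lim: "AE x in lborel. (\<lambda>n. F n x) \<longlonglongrightarrow> f x" and r: "r > 0"
    and dom: "\<And>n x. \<bar>F n x - f x\<bar> \<le> w x" and fin: "nnr r w < \<infinity>"
  shows "(\<lambda>n. nnr r (\<lambda>x. F n x - f x)) \<longlonglongrightarrow> 0"
proof -
  have "(\<lambda>n. nnr r (\<lambda>x. F n x - f x)) \<longlonglongrightarrow> (\<integral>\<^sup>+x. 0 \<partial>(lborel::'a measure))"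
    unfolding nnr_def
  proof (rule nn_integral_dominated_convergence[where w = "\<lambda>x. ennreal (\<bar>w x\<bar> powr r)"])
    show "AE x in lborel. ennreal (\<bar>F j x - f x\<bar> powr r) \<le> ennreal (\<bar>w x\<bar> powr r)" for j
      using dom r by (intro AE_I2 ennreal_leI powr_mono2) (auto intro: order_trans[OF _ abs_ge_self])
    show "(\<integral>\<^sup>+ x. ennreal (\<bar>w x\<bar> powr r) \<partial>lborel) < \<infinity>" using fin by (simp add: nnr_def)
    show "AE x in lborel. (\<lambda>i. ennreal (\<bar>F i x - f x\<bar> powr r)) \<longlonglongrightarrow> 0"
      using lim
    proof eventually_elim
      case (elim x)
      have "(\<lambda>i. \<bar>F i x - f x\<bar> powr r) \<longlonglongrightarrow> 0 powr r"
      proof (rule tendsto_powr2)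
        show "(\<lambda>i. \<bar>F i x - f x\<bar>) \<longlonglongrightarrow> 0"
          using elim by (simp add: LIM_zero tendsto_rabs_zero)
      qed (use r in auto)
      then show ?case using r tendsto_ennrealI by fastforce
    qed
  qed auto
  then show ?thesis by simp
qed

lemma LIMSEQ_ennreal_less:
  fixes X :: "nat \<Rightarrow> ennreal" shows "X \<longlonglongrightarrow> 0 \<Longrightarrow> \<delta> > 0 \<Longrightarrow> \<exists>n. X n < \<delta>"
  by (metis eventually_sequentially order_tendstoD(2) order_refl)

lemma nnr_indicator_finite:
  "r > 0 \<Longrightarrow> nnr r (\<lambda>x::'a::euclidean_space. C * indicator (cball 0 R) x) < \<infinity>"
proof -
  assume "r > 0"
  then have "nnr r (\<lambda>x::'a. C * indicator (cball 0 R) x) = (\<integral>\<^sup>+x. ennreal (\<bar>C\<bar> powr r) * indicator (cball (0::'a) R) x \<partial>lborel)"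
    unfolding nnr_def by (intro nn_integral_cong) (auto simp: indicator_def)
  also have "\<dots> = ennreal (\<bar>C\<bar> powr r) * emeasure lborel (cball (0::'a) R)"
    by (subst nn_integral_cmult_indicator) auto
  also have "\<dots> < \<infinity>" using emeasure_lborel_cball_finite[of "0::'a" R] by (simp add: ennreal_mult_less_top)
  finally show ?thesis .
qed

text \<open>Density of compactly supported continuous functions in L^r, in two steps:
  \<open>f\<close> is truncated in value and in space, and the truncation is approximated almost
  everywhere by continuous functions, clipped so that dominated convergence applies.\<close>

lemma nnr_approx_continuous:
  fixes f :: "'a::euclidean_space \<Rightarrow> real"
  assumes f[measurable]: "f \<in> borel_measurable borel" and fin: "nnr r f < \<infinity>" and r: "r > 0" and d: "\<delta> > 0"
  obtains g :: "'a \<Rightarrow> real" and R where "continuous_on UNIV g" "\<And>x. norm x > R \<Longrightarrow> g x = 0"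
    "nnr r (\<lambda>x. g x - f x) < ennreal \<delta>"
proof -
  define \<delta>' where "\<delta>' = ennreal (\<delta> / (2 * 2 powr r))"
  have d': "\<delta>' > 0" "ennreal (2 powr r) * (\<delta>' + \<delta>') = ennreal \<delta>"
    using d by (auto simp: \<delta>'_def simp flip: ennreal_plus ennreal_mult)
  define c where "c = ennreal (2 powr r)"
  define F where "F = (\<lambda>n x. if \<bar>f x\<bar> \<le> real n \<and> norm x \<le> real n then f x else 0)"
  have [measurable]: "F n \<in> borel_measurable borel" for n unfolding F_def by measurable
  have "(\<lambda>n. nnr r (\<lambda>x. F n x - f x)) \<longlonglongrightarrow> 0"
  proof (rule nnr_dominated[where w = "\<lambda>x. \<bar>f x\<bar>"])
    show "AE x in lborel. (\<lambda>n. F n x) \<longlonglongrightarrow> f x"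
    proof (rule AE_I2)
      fix x
      have "\<forall>\<^sub>F n in sequentially. F n x = f x"
        using eventually_ge_at_top[of "nat \<lceil>max \<bar>f x\<bar> (norm x)\<rceil>"]
        by eventually_elim (auto simp: F_def nat_le_iff ceiling_le_iff)
      then show "(\<lambda>n. F n x) \<longlonglongrightarrow> f x" by (rule tendsto_eventually)
    qed
  qed (use r fin in \<open>auto simp: F_def nnr_def\<close>)
  from LIMSEQ_ennreal_less[OF this d'(1)] obtain n where n: "nnr r (\<lambda>x. F n x - f x) < \<delta>'" by blast
  have "F n \<in> borel_measurable lebesgue" by (rule measurable_completion) simp
  \<comment> \<open>Unfolding \<open>measurable_on\<close> supplies continuous functions that
    converge off a negligible set.\<close>
  then have "F n measurable_on UNIV" by (rule lebesgue_measurable_imp_measurable_on) auto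
  then obtain N g where N: "negligible N" and g: "\<And>k. continuous_on UNIV (g k)"
    "\<And>x. x \<notin> N \<Longrightarrow> (\<lambda>k. g k x) \<longlonglongrightarrow> F n x"
    by (auto simp: measurable_on_def)
  \<comment> \<open>Clipping to [-n, n] and the tent factor, which is 1 on the ball of radius
    \<open>n\<close> and 0 beyond \<open>n + 1\<close>, do not change the limit: \<open>F n\<close>
    is bounded by \<open>n\<close> and vanishes outside that ball.\<close>
  define G where "G = (\<lambda>k x. max (- real n) (min (real n) (g k x)) * max 0 (min 1 (real n + 1 - norm x)))"
  have Gc: "continuous_on UNIV (G k)" for k unfolding G_def by (intro continuous_intros g)
  then have [measurable]: "G k \<in> borel_measurable borel" for k by (rule borel_measurable_continuous_onI)
  have Gb: "\<bar>G k x\<bar> \<le> real n" for k x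
  proof -
    have "\<bar>G k x\<bar> \<le> real n * 1" unfolding G_def abs_mult by (rule mult_mono) auto
    then show ?thesis by simp
  qed
  have Gz: "G k x = 0" if "norm x > real n + 1" for k x using that by (simp add: G_def)
  have "(\<lambda>k. nnr r (\<lambda>x. G k x - F n x)) \<longlonglongrightarrow> 0"
  proof (rule nnr_dominated[where w = "\<lambda>x. 2 * real n * indicator (cball 0 (real n + 1)) x"])
    have "AE x in lebesgue. x \<notin> N" using N AE_not_in negligible_iff_null_sets by blast
    then have "AE x in lborel. x \<notin> N" by (simp add: AE_completion_iff)
    then show "AE x in lborel. (\<lambda>k. G k x) \<longlonglongrightarrow> F n x"
    proof eventually_elim
      case (elim x)
      have "(\<lambda>k. G k x) \<longlonglongrightarrow> max (- real n) (min (real n) (F n x)) * max 0 (min 1 (real n + 1 - norm x))"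
        unfolding G_def by (intro tendsto_intros g(2) elim)
      moreover have "max (- real n) (min (real n) (F n x)) * max 0 (min 1 (real n + 1 - norm x)) = F n x"
        by (auto simp: F_def)
      ultimately show ?case by simp
    qed
    show "\<bar>G k x - F n x\<bar> \<le> 2 * real n * indicator (cball 0 (real n + 1)) x" for k x
      using Gb[of k x] Gz[of x k] by (cases "norm x > real n + 1") (auto simp: F_def indicator_def)
    show "(\<lambda>x. 2 * real n * indicator (cball (0::'a) (real n + 1)) x :: real) \<in> borel_measurable borel"
      by (intro borel_measurable_times borel_measurable_indicator borel_measurable_const) auto
  qed (use r nnr_indicator_finite in auto)
  from LIMSEQ_ennreal_less[OF this d'(1)] obtain k where k: "nnr r (\<lambda>x. G k x - F n x) < \<delta>'" by blast
  have "nnr r (\<lambda>x. (G k x - F n x) + (F n x - f x)) \<le> c * (nnr r (\<lambda>x. G k x - F n x) + nnr r (\<lambda>x. F n x - f x))"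
    unfolding c_def by (rule nnr_add) (use r in auto)
  also have "\<dots> < c * (\<delta>' + \<delta>')"
    using add_strict_mono[OF k n] by (intro ennreal_mult_strict_left_mono) (auto simp: c_def)
  also have "\<dots> = ennreal \<delta>" unfolding c_def by (rule d')
  finally show ?thesis using that[OF Gc[of k] Gz] by simp
qed

text \<open>For a compactly supported continuous function this is uniform continuity; density
  transfers it to every \<open>f\<close> with finite \<open>nnr\<close>.\<close>

lemma nnr_translation:
  fixes f :: "'a::euclidean_space \<Rightarrow> real"
  assumes f[measurable]: "f \<in> borel_measurable borel" and fin: "nnr r f < \<infinity>" and r: "r > 0" and d: "\<delta> > 0"
  obtains \<eta> where "\<eta> > 0" "\<And>h. norm h < \<eta> \<Longrightarrow> nnr r (\<lambda>x. f (x - h) - f x) \<le> ennreal \<delta>"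
proof -
  define c where "c = 2 powr r"
  have c: "c > 0" by (simp add: c_def)
  \<comment> \<open>Two applications of the inequality with factor \<open>c\<close> turn three
    errors \<open>\<delta>'\<close> into \<open>c * (1 + 2 * c) * \<delta>'\<close>, hence this
    divisor.\<close>
  define \<delta>' where "\<delta>' = \<delta> / (c * (1 + 2 * c))"
  have d': "\<delta>' > 0" using c d by (simp add: \<delta>'_def)
  obtain g R where g: "continuous_on UNIV g" and gR: "\<And>x. norm x > R \<Longrightarrow> g x = 0"
    and gf: "nnr r (\<lambda>x. g x - f x) < ennreal \<delta>'"
    using nnr_approx_continuous[OF f fin r d'] by blast
  have [measurable]: "g \<in> borel_measurable borel" using g by (rule borel_measurable_continuous_onI)
  define V where "V = measure lborel (cball (0::'a) (R + 1))"
  have V: "emeasure lborel (cball (0::'a) (R + 1)) = ennreal V"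
    unfolding V_def using emeasure_lborel_cball_finite by (intro emeasure_eq_ennreal_measure) (auto simp: top.not_eq_extremum)
  have V0: "V \<ge> 0" by (simp add: V_def)
  \<comment> \<open>An oscillation \<open>e\<close> on a set of measure \<open>V\<close> has
    \<open>nnr\<close> at most \<open>\<delta>'\<close>; \<open>V + 1\<close> keeps the denominator
    positive.\<close>
  define e where "e = (\<delta>' / (V + 1)) powr (1 / r)"
  have e: "e > 0" using d' V0 by (simp add: e_def)
  have "e powr r * V \<le> \<delta>'"
  proof -
    have "e powr r = \<delta>' / (V + 1)" using d' V0 r by (simp add: e_def powr_powr)
    then have "e powr r * V = \<delta>' - e powr r" using d' V0 by (simp add: field_simps)
    then show ?thesis using powr_ge_zero[of e r] by linarith
  qed
  have "uniformly_continuous_on (cball 0 (R + 2)) g"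
    using g by (intro compact_uniformly_continuous) (auto intro: continuous_on_subset)
  then obtain \<eta> where n0: "\<eta> > 0" and n: "\<And>x y. x \<in> cball 0 (R + 2) \<Longrightarrow> y \<in> cball 0 (R + 2) \<Longrightarrow> dist y x < \<eta> \<Longrightarrow> dist (g y) (g x) < e"
    unfolding uniformly_continuous_on_def using e by metis
  have "nnr r (\<lambda>x. f (x - h) - f x) \<le> ennreal \<delta>" if h: "norm h < min 1 \<eta>" for h
  proof -
    have gb: "\<bar>g (x - h) - g x\<bar> \<le> e * indicator (cball 0 (R + 1)) x" for x
    proof (cases "norm x \<le> R + 1")
      case True
      have "norm (x - h) \<le> norm x + norm h" by (rule norm_triangle_ineq4)
      then have "dist (g (x - h)) (g x) < e" using True h
        by (intro n) (auto simp: dist_norm norm_minus_commute[of h x])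
      then show ?thesis using True by (simp add: dist_real_def)
    next
      case False
      have "norm x - norm h \<le> norm (x - h)" by (rule norm_triangle_ineq2)
      then have "norm (x - h) > R" using False h by simp
      then show ?thesis using False gR by simp
    qed
    have "nnr r (\<lambda>x. g (x - h) - g x) \<le> (\<integral>\<^sup>+x. ennreal (e powr r) * indicator (cball (0::'a) (R + 1)) x \<partial>lborel)"
      unfolding nnr_def
    proof (intro nn_integral_mono)
      fix x :: 'a
      have "\<bar>g (x - h) - g x\<bar> powr r \<le> (e * indicator (cball 0 (R + 1)) x) powr r"
        using gb r by (intro powr_mono2) auto
      then show "ennreal (\<bar>g (x - h) - g x\<bar> powr r) \<le> ennreal (e powr r) * indicator (cball 0 (R + 1)) x"
        using r by (auto simp: indicator_def intro: ennreal_leI)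
    qed
    also have "\<dots> = ennreal (e powr r * V)"
      using e V0 by (subst nn_integral_cmult_indicator) (auto simp: V ennreal_mult)
    also have "\<dots> \<le> ennreal \<delta>'" using \<open>e powr r * V \<le> \<delta>'\<close> by (rule ennreal_leI)
    finally have 1: "nnr r (\<lambda>x. g (x - h) - g x) \<le> ennreal \<delta>'" .
    have 2: "nnr r (\<lambda>x. g (x - h) - f (x - h)) \<le> ennreal \<delta>'"
      using nnr_shift[of "\<lambda>x. g x - f x" r h] gf by simp
    have "nnr r (\<lambda>x. g (x - h) - f x) = nnr r (\<lambda>x. (g (x - h) - g x) + (g x - f x))" by simp
    also have "\<dots> \<le> ennreal c * (nnr r (\<lambda>x. g (x - h) - g x) + nnr r (\<lambda>x. g x - f x))"
      unfolding c_def by (rule nnr_add) (use r in auto)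
    also have "\<dots> \<le> ennreal c * (ennreal \<delta>' + ennreal \<delta>')"
      using 1 gf by (intro mult_left_mono add_mono) auto
    finally have 3: "nnr r (\<lambda>x. g (x - h) - f x) \<le> ennreal (2 * c * \<delta>')"
      using c d' by (simp add: mult_ac flip: ennreal_plus ennreal_mult)
    have "nnr r (\<lambda>x. f (x - h) - f x) = nnr r (\<lambda>x. (g (x - h) - f x) - (g (x - h) - f (x - h)))" by simp
    also have "\<dots> \<le> ennreal c * (nnr r (\<lambda>x. g (x - h) - f x) + nnr r (\<lambda>x. g (x - h) - f (x - h)))"
      unfolding c_def by (rule nnr_diff) (use r in auto)
    also have "\<dots> \<le> ennreal c * (ennreal (2 * c * \<delta>') + ennreal \<delta>')"
      using 3 2 by (intro mult_left_mono add_mono) auto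
    also have "\<dots> = ennreal (c * (1 + 2 * c) * \<delta>')"
      using c d' by (simp add: algebra_simps flip: ennreal_plus ennreal_mult)
    also have "\<dots> = ennreal \<delta>"
    proof -
      have "c * (1 + 2 * c) \<noteq> 0" using c by (simp add: add_pos_pos less_imp_neq[THEN not_sym])
      then show ?thesis unfolding \<delta>'_def by simp
    qed
    finally show ?thesis .
  qed
  then show ?thesis using that[of "min 1 \<eta>"] n0 by auto
qed

section \<open>Mollification and convergence in L^r\<close>

text \<open>Serves as the convex function in Jensen's inequality. The triangle inequality reduces it
  to convexity of x^r on the positive reals; a vanishing argument is settled by s^r \<le> s on (0,
  1).\<close>

lemma convex_on_abs_powr:
  assumes r: "r \<ge> 1" shows "convex_on UNIV (\<lambda>t::real. \<bar>t\<bar> powr r)"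
proof (rule convex_onI)
  fix t x y :: real assume t: "0 < t" "t < 1"
  have c: "convex_on {0<..} (\<lambda>x::real. x powr r)" using r by (rule powr_convex)
  have "\<bar>(1 - t) *\<^sub>R x + t *\<^sub>R y\<bar> powr r \<le> ((1 - t) * \<bar>x\<bar> + t * \<bar>y\<bar>) powr r"
    using t r by (intro powr_mono2) (auto intro: order_trans[OF abs_triangle_ineq] simp: abs_mult)
  also have "\<dots> \<le> (1 - t) * \<bar>x\<bar> powr r + t * \<bar>y\<bar> powr r"
  proof (cases "x = 0 \<or> y = 0")
    case True
    have s: "s powr r \<le> s" if "0 < s" "s < 1" for s :: real
      using powr_mono'[of 1 r s] that r by simp
    show ?thesis using True s[of t] s[of "1 - t"] t r
      by (auto simp: powr_mult intro!: mult_right_mono)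
  next
    case False
    then show ?thesis using convex_onD[OF c, of t "\<bar>x\<bar>" "\<bar>y\<bar>"] t by simp
  qed
  finally show "\<bar>(1 - t) *\<^sub>R x + t *\<^sub>R y\<bar> powr r \<le> (1 - t) * \<bar>x\<bar> powr r + t * \<bar>y\<bar> powr r" .
qed simp

text \<open>Integrating over the unscaled variable keeps \<open>\<rho>\<close> itself as the
  probability density and exhibits the mollification as an average of translates by
  \<open>\<epsilon> *\<^sub>R y\<close>. The usual convolution with a rescaled kernel is recovered
  in \<open>moll_eq_conv\<close>.\<close>

definition moll :: "('a::euclidean_space \<Rightarrow> real) \<Rightarrow> real \<Rightarrow> ('a \<Rightarrow> real) \<Rightarrow> 'a \<Rightarrow> real" where
  "moll \<rho> \<epsilon> f x = (LINT y|lborel. f (x - \<epsilon> *\<^sub>R y) * \<rho> y)"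

definition mollifier :: "('a::euclidean_space \<Rightarrow> real) \<Rightarrow> bool" where
  "mollifier \<rho> \<longleftrightarrow> \<rho> \<in> test_functions \<and> (\<forall>x. \<rho> x \<ge> 0) \<and> (\<forall>x. norm x \<ge> 1 \<longrightarrow> \<rho> x = 0) \<and> (LINT x|lborel. \<rho> x) = 1"

lemma nnr_finite_integrable:
  assumes [measurable]: "f \<in> borel_measurable borel"
  shows "nnr r f < \<infinity> \<longleftrightarrow> integrable lborel (\<lambda>x. \<bar>f x\<bar> powr r)"
  by (simp add: integrable_iff_bounded nnr_def)

text \<open>The elementary reason why functions in L^r with \<open>r \<ge> 1\<close> are locally
  integrable.\<close>

lemma abs_le_one_plus_powr: "r \<ge> 1 \<Longrightarrow> \<bar>t\<bar> \<le> 1 + \<bar>t\<bar> powr r" for t r :: real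
  using powr_mono[of 1 r "\<bar>t\<bar>"] by (cases "\<bar>t\<bar> \<le> 1") (auto intro: add_increasing2)

context
  fixes \<rho> :: "'a::euclidean_space \<Rightarrow> real" assumes rho: "mollifier \<rho>"
begin

lemma mollifier_props: "\<rho> \<in> test_functions" "\<And>x. \<rho> x \<ge> 0" "\<And>x. norm x \<ge> 1 \<Longrightarrow> \<rho> x = 0"
  "(LINT x|lborel. \<rho> x) = 1" "integrable lborel \<rho>" "smooth \<rho>"
  using rho test_integrable test_smooth by (auto simp: mollifier_def)

lemma mollifier_meas: "\<rho> \<in> borel_measurable borel"
  by (simp add: mollifier_props smooth_measurable)

lemma moll_measurable:
  assumes [measurable]: "f \<in> borel_measurable borel" shows "moll \<rho> \<epsilon> f \<in> borel_measurable borel"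
proof -
  note [measurable] = mollifier_meas
  show ?thesis unfolding moll_def by measurable
qed

lemma moll_integrable:
  assumes [measurable]: "f \<in> borel_measurable borel" and fin: "nnr r f < \<infinity>" and r: "r \<ge> 1" and e: "\<epsilon> \<noteq> 0"
  shows "integrable lborel (\<lambda>y. \<bar>f (x - \<epsilon> *\<^sub>R y)\<bar> powr r * \<rho> y)" "integrable lborel (\<lambda>y. f (x - \<epsilon> *\<^sub>R y) * \<rho> y)"
proof -
  note [measurable] = mollifier_meas
  obtain B where B: "\<And>x. \<bar>\<rho> x\<bar> \<le> B" using test_bounded mollifier_props(1) by metis
  have "integrable lborel (\<lambda>y. \<bar>f (x + (-\<epsilon>) *\<^sub>R y)\<bar> powr r)"
    using fin e assms(1) nnr_finite_integrable[of f r] by (intro integrable_affine[where f="\<lambda>x. \<bar>f x\<bar> powr r"]) auto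
  then have 1: "integrable lborel (\<lambda>y. \<bar>f (x - \<epsilon> *\<^sub>R y)\<bar> powr r * B)" by simp
  show 2: "integrable lborel (\<lambda>y. \<bar>f (x - \<epsilon> *\<^sub>R y)\<bar> powr r * \<rho> y)"
    by (rule Bochner_Integration.integrable_bound[OF 1])
       (auto intro!: AE_I2 mult_left_mono simp: abs_mult intro: order_trans[OF B abs_ge_self])
  have 3: "integrable lborel (\<lambda>y. \<rho> y + \<bar>f (x - \<epsilon> *\<^sub>R y)\<bar> powr r * \<rho> y)"
    by (intro Bochner_Integration.integrable_add 2 mollifier_props)
  show "integrable lborel (\<lambda>y. f (x - \<epsilon> *\<^sub>R y) * \<rho> y)"
  proof (rule Bochner_Integration.integrable_bound[OF 3])
    show "AE y in lborel. norm (f (x - \<epsilon> *\<^sub>R y) * \<rho> y) \<le> norm (\<rho> y + \<bar>f (x - \<epsilon> *\<^sub>R y)\<bar> powr r * \<rho> y)"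
    proof (rule AE_I2)
      fix y
      have "\<bar>f (x - \<epsilon> *\<^sub>R y)\<bar> * \<rho> y \<le> (1 + \<bar>f (x - \<epsilon> *\<^sub>R y)\<bar> powr r) * \<rho> y"
        by (intro mult_right_mono abs_le_one_plus_powr r mollifier_props)
      then show "norm (f (x - \<epsilon> *\<^sub>R y) * \<rho> y) \<le> norm (\<rho> y + \<bar>f (x - \<epsilon> *\<^sub>R y)\<bar> powr r * \<rho> y)"
        using mollifier_props(2)[of y] by (simp add: abs_mult distrib_right)
    qed
  qed auto
qed

text \<open>Jensen's inequality for the probability measure with density \<open>\<rho>\<close>,
  applied to the random variable f(x - \<epsilon> y) - f(x), whose mean is the mollification
  error.\<close>

lemma moll_jensen:
  assumes m[measurable]: "f \<in> borel_measurable borel" and fin: "nnr r f < \<infinity>" and r: "r \<ge> 1" and e: "\<epsilon> \<noteq> 0"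
  shows "ennreal (\<bar>moll \<rho> \<epsilon> f x - f x\<bar> powr r) \<le> (\<integral>\<^sup>+y. ennreal (\<bar>f (x - \<epsilon> *\<^sub>R y) - f x\<bar> powr r) * ennreal (\<rho> y) \<partial>lborel)"
proof -
  note p = mollifier_props
  note [measurable] = mollifier_meas moll_measurable
  let ?M = "density lborel (\<lambda>y. ennreal (\<rho> y))"
  interpret prob_space ?M
  proof
    have "emeasure ?M (space ?M) = (\<integral>\<^sup>+y. ennreal (\<rho> y) \<partial>lborel)"
      by (simp add: emeasure_density)
    also have "\<dots> = 1" using nn_integral_eq_integral[OF p(5)] p(2,4) by simp
    finally show "emeasure ?M (space ?M) = 1" .
  qed
  let ?X = "\<lambda>y. f (x - \<epsilon> *\<^sub>R y) - f x"
  have i: "integrable lborel (\<lambda>y. ?X y * \<rho> y)"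
    using moll_integrable(2)[OF m fin r e, of x] p(5) by (simp add: left_diff_distrib)
  have iX: "integrable ?M ?X"
    using i p(2) by (subst integrable_real_density) (auto simp: mult.commute)
  have X: "expectation ?X = moll \<rho> \<epsilon> f x - f x"
    using moll_integrable(2)[OF m fin r e, of x] p(2,4,5)
    by (subst integral_real_density) (auto simp: moll_def right_diff_distrib mult.commute)
  have "2 powr r * (\<bar>f (x - \<epsilon> *\<^sub>R y)\<bar> powr r * \<rho> y) + (2 powr r * \<bar>f x\<bar> powr r) * \<rho> y \<ge> \<bar>?X y\<bar> powr r * \<rho> y" for y
    using mult_right_mono[OF powr_add_bound[of r "f (x - \<epsilon> *\<^sub>R y)" "- f x"] p(2)[of y]] r by (simp add: algebra_simps)
  moreover have "integrable lborel (\<lambda>y. 2 powr r * (\<bar>f (x - \<epsilon> *\<^sub>R y)\<bar> powr r * \<rho> y) + (2 powr r * \<bar>f x\<bar> powr r) * \<rho> y)"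
    using moll_integrable(1)[OF m fin r e] p(5) by (intro Bochner_Integration.integrable_add integrable_mult_right)
  ultimately have ip: "integrable lborel (\<lambda>y. \<bar>?X y\<bar> powr r * \<rho> y)"
    by (rule_tac Bochner_Integration.integrable_bound)
       (use p(2) in \<open>auto simp: abs_mult intro!: AE_I2 intro: order_trans[OF _ abs_ge_self]\<close>)
  have ipM: "integrable ?M (\<lambda>y. \<bar>?X y\<bar> powr r)"
    using ip p(2) by (subst integrable_real_density) (auto simp: mult.commute)
  have "\<bar>expectation ?X\<bar> powr r \<le> expectation (\<lambda>y. \<bar>?X y\<bar> powr r)"
    by (rule jensens_inequality[OF iX _ _ ipM, of UNIV]) (use convex_on_abs_powr[OF r] in auto)
  then have "ennreal (\<bar>moll \<rho> \<epsilon> f x - f x\<bar> powr r) \<le> ennreal (LINT y|lborel. \<bar>?X y\<bar> powr r * \<rho> y)"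
    using p(2) unfolding X by (subst (asm) integral_real_density) (auto simp: mult.commute intro: ennreal_leI)
  also have "\<dots> = (\<integral>\<^sup>+y. ennreal (\<bar>?X y\<bar> powr r * \<rho> y) \<partial>lborel)"
    using ip p(2) by (intro nn_integral_eq_integral[symmetric]) auto
  finally show ?thesis using p(2) by (simp add: ennreal_mult)
qed

text \<open>Integrating the Jensen bound in \<open>x\<close> and exchanging the integrals leaves an
  average over \<open>y\<close> of translation errors. All shifts are shorter than
  \<open>\<epsilon>\<close>, since \<open>\<rho>\<close> vanishes off the open unit ball.\<close>

lemma moll_diff_bound:
  assumes m[measurable]: "f \<in> borel_measurable borel" and fin: "nnr r f < \<infinity>" and r: "r \<ge> 1" and e: "\<epsilon> > 0"
    and C: "\<And>h. norm h < \<epsilon> \<Longrightarrow> nnr r (\<lambda>x. f (x - h) - f x) \<le> C"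
  shows "nnr r (\<lambda>x. moll \<rho> \<epsilon> f x - f x) \<le> C"
proof -
  note p = mollifier_props
  note [measurable] = mollifier_meas moll_measurable
  have "nnr r (\<lambda>x. moll \<rho> \<epsilon> f x - f x) \<le>
      (\<integral>\<^sup>+x. (\<integral>\<^sup>+y. ennreal (\<bar>f (x - \<epsilon> *\<^sub>R y) - f x\<bar> powr r) * ennreal (\<rho> y) \<partial>lborel) \<partial>lborel)"
    unfolding nnr_def using moll_jensen[OF m fin r] e by (intro nn_integral_mono) auto
  also have "\<dots> = (\<integral>\<^sup>+y. (\<integral>\<^sup>+x. ennreal (\<bar>f (x - \<epsilon> *\<^sub>R y) - f x\<bar> powr r) * ennreal (\<rho> y) \<partial>lborel) \<partial>lborel)"
    by (rule lborel_pair.Fubini') measurable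
  also have "\<dots> \<le> (\<integral>\<^sup>+y. C * ennreal (\<rho> y) \<partial>lborel)"
  proof (intro nn_integral_mono)
    fix y
    show "(\<integral>\<^sup>+x. ennreal (\<bar>f (x - \<epsilon> *\<^sub>R y) - f x\<bar> powr r) * ennreal (\<rho> y) \<partial>lborel) \<le> C * ennreal (\<rho> y)"
    proof (cases "norm y < 1")
      case True
      have "nnr r (\<lambda>x. f (x - \<epsilon> *\<^sub>R y) - f x) \<le> C" using True e by (intro C) auto
      then show ?thesis unfolding nnr_def by (subst nn_integral_multc) (auto intro: mult_right_mono)
    next
      case False
      then show ?thesis using p(3)[of y] by simp
    qed
  qed
  also have "\<dots> = C * (\<integral>\<^sup>+y. ennreal (\<rho> y) \<partial>lborel)" by (rule nn_integral_cmult) auto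
  also have "(\<integral>\<^sup>+y. ennreal (\<rho> y) \<partial>lborel) = 1" using nn_integral_eq_integral[OF p(5)] p(2,4) by simp
  finally show ?thesis by simp
qed

end

text \<open>Convergence in L^r. Finiteness of the limit and of every difference is built in, so that
  it can be turned into a statement about real integrals.\<close>

definition Lto :: "real \<Rightarrow> (nat \<Rightarrow> 'a::euclidean_space \<Rightarrow> real) \<Rightarrow> ('a \<Rightarrow> real) \<Rightarrow> bool" where
  "Lto r F f \<longleftrightarrow> (\<forall>k. F k \<in> borel_measurable borel) \<and> f \<in> borel_measurable borel \<and> nnr r f < \<infinity> \<and>
     (\<forall>k. nnr r (\<lambda>x. F k x - f x) < \<infinity>) \<and> (\<lambda>k. nnr r (\<lambda>x. F k x - f x)) \<longlonglongrightarrow> 0"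

text \<open>\<open>moll_diff_bound\<close> serves twice: with a crude bound on all translates for
  the finiteness of each difference, and with the continuity of translation for the limit.\<close>

lemma Lto_moll:
  assumes rho: "mollifier \<rho>" and m[measurable]: "f \<in> borel_measurable borel" and fin: "nnr r f < \<infinity>" and r: "r \<ge> 1"
  shows "Lto r (\<lambda>k. moll \<rho> (1 / (real k + 1)) f) f"
proof -
  have "nnr r (\<lambda>x. moll \<rho> (1 / (real k + 1)) f x - f x) < \<infinity>" for k
  proof -
    have "nnr r (\<lambda>x. f (x - h) - f x) \<le> ennreal (2 powr r) * (nnr r f + nnr r f)" for h
      using nnr_diff[of "\<lambda>x. f (x - h)" f r] r nnr_shift[OF m] by simp
    then have "nnr r (\<lambda>x. moll \<rho> (1 / (real k + 1)) f x - f x) \<le> ennreal (2 powr r) * (nnr r f + nnr r f)"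
      by (intro moll_diff_bound[OF rho m fin r]) auto
    also have "\<dots> < \<infinity>" using fin by (simp add: ennreal_mult_less_top)
    finally show ?thesis .
  qed
  moreover have "(\<lambda>k. nnr r (\<lambda>x. moll \<rho> (1 / (real k + 1)) f x - f x)) \<longlonglongrightarrow> 0"
  proof (rule order_tendstoI)
    fix a :: ennreal assume "0 < a"
    then obtain \<delta> where d: "0 < ennreal \<delta>" "ennreal \<delta> < a" by (metis dense ennreal_cases top.not_eq_extremum order_top_class.not_top_less top.extremum_strict less_trans)
    then have "\<delta> > 0" by simp
    obtain \<eta> where n: "\<eta> > 0" "\<And>h. norm h < \<eta> \<Longrightarrow> nnr r (\<lambda>x. f (x - h) - f x) \<le> ennreal \<delta>"
      using nnr_translation[OF m fin _ \<open>\<delta> > 0\<close>] r by auto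
    have "\<forall>\<^sub>F k in sequentially. 1 / (real k + 1) < \<eta>"
      using LIMSEQ_inverse_real_of_nat n(1) by (intro order_tendstoD) (auto simp: inverse_eq_divide add.commute)
    then show "\<forall>\<^sub>F k in sequentially. nnr r (\<lambda>x. moll \<rho> (1 / (real k + 1)) f x - f x) < a"
    proof eventually_elim
      case (elim k)
      have "nnr r (\<lambda>x. moll \<rho> (1 / (real k + 1)) f x - f x) \<le> ennreal \<delta>"
        by (rule moll_diff_bound[OF rho m fin r]) (use n(2) elim in auto)
      then show ?case using d by simp
    qed
  qed simp
  ultimately show ?thesis using assms by (auto simp: Lto_def intro: moll_measurable)
qed

lemma nnr_mult_bounded:
  assumes [measurable]: "f \<in> borel_measurable borel" and B: "\<And>x. \<bar>w x\<bar> \<le> B" and r: "r \<ge> 0"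
  shows "nnr r (\<lambda>x. w x * f x) \<le> ennreal (B powr r) * nnr r f"
proof -
  have "nnr r (\<lambda>x. w x * f x) \<le> (\<integral>\<^sup>+x. ennreal (B powr r) * ennreal (\<bar>f x\<bar> powr r) \<partial>lborel)"
    unfolding nnr_def using B r
    by (intro nn_integral_mono)
       (auto simp: abs_mult powr_mult intro!: ennreal_leI mult_right_mono powr_mono2 simp flip: ennreal_mult)
  then show ?thesis by (simp add: nnr_def nn_integral_cmult)
qed

lemma tendsto_zero_sandwich_ennreal:
  fixes X Y :: "nat \<Rightarrow> ennreal"
  assumes "Y \<longlonglongrightarrow> 0" "\<And>k. X k \<le> ennreal c * Y k"
  shows "X \<longlonglongrightarrow> 0"
proof (rule tendsto_sandwich[of "\<lambda>_. 0" X sequentially "\<lambda>k. ennreal c * Y k"])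
  have "(\<lambda>k. ennreal c * Y k) \<longlonglongrightarrow> ennreal c * 0"
    by (rule ennreal_tendsto_cmult) (use assms in auto)
  then show "(\<lambda>k. ennreal c * Y k) \<longlonglongrightarrow> 0" by simp
qed (use assms in auto)

lemma Lto_add:
  assumes F: "Lto r F f" and G: "Lto r G g" and r: "r \<ge> 0"
  shows "Lto r (\<lambda>k x. F k x + G k x) (\<lambda>x. f x + g x)"
proof -
  have [measurable]: "F k \<in> borel_measurable borel" "G k \<in> borel_measurable borel" "f \<in> borel_measurable borel"
    "g \<in> borel_measurable borel" for k using F G by (auto simp: Lto_def)
  have b: "nnr r (\<lambda>x. (F k x + G k x) - (f x + g x)) \<le> ennreal (2 powr r) * (nnr r (\<lambda>x. F k x - f x) + nnr r (\<lambda>x. G k x - g x))" for k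
    using nnr_add[of "\<lambda>x. F k x - f x" "\<lambda>x. G k x - g x" r] r by (simp add: algebra_simps)
  have "(\<lambda>k. nnr r (\<lambda>x. F k x - f x) + nnr r (\<lambda>x. G k x - g x)) \<longlonglongrightarrow> 0"
    using F G tendsto_add[of _ "0::ennreal" sequentially _ 0] by (auto simp: Lto_def)
  from tendsto_zero_sandwich_ennreal[OF this b]
  have "(\<lambda>k. nnr r (\<lambda>x. (F k x + G k x) - (f x + g x))) \<longlonglongrightarrow> 0" .
  moreover have "nnr r (\<lambda>x. (F k x + G k x) - (f x + g x)) < \<infinity>" for k
    by (rule le_less_trans[OF b]) (use F G in \<open>auto simp: Lto_def ennreal_mult_less_top\<close>)
  moreover have "nnr r (\<lambda>x. f x + g x) < \<infinity>"
    by (rule le_less_trans[OF nnr_add]) (use F G r in \<open>auto simp: Lto_def ennreal_mult_less_top\<close>)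
  ultimately show ?thesis by (auto simp: Lto_def)
qed

lemma Lto_mult_bounded:
  assumes F: "Lto r F f" and [measurable]: "w \<in> borel_measurable borel" and B: "\<And>x. \<bar>w x\<bar> \<le> B" and r: "r \<ge> 0"
  shows "Lto r (\<lambda>k x. w x * F k x) (\<lambda>x. w x * f x)"
proof -
  have [measurable]: "F k \<in> borel_measurable borel" "f \<in> borel_measurable borel" for k using F by (auto simp: Lto_def)
  have b: "nnr r (\<lambda>x. w x * F k x - w x * f x) \<le> ennreal (B powr r) * nnr r (\<lambda>x. F k x - f x)" for k
    using nnr_mult_bounded[of "\<lambda>x. F k x - f x" w B r] B r by (simp add: algebra_simps)
  have "(\<lambda>k. nnr r (\<lambda>x. F k x - f x)) \<longlonglongrightarrow> 0"
    using F by (auto simp: Lto_def)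
  from tendsto_zero_sandwich_ennreal[OF this b]
  have "(\<lambda>k. nnr r (\<lambda>x. w x * F k x - w x * f x)) \<longlonglongrightarrow> 0" .
  moreover have "nnr r (\<lambda>x. w x * F k x - w x * f x) < \<infinity>" for k
    by (rule le_less_trans[OF b]) (use F in \<open>auto simp: Lto_def ennreal_mult_less_top\<close>)
  moreover have "nnr r (\<lambda>x. w x * f x) < \<infinity>"
    by (rule le_less_trans[OF nnr_mult_bounded]) (use F B r in \<open>auto simp: Lto_def ennreal_mult_less_top\<close>)
  ultimately show ?thesis by (auto simp: Lto_def)
qed

lemma nnr_scale:
  fixes f :: "'a::euclidean_space \<Rightarrow> real"
  assumes "f \<in> borel_measurable borel" and l: "l > 0"
  shows "nnr r (\<lambda>x. f (l *\<^sub>R x)) = ennreal ((1 / l) ^ DIM('a)) * nnr r f"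
proof -
  have "nnr r f = ennreal (l ^ DIM('a)) * nnr r (\<lambda>x. f (l *\<^sub>R x))"
    using nnr_affine[OF assms(1), of l r 0] l by simp
  then have "ennreal ((1 / l) ^ DIM('a)) * nnr r f = (ennreal ((1 / l) ^ DIM('a)) * ennreal (l ^ DIM('a))) * nnr r (\<lambda>x. f (l *\<^sub>R x))"
    by (simp add: mult.assoc)
  also have "ennreal ((1 / l) ^ DIM('a)) * ennreal (l ^ DIM('a)) = 1"
    using l by (simp add: power_mult_distrib[symmetric] flip: ennreal_mult)
  finally show ?thesis by simp
qed

lemma Lto_scale:
  fixes f :: "'a::euclidean_space \<Rightarrow> real"
  assumes F: "Lto r F f" and l: "l > 0"
  shows "Lto r (\<lambda>k x. F k (l *\<^sub>R x)) (\<lambda>x. f (l *\<^sub>R x))"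
proof -
  have [measurable]: "F k \<in> borel_measurable borel" "f \<in> borel_measurable borel" for k using F by (auto simp: Lto_def)
  have b: "nnr r (\<lambda>x. F k (l *\<^sub>R x) - f (l *\<^sub>R x)) = ennreal ((1 / l) ^ DIM('a)) * nnr r (\<lambda>x. F k x - f x)" for k
    by (rule nnr_scale) (use l in auto)
  have "(\<lambda>k. nnr r (\<lambda>x. F k x - f x)) \<longlonglongrightarrow> 0"
    using F by (auto simp: Lto_def)
  from tendsto_zero_sandwich_ennreal[OF this eq_refl[OF b]]
  have "(\<lambda>k. nnr r (\<lambda>x. F k (l *\<^sub>R x) - f (l *\<^sub>R x))) \<longlonglongrightarrow> 0" .
  then show ?thesis using F by (auto simp: Lto_def b nnr_scale[OF _ l] ennreal_mult_less_top)
qed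

lemma Lto_real:
  assumes F: "Lto r F f"
  shows "integrable lborel (\<lambda>x. \<bar>F k x - f x\<bar> powr r)" "(\<lambda>k. LINT x|lborel. \<bar>F k x - f x\<bar> powr r) \<longlonglongrightarrow> 0"
    "integrable lborel (\<lambda>x. \<bar>f x\<bar> powr r)"
proof -
  have [measurable]: "F k \<in> borel_measurable borel" "f \<in> borel_measurable borel" for k using F by (auto simp: Lto_def)
  show 1: "integrable lborel (\<lambda>x. \<bar>F k x - f x\<bar> powr r)" for k
    using F nnr_finite_integrable[of "\<lambda>x. F k x - f x" r] by (auto simp: Lto_def)
  have "nnr r (\<lambda>x. F k x - f x) = ennreal (LINT x|lborel. \<bar>F k x - f x\<bar> powr r)" for k
    unfolding nnr_def by (rule nn_integral_eq_integral[OF 1]) auto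
  then have "(\<lambda>k. ennreal (LINT x|lborel. \<bar>F k x - f x\<bar> powr r)) \<longlonglongrightarrow> ennreal 0"
    using F by (simp add: Lto_def)
  then show "(\<lambda>k. LINT x|lborel. \<bar>F k x - f x\<bar> powr r) \<longlonglongrightarrow> 0"
    by (subst (asm) tendsto_ennreal_iff) auto
  show "integrable lborel (\<lambda>x. \<bar>f x\<bar> powr r)"
    using F nnr_finite_integrable[of f r] by (auto simp: Lto_def)
qed

section \<open>Weighted Young inequality and convergence of pairings\<close>

text \<open>Takes the place of Hoelder's inequality: the free parameter \<open>\<delta>\<close>
  shifts smallness from one term to the other. The factors 1/s and 1/r of Young's inequality are
  bounded by 1.\<close>

lemma young_scaled:
  fixes a b :: real
  assumes r: "r > 1" and s: "s > 1" "1 / s + 1 / r = 1" and d: "\<delta> > 0"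
  shows "\<bar>a * b\<bar> \<le> \<delta> powr s * \<bar>a\<bar> powr s + \<delta> powr (-r) * \<bar>b\<bar> powr r"
proof -
  have "\<bar>a * b\<bar> = (\<delta> * \<bar>a\<bar>) * (\<bar>b\<bar> / \<delta>)" using d by (simp add: abs_mult)
  also have "\<dots> \<le> (\<delta> * \<bar>a\<bar>) powr s / s + (\<bar>b\<bar> / \<delta>) powr r / r"
    using r s d by (intro Youngs_inequality) auto
  also have "\<dots> \<le> (\<delta> * \<bar>a\<bar>) powr s + (\<bar>b\<bar> / \<delta>) powr r"
  proof -
    have "x / t \<le> x" if "t > 1" "x \<ge> 0" for x t :: real
      using divide_left_mono[of 1 t x] that by simp
    then show ?thesis using r s by (intro add_mono) auto
  qed
  also have "\<dots> = \<delta> powr s * \<bar>a\<bar> powr s + \<delta> powr (-r) * \<bar>b\<bar> powr r"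
    using d by (simp add: powr_mult powr_divide powr_minus_divide)
  finally show ?thesis .
qed

lemma young_integrable:
  fixes f g :: "'a::euclidean_space \<Rightarrow> real"
  assumes [measurable]: "f \<in> borel_measurable borel" "g \<in> borel_measurable borel"
    and r: "r > 1" and s: "s > 1" "1 / s + 1 / r = 1"
    and i: "integrable lborel (\<lambda>x. \<bar>g x\<bar> powr s)" "integrable lborel (\<lambda>x. \<bar>f x\<bar> powr r)"
  shows "integrable lborel (\<lambda>x. g x * f x)"
proof (rule Bochner_Integration.integrable_bound)
  show "integrable lborel (\<lambda>x. \<bar>g x\<bar> powr s + \<bar>f x\<bar> powr r)" using i by simp
  show "AE x in lborel. norm (g x * f x) \<le> norm (\<bar>g x\<bar> powr s + \<bar>f x\<bar> powr r)"
    using young_scaled[OF r s, of 1] by auto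
qed auto

text \<open>The error splits into \<delta>^s times a fixed integral of \<open>g\<close> and a
  multiple, depending on \<delta>, of an integral that tends to 0; \<delta> is fixed first, then
  \<open>k\<close> is taken large.\<close>

lemma Lto_pairing:
  fixes f :: "'a::euclidean_space \<Rightarrow> real"
  assumes F: "Lto r F f" and r: "r > 1" and s: "s > 1" "1 / s + 1 / r = 1"
    and g[measurable]: "g \<in> borel_measurable borel" and gi: "integrable lborel (\<lambda>x. \<bar>g x\<bar> powr s)"
  shows "integrable lborel (\<lambda>x. g x * f x)" "integrable lborel (\<lambda>x. g x * F k x)"
    "(\<lambda>k. LINT x|lborel. g x * F k x) \<longlonglongrightarrow> (LINT x|lborel. g x * f x)"
proof -
  have [measurable]: "F k \<in> borel_measurable borel" "f \<in> borel_measurable borel" for k using F by (auto simp: Lto_def)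
  note L = Lto_real[OF F]
  show 1: "integrable lborel (\<lambda>x. g x * f x)"
    by (rule young_integrable[OF _ _ r s gi L(3)]) auto
  have D: "integrable lborel (\<lambda>x. g x * (F k x - f x))" for k
    by (rule young_integrable[OF _ _ r s gi L(1)]) auto
  have 2: "integrable lborel (\<lambda>x. g x * F k x)" for k
    using Bochner_Integration.integrable_add[OF D[of k] 1] by (simp add: algebra_simps)
  then show "integrable lborel (\<lambda>x. g x * F k x)" .
  define A where "A = (LINT x|lborel. \<bar>g x\<bar> powr s)"
  have A: "A \<ge> 0" by (simp add: A_def)
  let ?J = "\<lambda>k. LINT x|lborel. \<bar>F k x - f x\<bar> powr r"
  have bd: "\<bar>LINT x|lborel. g x * (F k x - f x)\<bar> \<le> \<delta> powr s * A + \<delta> powr (-r) * ?J k" if "\<delta> > 0" for \<delta> k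
  proof -
    have "\<bar>LINT x|lborel. g x * (F k x - f x)\<bar> \<le> (LINT x|lborel. \<bar>g x * (F k x - f x)\<bar>)"
      by (rule integral_abs_bound)
    also have "\<dots> \<le> (LINT x|lborel. \<delta> powr s * \<bar>g x\<bar> powr s + \<delta> powr (-r) * \<bar>F k x - f x\<bar> powr r)"
      using D[of k] gi L(1)[of k] young_scaled[OF r s that]
      by (intro integral_mono Bochner_Integration.integrable_add integrable_mult_right integrable_abs) auto
    also have "\<dots> = \<delta> powr s * A + \<delta> powr (-r) * ?J k"
      using gi L(1)[of k] by (simp add: A_def)
    finally show ?thesis .
  qed
  have "(\<lambda>k. LINT x|lborel. g x * (F k x - f x)) \<longlonglongrightarrow> 0"
  proof (rule LIMSEQ_I)
    fix e :: real assume e: "e > 0"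
    \<comment> \<open>Chosen so that \<open>\<delta> powr s * (A + 1)\<close> is e/2; with
      \<open>A + 1\<close> in place of \<open>A\<close> the bound on
      \<open>\<delta> powr s * A\<close> is strict and \<open>A = 0\<close> is covered.\<close>
    define \<delta> where "\<delta> = (e / (2 * (A + 1))) powr (1 / s)"
    have d: "\<delta> > 0" using e A by (simp add: \<delta>_def)
    have "\<delta> powr s = e / (2 * (A + 1))" using e A s by (simp add: \<delta>_def powr_powr)
    then have "\<delta> powr s * A = e / 2 - \<delta> powr s" using e A by (simp add: field_simps)
    then have dA: "\<delta> powr s * A < e / 2" using d by simp
    have "(\<lambda>k. \<delta> powr (-r) * ?J k) \<longlonglongrightarrow> \<delta> powr (-r) * 0" by (intro tendsto_intros L)
    then have "\<forall>\<^sub>F k in sequentially. \<delta> powr (-r) * ?J k < e / 2"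
      using e by (intro order_tendstoD) auto
    then obtain n where "\<And>k. k \<ge> n \<Longrightarrow> \<delta> powr (-r) * ?J k < e / 2" by (auto simp: eventually_sequentially)
    then show "\<exists>n. \<forall>k\<ge>n. norm ((LINT x|lborel. g x * (F k x - f x)) - 0) < e"
      using bd[OF d] dA by (intro exI[of _ n]) (smt (verit) field_sum_of_halves mult_cancel_left2 real_norm_def)
  qed
  then have "(\<lambda>k. (LINT x|lborel. g x * (F k x - f x)) + (LINT x|lborel. g x * f x)) \<longlonglongrightarrow> 0 + (LINT x|lborel. g x * f x)"
    by (intro tendsto_intros)
  then show "(\<lambda>k. LINT x|lborel. g x * F k x) \<longlonglongrightarrow> (LINT x|lborel. g x * f x)"
    using 1 2 by (simp add: right_diff_distrib)
qed

section \<open>Smoothness of convolutions\<close>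

definition locint :: "('a::euclidean_space \<Rightarrow> real) \<Rightarrow> bool" where
  "locint f \<longleftrightarrow> f \<in> borel_measurable borel \<and> (\<forall>R. integrable lborel (\<lambda>y. indicator (cball 0 R) y * f y))"

lemma nnr_locint:
  fixes f :: "'a::euclidean_space \<Rightarrow> real"
  assumes [measurable]: "f \<in> borel_measurable borel" and fin: "nnr r f < \<infinity>" and r: "r \<ge> 1"
  shows "locint f"
  unfolding locint_def
proof (intro conjI allI)
  fix R :: real
  have [measurable]: "cball (0::'a) R \<in> sets borel" by simp
  have 1: "integrable lborel (\<lambda>y. \<bar>f y\<bar> powr r)" using fin nnr_finite_integrable[of f r] by simp
  have 2: "integrable lborel (\<lambda>y::'a. indicator (cball 0 R) y :: real)"
    by (intro integrable_real_indicator emeasure_lborel_cball_finite) auto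
  show "integrable lborel (\<lambda>y. indicator (cball 0 R) y * f y)"
    by (rule Bochner_Integration.integrable_bound[OF Bochner_Integration.integrable_add[OF 2 1]])
       (use abs_le_one_plus_powr[OF r] in \<open>auto simp: indicator_def abs_of_nonneg\<close>)
qed simp

text \<open>The first factor will be merely locally integrable, so all derivatives are made to fall
  on the second, a test function.\<close>

definition conv :: "('a::euclidean_space \<Rightarrow> real) \<Rightarrow> ('a \<Rightarrow> real) \<Rightarrow> 'a \<Rightarrow> real" where
  "conv f \<phi> x = (LINT y|lborel. f y * \<phi> (x - y))"

lemma locint_bounded_integrable:
  fixes f :: "'a::euclidean_space \<Rightarrow> real"
  assumes f: "locint f" and [measurable]: "g \<in> borel_measurable borel" and B: "\<And>y. \<bar>g y\<bar> \<le> B"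
    and R: "\<And>y. norm y > R \<Longrightarrow> g y = 0"
  shows "integrable lborel (\<lambda>y. f y * g y)"
proof (rule Bochner_Integration.integrable_bound)
  have [measurable]: "f \<in> borel_measurable borel" using f by (simp add: locint_def)
  show "integrable lborel (\<lambda>y. B * \<bar>indicator (cball 0 R) y * f y\<bar>)"
    using f by (auto simp: locint_def)
  show "AE y in lborel. norm (f y * g y) \<le> norm (B * \<bar>indicator (cball 0 R) y * f y\<bar>)"
  proof (rule AE_I2)
    fix y
    have "\<bar>f y\<bar> * \<bar>g y\<bar> \<le> \<bar>f y\<bar> * \<bar>B\<bar>" using B[of y] by (intro mult_left_mono) auto
    then show "norm (f y * g y) \<le> norm (B * \<bar>indicator (cball 0 R) y * f y\<bar>)"
      using R[of y] by (cases "norm y \<le> R") (auto simp: abs_mult mult.commute)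
  qed
  show "(\<lambda>y. f y * g y) \<in> borel_measurable lborel" by simp
qed

lemma conv_integrable:
  assumes f: "locint f" and p: "\<phi> \<in> test_functions"
  shows "integrable lborel (\<lambda>y. f y * \<phi> (x - y))"
proof -
  have t: "(\<lambda>y. \<phi> ((-1) *\<^sub>R y + x)) \<in> test_functions" by (rule test_affine[OF p]) simp
  obtain B where "\<And>y. \<bar>\<phi> ((-1) *\<^sub>R y + x)\<bar> \<le> B" using test_bounded[OF t] by metis
  moreover obtain R where "\<And>y. norm y > R \<Longrightarrow> \<phi> ((-1) *\<^sub>R y + x) = 0" using t by (auto simp: test_functions_iff)
  ultimately have "integrable lborel (\<lambda>y. f y * \<phi> ((-1) *\<^sub>R y + x))"
    using smooth_measurable[OF test_smooth[OF t]] by (intro locint_bounded_integrable[OF f]) auto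
  then show ?thesis by simp
qed

lemma smooth_mvt:
  assumes p: "smooth \<phi>"
  obtains t where "0 < t" "t < 1" "\<phi> (a + h) - \<phi> a = frechet_derivative \<phi> (at (a + t *\<^sub>R h)) h"
proof -
  have "((\<lambda>t. \<phi> (a + t *\<^sub>R h)) has_derivative (\<lambda>s. frechet_derivative \<phi> (at (a + t *\<^sub>R h)) (s *\<^sub>R h))) (at t within {0..1})" for t
    by (rule has_derivative_compose[OF _ smooth_has_derivative[OF p]])
       (auto intro!: derivative_eq_intros)
  from mvt_simple[OF zero_less_one this]
  obtain t where "t \<in> {0<..<1}" "\<phi> (a + 1 *\<^sub>R h) - \<phi> (a + 0 *\<^sub>R h) = frechet_derivative \<phi> (at (a + t *\<^sub>R h)) ((1 - 0) *\<^sub>R h)"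
    by blast
  then show ?thesis using that[of t] by simp
qed

text \<open>Mean value theorem twice: for \<open>\<phi>\<close> along the segment and for its
  partial derivatives. Uniformity in the base point is what permits differentiation under the
  integral against a merely locally integrable function.\<close>

lemma test_taylor:
  fixes \<phi> :: "'a::euclidean_space \<Rightarrow> real"
  assumes p: "\<phi> \<in> test_functions"
  obtains C where "C \<ge> 0" "\<And>a h. \<bar>\<phi> (a + h) - \<phi> a - frechet_derivative \<phi> (at a) h\<bar> \<le> C * (norm h)\<^sup>2"
proof -
  have s: "smooth \<phi>" using p by (rule test_smooth)
  have "\<exists>B>0. \<forall>a k. \<bar>pd \<phi> i (a + k) - pd \<phi> i a\<bar> \<le> B * norm k" if i: "i \<in> Basis" for i
  proof -
    obtain B where B: "B > 0" "\<And>x h. \<bar>frechet_derivative (pd \<phi> i) (at x) h\<bar> \<le> B * norm h"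
      using pd_bound[OF test_pd[OF p i]] by metis
    have "\<bar>pd \<phi> i (a + k) - pd \<phi> i a\<bar> \<le> B * norm k" for a k
      using smooth_mvt[OF smooth_pd[OF s i], of a k] B(2) by metis
    then show ?thesis using B by blast
  qed
  then obtain B where B: "\<And>i. i \<in> Basis \<Longrightarrow> B i > 0"
    "\<And>i a k. i \<in> Basis \<Longrightarrow> \<bar>pd \<phi> i (a + k) - pd \<phi> i a\<bar> \<le> B i * norm k" by metis
  have "\<bar>\<phi> (a + h) - \<phi> a - frechet_derivative \<phi> (at a) h\<bar> \<le> (\<Sum>i\<in>Basis. B i) * (norm h)\<^sup>2" for a h
  proof -
    obtain t where t: "0 < t" "t < 1" "\<phi> (a + h) - \<phi> a = frechet_derivative \<phi> (at (a + t *\<^sub>R h)) h"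
      using smooth_mvt[OF s] by metis
    have "frechet_derivative \<phi> (at x) h = (\<Sum>i\<in>Basis. (h \<bullet> i) * pd \<phi> i x)" for x
      by (rule pd_expand[OF s])
    then have "\<phi> (a + h) - \<phi> a - frechet_derivative \<phi> (at a) h
       = (\<Sum>i\<in>Basis. (h \<bullet> i) * (pd \<phi> i (a + t *\<^sub>R h) - pd \<phi> i a))"
      using t by (simp add: sum_subtractf right_diff_distrib)
    also have "\<bar>\<dots>\<bar> \<le> (\<Sum>i\<in>Basis. norm h * (B i * norm h))"
    proof (rule order_trans[OF sum_abs sum_mono])
      fix i :: 'a assume i: "i \<in> Basis"
      have "B i * norm (t *\<^sub>R h) \<le> B i * norm h" using B(1)[OF i] t
        by (intro mult_left_mono) (auto intro: mult_left_le_one_le)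
      then have "\<bar>pd \<phi> i (a + t *\<^sub>R h) - pd \<phi> i a\<bar> \<le> B i * norm h" using B(2)[OF i] order_trans by blast
      then show "\<bar>(h \<bullet> i) * (pd \<phi> i (a + t *\<^sub>R h) - pd \<phi> i a)\<bar> \<le> norm h * (B i * norm h)"
        unfolding abs_mult by (intro mult_mono Basis_le_norm[OF i]) auto
    qed
    finally show ?thesis by (simp add: sum_distrib_left sum_distrib_right power2_eq_square mult_ac)
  qed
  moreover have "(\<Sum>i\<in>Basis. B i) \<ge> 0" using B(1) by (intro sum_nonneg) (auto intro: less_imp_le)
  ultimately show ?thesis using that by blast
qed

text \<open>The uniform Taylor bound is integrated against \<open>f\<close>: the remainder of the
  candidate derivative is at most a constant times |h|^2 times the integral of |f| over a fixed
  ball.\<close>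

lemma conv_has_derivative:
  fixes f :: "'a::euclidean_space \<Rightarrow> real"
  assumes f: "locint f" and p: "\<phi> \<in> test_functions"
  shows "(conv f \<phi> has_derivative (\<lambda>h. \<Sum>i\<in>Basis. (h \<bullet> i) * conv f (pd \<phi> i) x)) (at x)"
proof -
  have s: "smooth \<phi>" using p by (rule test_smooth)
  have [measurable]: "f \<in> borel_measurable borel" using f by (simp add: locint_def)
  obtain C where C: "C \<ge> 0" "\<And>a h. \<bar>\<phi> (a + h) - \<phi> a - frechet_derivative \<phi> (at a) h\<bar> \<le> C * (norm h)\<^sup>2"
    using test_taylor[OF p] by metis
  obtain R where R: "\<And>x. norm x > R \<Longrightarrow> \<phi> x = 0" using p by (auto simp: test_functions_iff)
  obtain R' where R': "\<And>i x. i \<in> Basis \<Longrightarrow> norm x > R' \<Longrightarrow> pd \<phi> i x = 0"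
  proof -
    have "\<forall>i\<in>Basis. \<exists>R. \<forall>x. norm x > R \<longrightarrow> pd \<phi> i x = 0" using test_pd[OF p] by (auto simp: test_functions_iff)
    then obtain R where R: "\<And>i x. i \<in> Basis \<Longrightarrow> norm x > R i \<Longrightarrow> pd \<phi> i x = 0" by metis
    show ?thesis
    proof (rule that[of "Max (R ` Basis)"])
      fix i x :: 'a assume "i \<in> Basis" "Max (R ` Basis) < norm x"
      then show "pd \<phi> i x = 0" by (intro R) auto
    qed
  qed
  \<comment> \<open>Outside the ball of radius \<open>K\<close> every term of the Taylor remainder
    vanishes as soon as \<open>norm h < 1\<close>; the summand 1 accounts for the shift by
    \<open>h\<close>.\<close>
  define K where "K = max R R' + 1 + norm x"
  define A where "A = (LINT y|lborel. \<bar>indicator (cball 0 K) y * f y\<bar>)"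
  have Ai: "integrable lborel (\<lambda>y. \<bar>indicator (cball 0 K) y * f y\<bar>)" using f by (auto simp: locint_def)
  let ?D = "\<lambda>h. \<Sum>i\<in>Basis. (h \<bullet> i) * conv f (pd \<phi> i) x"
  have expand: "frechet_derivative \<phi> (at z) h = (\<Sum>i\<in>Basis. (h \<bullet> i) * pd \<phi> i z)" for z h
    by (rule pd_expand[OF s])
  have D: "?D h = (LINT y|lborel. f y * frechet_derivative \<phi> (at (x - y)) h)"
    "integrable lborel (\<lambda>y. f y * frechet_derivative \<phi> (at (x - y)) h)" for h
  proof -
    have i: "integrable lborel (\<lambda>y. (h \<bullet> i) * (f y * pd \<phi> i (x - y)))" if "i \<in> Basis" for i
      by (intro integrable_mult_right conv_integrable[OF f test_pd[OF p that]])
    have e: "f y * frechet_derivative \<phi> (at (x - y)) h = (\<Sum>i\<in>Basis. (h \<bullet> i) * (f y * pd \<phi> i (x - y)))" for y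
      by (subst expand) (simp only: sum_distrib_left mult.left_commute)
    show "integrable lborel (\<lambda>y. f y * frechet_derivative \<phi> (at (x - y)) h)"
      unfolding e by (intro Bochner_Integration.integrable_sum i)
    show "?D h = (LINT y|lborel. f y * frechet_derivative \<phi> (at (x - y)) h)"
      unfolding e by (subst Bochner_Integration.integral_sum[OF i]) (auto simp: conv_def)
  qed
  have bound: "\<bar>conv f \<phi> (x + h) - conv f \<phi> x - ?D h\<bar> \<le> C * (norm h)\<^sup>2 * A" if h: "norm h < 1" for h
  proof -
    let ?E = "\<lambda>y. \<phi> (x + h - y) - \<phi> (x - y) - frechet_derivative \<phi> (at (x - y)) h"
    have e: "f y * ?E y = f y * \<phi> (x + h - y) - f y * \<phi> (x - y) - f y * frechet_derivative \<phi> (at (x - y)) h" for y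
      by (simp only: right_diff_distrib)
    note i = conv_integrable[OF f p, of "x + h"] conv_integrable[OF f p, of x] D(2)[of h]
    have iE: "integrable lborel (\<lambda>y. f y * ?E y)"
      unfolding e by (intro Bochner_Integration.integrable_diff i)
    have "conv f \<phi> (x + h) - conv f \<phi> x - ?D h = (LINT y|lborel. f y * ?E y)"
      unfolding D(1) e unfolding conv_def
      by (simp only: Bochner_Integration.integral_diff[OF Bochner_Integration.integrable_diff[OF i(1,2)] i(3)]
         Bochner_Integration.integral_diff[OF i(1,2)])
    also have "\<bar>\<dots>\<bar> \<le> (LINT y|lborel. \<bar>f y * ?E y\<bar>)" by (rule integral_abs_bound)
    also have "\<dots> \<le> (LINT y|lborel. C * (norm h)\<^sup>2 * \<bar>indicator (cball 0 K) y * f y\<bar>)"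
    proof (rule integral_mono)
      show "integrable lborel (\<lambda>y. \<bar>f y * ?E y\<bar>)"
        using iE by (rule integrable_abs)
      show "integrable lborel (\<lambda>y. C * (norm h)\<^sup>2 * \<bar>indicator (cball 0 K) y * f y\<bar>)"
        by (rule integrable_mult_right[OF Ai])
      fix y
      show "\<bar>f y * ?E y\<bar> \<le> C * (norm h)\<^sup>2 * \<bar>indicator (cball 0 K) y * f y\<bar>"
      proof (cases "norm y \<le> K")
        case True
        have "\<bar>f y\<bar> * \<bar>?E y\<bar> \<le> \<bar>f y\<bar> * (C * (norm h)\<^sup>2)"
          using C(2)[of "x - y" h] by (intro mult_left_mono) (simp_all add: add_diff_eq diff_add_eq)
        then show ?thesis using True by (simp add: abs_mult mult.commute)
      next
        case False
        have 1: "norm (x - y) \<ge> norm y - norm x" using norm_triangle_ineq2[of y x] by (simp add: norm_minus_commute)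
        have 2: "norm (x + h - y) \<ge> norm y - norm x - norm h"
          using norm_triangle_ineq2[of y "x + h"] norm_triangle_ineq[of x h] by (simp add: norm_minus_commute)
        have n: "norm (x - y) > R" "norm (x - y) > R'" "norm (x + h - y) > R"
          using 1 2 False h by (auto simp: K_def)
        have "frechet_derivative \<phi> (at (x - y)) h = 0"
          by (subst expand) (rule sum.neutral, use R' n in simp)
        then have "?E y = 0" using R n by simp
        then show ?thesis using C by simp
      qed
    qed
    also have "\<dots> = C * (norm h)\<^sup>2 * A" by (simp add: A_def)
    finally show ?thesis .
  qed
  have bl: "bounded_linear ?D"
    by (intro bounded_linear_sum bounded_linear_mult_const bounded_linear_inner_left)
  show ?thesis
  proof (rule has_derivativeI_sandwich[of 1 _ _ _ _ "\<lambda>y. C * A * norm (y - x)"])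
    fix y assume "y \<noteq> x" "dist y x < 1"
    then have "\<bar>conv f \<phi> (x + (y - x)) - conv f \<phi> x - ?D (y - x)\<bar> \<le> C * (norm (y - x))\<^sup>2 * A"
      by (intro bound) (auto simp: dist_norm)
    then have "\<bar>conv f \<phi> y - conv f \<phi> x - ?D (y - x)\<bar> \<le> C * A * norm (y - x) * norm (y - x)"
      by (simp add: power2_eq_square mult_ac)
    then show "norm (conv f \<phi> y - conv f \<phi> x - ?D (y - x)) / norm (y - x) \<le> C * A * norm (y - x)"
      using \<open>y \<noteq> x\<close> by (subst pos_divide_le_eq) auto
  next
    have "((\<lambda>y. C * A * norm (y - x)) \<longlongrightarrow> C * A * norm (x - x)) (at x)" by (intro tendsto_intros)
    then show "((\<lambda>y. C * A * norm (y - x)) \<longlongrightarrow> 0) (at x)" by simp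
  qed (use bl in auto)
qed

text \<open>A partial derivative of the convolution is the convolution of the same \<open>f\<close>
  with a derivative of the test function, so the induction keeps \<open>f\<close> fixed and runs
  over all test functions.\<close>

lemma smooth_conv:
  fixes f :: "'a::euclidean_space \<Rightarrow> real"
  assumes f: "locint f" and p: "\<phi> \<in> test_functions"
  shows "smooth (conv f \<phi>)"
proof -
  have "times_cont_diff k (conv f \<phi>)" if "\<phi> \<in> test_functions" for k \<phi> using that
  proof (induction k arbitrary: \<phi>)
    case 0
    have "continuous_on UNIV (conv f \<phi>)"
      using conv_has_derivative[OF f 0] has_derivative_continuous continuous_at_imp_continuous_on by blast
    then show ?case by simp
  next
    case (Suc k)
    show ?case
    proof (rule times_cont_diff_SucI[OF conv_has_derivative[OF f Suc.prems]])
      fix j :: 'a assume j: "j \<in> Basis"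
      have "(\<Sum>i\<in>Basis. (j \<bullet> i) * conv f (pd \<phi> i) x) = (\<Sum>i\<in>Basis. if i = j then conv f (pd \<phi> i) x else 0)" for x
        by (intro sum.cong refl) (auto simp: inner_Basis j)
      then have e: "(\<lambda>x. \<Sum>i\<in>Basis. (j \<bullet> i) * conv f (pd \<phi> i) x) = conv f (pd \<phi> j)"
        using j by (simp add: fun_eq_iff)
      show "times_cont_diff k (\<lambda>x. \<Sum>i\<in>Basis. (j \<bullet> i) * conv f (pd \<phi> i) x)"
        unfolding e by (rule Suc.IH[OF test_pd[OF Suc.prems j]])
    qed
  qed
  then show ?thesis using p by (auto simp: smooth_def)
qed

lemma gradient_conv:
  assumes f: "locint f" and p: "\<phi> \<in> test_functions" and i: "i \<in> Basis"
  shows "gradient (conv f \<phi>) x \<bullet> i = conv f (pd \<phi> i) x"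
proof -
  have "pd (conv f \<phi>) i x = (\<Sum>j\<in>Basis. (i \<bullet> j) * conv f (pd \<phi> j) x)"
    by (rule pd_eqI[OF conv_has_derivative[OF f p]])
  also have "\<dots> = (\<Sum>j\<in>Basis. if j = i then conv f (pd \<phi> j) x else 0)"
    by (intro sum.cong refl) (auto simp: inner_Basis i)
  finally show ?thesis using i by (simp add: gradient_inner)
qed

lemma moll_eq_conv:
  fixes f :: "'a::euclidean_space \<Rightarrow> real"
  assumes [measurable]: "f \<in> borel_measurable borel" "\<rho> \<in> borel_measurable borel" and e: "\<epsilon> > 0"
  shows "moll \<rho> \<epsilon> f = conv f (\<lambda>z. (1 / \<epsilon>) ^ DIM('a) * \<rho> ((1 / \<epsilon>) *\<^sub>R z + 0))"
proof
  fix x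
  let ?F = "\<lambda>z. f z * ((1 / \<epsilon>) ^ DIM('a) * \<rho> ((1 / \<epsilon>) *\<^sub>R (x - z)))"
  have "(LINT z|lborel. ?F z) = \<bar>-\<epsilon>\<bar> ^ DIM('a) * (LINT y|lborel. ?F (x + (-\<epsilon>) *\<^sub>R y))"
    by (rule integral_affine) (use e in auto)
  also have "(\<lambda>y. ?F (x + (-\<epsilon>) *\<^sub>R y)) = (\<lambda>y. (1 / \<epsilon>) ^ DIM('a) * (f (x - \<epsilon> *\<^sub>R y) * \<rho> y))"
    using e by (auto simp: fun_eq_iff)
  finally show "moll \<rho> \<epsilon> f x = conv f (\<lambda>z. (1 / \<epsilon>) ^ DIM('a) * \<rho> ((1 / \<epsilon>) *\<^sub>R z + 0)) x"
    using e by (simp add: moll_def conv_def power_divide)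
qed

lemma smooth_moll:
  fixes f :: "'a::euclidean_space \<Rightarrow> real"
  assumes f: "locint f" and p: "\<rho> \<in> test_functions" and e: "\<epsilon> > 0"
  shows "smooth (moll \<rho> \<epsilon> f)"
proof -
  have t: "(\<lambda>z. (1 / \<epsilon>) ^ DIM('a) * \<rho> ((1 / \<epsilon>) *\<^sub>R z + 0)) \<in> test_functions"
    using test_mult_smooth[OF test_affine[OF p, of "1/\<epsilon>" 0] smooth_const[of "(1 / \<epsilon>) ^ DIM('a)"]] e by (simp add: mult.commute)
  show ?thesis
    using f smooth_measurable[OF test_smooth[OF p]] smooth_conv[OF f t]
    by (subst moll_eq_conv[OF _ _ e]) (auto simp: locint_def)
qed

text \<open>The weak derivative identity is tested with the reflected rescaled kernel centred at
  \<open>x\<close>; the sign in it is cancelled by the one coming from the reflection.\<close>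

lemma gradient_moll:
  fixes u :: "'a::euclidean_space \<Rightarrow> real"
  assumes u: "locint u" and g: "g \<in> borel_measurable borel" and p: "\<rho> \<in> test_functions" and e: "\<epsilon> > 0"
    and i: "i \<in> Basis"
    and weak: "\<And>\<phi>. \<phi> \<in> test_functions \<Longrightarrow> (LINT y|lborel. u y * pd \<phi> i y) = - (LINT y|lborel. \<phi> y * g y)"
  shows "gradient (moll \<rho> \<epsilon> u) x \<bullet> i = moll \<rho> \<epsilon> g x"
proof -
  define r where "r = (\<lambda>z. (1 / \<epsilon>) ^ DIM('a) * \<rho> ((1 / \<epsilon>) *\<^sub>R z + 0))"
  have t: "r \<in> test_functions"
    using test_mult_smooth[OF test_affine[OF p, of "1/\<epsilon>" 0] smooth_const[of "(1 / \<epsilon>) ^ DIM('a)"]] e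
    by (simp add: mult.commute r_def)
  have um: "u \<in> borel_measurable borel" using u by (simp add: locint_def)
  have rm: "\<rho> \<in> borel_measurable borel" using p by (simp add: test_smooth smooth_measurable)
  define \<phi> where "\<phi> = (\<lambda>y. r ((-1) *\<^sub>R y + x))"
  have tp: "\<phi> \<in> test_functions" unfolding \<phi>_def by (rule test_affine[OF t]) simp
  have "pd \<phi> i y = - pd r i (x - y)" for y
    using gradient_affine[OF test_smooth[OF t], of "-1" x y] gradient_inner[OF i]
    by (simp add: \<phi>_def flip: gradient_inner[OF i])
  then have "conv u (pd r i) x = - (LINT y|lborel. u y * pd \<phi> i y)" by (simp add: conv_def)
  also have "\<dots> = (LINT y|lborel. \<phi> y * g y)" using weak[OF tp] by simp
  also have "\<dots> = conv g r x" by (simp add: conv_def \<phi>_def mult.commute)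
  finally show ?thesis
    using gradient_conv[OF u t i] moll_eq_conv[OF um rm e] moll_eq_conv[OF g rm e] by (simp add: r_def)
qed

section \<open>Dilations of functions with square-integrable gradient\<close>

text \<open>Fundamental theorem of calculus along the ray from \<open>\<sigma> *\<^sub>R x\<close>
  to \<open>x\<close>, then Cauchy-Schwarz in \<open>t\<close> on an interval of length 1 -
  \<sigma>.\<close>

lemma dilation_pointwise:
  fixes f :: "'a::euclidean_space \<Rightarrow> real"
  assumes f: "smooth f" and l: "0 < \<sigma>" "\<sigma> \<le> 1"
  shows "ennreal ((f (\<sigma> *\<^sub>R x) - f x)\<^sup>2) \<le>
    ennreal ((1 - \<sigma>) * (norm x)\<^sup>2) * (\<integral>\<^sup>+t. ennreal ((norm (gradient f (t *\<^sub>R x)))\<^sup>2) * indicator {\<sigma>..1} t \<partial>lborel)"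
proof -
  have [measurable]: "gradient f \<in> borel_measurable borel" by (rule gradient_measurable[OF f])
  have gc: "continuous_on UNIV (gradient f)"
    unfolding gradient_def by (intro continuous_intros smooth_continuous_on smooth_pd f)
  let ?F = "\<lambda>t. gradient f (t *\<^sub>R x) \<bullet> x"
  have c: "continuous_on {\<sigma>..1} ?F"
    by (intro continuous_intros continuous_on_compose2[OF gc]) auto
  have d: "((\<lambda>t. f (t *\<^sub>R x)) has_vector_derivative ?F t) (at t within {\<sigma>..1})" for t
    unfolding has_vector_derivative_def
    by (rule has_derivative_eq_rhs[OF has_derivative_compose[where f = "\<lambda>t. t *\<^sub>R x" and g = f, OF _ smooth_gradient_derivative[OF f]]])
       (auto intro!: derivative_eq_intros)
  have eq: "(LINT t|lborel. indicator {\<sigma>..1} t *\<^sub>R ?F t) = f (1 *\<^sub>R x) - f (\<sigma> *\<^sub>R x)"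
    by (rule integral_FTC_atLeastAtMost[OF l(2) d c])
  have i: "integrable lborel (\<lambda>t. indicator {\<sigma>..1} t *\<^sub>R ?F t)"
    using borel_integrable_atLeastAtMost'[OF c] by (simp add: set_integrable_def)
  define J where "J = (\<integral>\<^sup>+t. ennreal (norm (gradient f (t *\<^sub>R x))) * indicator {\<sigma>..1} t \<partial>lborel)"
  have "ennreal (\<bar>f x - f (\<sigma> *\<^sub>R x)\<bar>) \<le> (\<integral>\<^sup>+t. norm (indicator {\<sigma>..1} t *\<^sub>R ?F t) \<partial>lborel)"
    using integral_norm_bound_ennreal[OF i] unfolding eq by simp
  also have "\<dots> \<le> (\<integral>\<^sup>+t. ennreal (norm x) * (ennreal (norm (gradient f (t *\<^sub>R x))) * indicator {\<sigma>..1} t) \<partial>lborel)"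
  proof (rule nn_integral_mono)
    fix t
    have "\<bar>?F t\<bar> \<le> norm x * norm (gradient f (t *\<^sub>R x))"
      using Cauchy_Schwarz_ineq2[of "gradient f (t *\<^sub>R x)" x] by (simp add: mult.commute)
    then show "ennreal (norm (indicator {\<sigma>..1} t *\<^sub>R ?F t)) \<le> ennreal (norm x) * (ennreal (norm (gradient f (t *\<^sub>R x))) * indicator {\<sigma>..1} t)"
      by (auto simp: indicator_def ennreal_leI simp flip: ennreal_mult)
  qed
  also have "\<dots> = ennreal (norm x) * J"
    unfolding J_def by (rule nn_integral_cmult) measurable
  finally have 1: "ennreal (\<bar>f x - f (\<sigma> *\<^sub>R x)\<bar>) \<le> ennreal (norm x) * J" .
  \<comment> \<open>The indicator is duplicated so that Cauchy-Schwarz can be applied to the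
    gradient factor and the indicator.\<close>
  have "J\<^sup>2 = (\<integral>\<^sup>+t. (ennreal (norm (gradient f (t *\<^sub>R x))) * indicator {\<sigma>..1} t) * indicator {\<sigma>..1} t \<partial>lborel)\<^sup>2"
    unfolding J_def by (rule arg_cong[where f="\<lambda>x. x^2"], rule nn_integral_cong) (auto simp: indicator_def)
  also have "\<dots> \<le> (\<integral>\<^sup>+t. (ennreal (norm (gradient f (t *\<^sub>R x))) * indicator {\<sigma>..1} t)^2 \<partial>lborel)
       * (\<integral>\<^sup>+t. (indicator {\<sigma>..1} t)^2 \<partial>lborel)"
    by (rule Cauchy_Schwarz_nn_integral) auto
  also have "(\<lambda>t. (ennreal (norm (gradient f (t *\<^sub>R x))) * indicator {\<sigma>..1} t)^2) =
      (\<lambda>t. ennreal ((norm (gradient f (t *\<^sub>R x)))\<^sup>2) * indicator {\<sigma>..1} t)"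
    by (auto simp: indicator_def ennreal_power)
  also have "(\<integral>\<^sup>+t. (indicator {\<sigma>..1} t)^2 \<partial>lborel) = (\<integral>\<^sup>+t. indicator {\<sigma>..1} t \<partial>lborel)"
    by (rule nn_integral_cong) (auto simp: indicator_def)
  also have "\<dots> = ennreal (1 - \<sigma>)" using l by simp
  finally have 2: "J\<^sup>2 \<le> (\<integral>\<^sup>+t. ennreal ((norm (gradient f (t *\<^sub>R x)))\<^sup>2) * indicator {\<sigma>..1} t \<partial>lborel) * ennreal (1 - \<sigma>)" .
  have "ennreal ((f (\<sigma> *\<^sub>R x) - f x)\<^sup>2) = (ennreal (\<bar>f x - f (\<sigma> *\<^sub>R x)\<bar>))\<^sup>2"
    by (simp add: ennreal_power power2_commute)
  also have "\<dots> \<le> (ennreal (norm x) * J)\<^sup>2" by (rule power_mono[OF 1]) simp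
  also have "\<dots> = ennreal ((norm x)\<^sup>2) * J\<^sup>2" by (simp add: power_mult_distrib ennreal_power)
  also have "\<dots> \<le> ennreal ((norm x)\<^sup>2) * ((\<integral>\<^sup>+t. ennreal ((norm (gradient f (t *\<^sub>R x)))\<^sup>2) * indicator {\<sigma>..1} t \<partial>lborel) * ennreal (1 - \<sigma>))"
    by (rule mult_left_mono[OF 2]) simp
  finally show ?thesis using l by (simp add: ennreal_mult mult_ac)
qed

text \<open>Dividing by |x|^2 absorbs the length of the radial direction. After Tonelli the
  substitution x -> t x costs t^(-N) \<le> 2^N, and the length of the \<open>t\<close>-interval
  supplies the second factor 1 - \<sigma>.\<close>

lemma dilation_smooth:
  fixes f :: "'a::euclidean_space \<Rightarrow> real"
  assumes f: "smooth f" and l: "1 / 2 \<le> \<sigma>" "\<sigma> \<le> 1" and A[measurable]: "A \<in> sets borel" "A' \<in> sets borel"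
    and AA: "\<And>x t. x \<in> A \<Longrightarrow> \<sigma> \<le> t \<Longrightarrow> t \<le> 1 \<Longrightarrow> t *\<^sub>R x \<in> A'"
  shows "(\<integral>\<^sup>+x. ennreal ((f (\<sigma> *\<^sub>R x) - f x)\<^sup>2 / (norm x)\<^sup>2) * indicator A x \<partial>lborel) \<le>
     ennreal (2 ^ DIM('a) * (1 - \<sigma>)\<^sup>2) * (\<integral>\<^sup>+x. ennreal ((norm (gradient f x))\<^sup>2) * indicator A' x \<partial>lborel)"
proof -
  have [measurable]: "gradient f \<in> borel_measurable borel" by (rule gradient_measurable[OF f])
  define I where "I = (\<integral>\<^sup>+x. ennreal ((norm (gradient f x))\<^sup>2) * indicator A' x \<partial>lborel)"
  let ?g = "\<lambda>x t. ennreal ((norm (gradient f (t *\<^sub>R x)))\<^sup>2) * indicator {\<sigma>..1} t"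
  have "(\<integral>\<^sup>+x. ennreal ((f (\<sigma> *\<^sub>R x) - f x)\<^sup>2 / (norm x)\<^sup>2) * indicator A x \<partial>lborel) \<le>
     (\<integral>\<^sup>+x. ennreal (1 - \<sigma>) * (\<integral>\<^sup>+t. ?g x t * indicator A x \<partial>lborel) \<partial>lborel)"
  proof (rule nn_integral_mono)
    fix x
    show "ennreal ((f (\<sigma> *\<^sub>R x) - f x)\<^sup>2 / (norm x)\<^sup>2) * indicator A x \<le> ennreal (1 - \<sigma>) * (\<integral>\<^sup>+t. ?g x t * indicator A x \<partial>lborel)"
    \<comment> \<open>At the origin the quotient is 0 by the convention for division, so the bound
      is trivial there.\<close>
    proof (cases "x \<in> A \<and> x \<noteq> 0")
      case True
      have "ennreal ((f (\<sigma> *\<^sub>R x) - f x)\<^sup>2 / (norm x)\<^sup>2) = ennreal (1 / (norm x)\<^sup>2) * ennreal ((f (\<sigma> *\<^sub>R x) - f x)\<^sup>2)"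
        by (simp flip: ennreal_mult)
      also have "\<dots> \<le> ennreal (1 / (norm x)\<^sup>2) * (ennreal ((1 - \<sigma>) * (norm x)\<^sup>2) * (\<integral>\<^sup>+t. ?g x t \<partial>lborel))"
        using l by (intro mult_left_mono dilation_pointwise f) auto
      also have "\<dots> = ennreal (1 - \<sigma>) * (\<integral>\<^sup>+t. ?g x t \<partial>lborel)"
        using True l by (simp add: mult.assoc[symmetric] flip: ennreal_mult)
      finally show ?thesis using True by simp
    qed auto
  qed
  also have "\<dots> = ennreal (1 - \<sigma>) * (\<integral>\<^sup>+x. (\<integral>\<^sup>+t. ?g x t * indicator A x \<partial>lborel) \<partial>lborel)"
    by (rule nn_integral_cmult) measurable
  also have "(\<integral>\<^sup>+x. (\<integral>\<^sup>+t. ?g x t * indicator A x \<partial>lborel) \<partial>lborel) = (\<integral>\<^sup>+t. (\<integral>\<^sup>+x. ?g x t * indicator A x \<partial>lborel) \<partial>lborel)"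
    by (rule lborel_pair.Fubini') measurable
  also have "\<dots> \<le> (\<integral>\<^sup>+t. ennreal (2 ^ DIM('a)) * I * indicator {\<sigma>..1} t \<partial>lborel)"
  proof (rule nn_integral_mono)
    fix t :: real
    show "(\<integral>\<^sup>+x. ?g x t * indicator A x \<partial>lborel) \<le> ennreal (2 ^ DIM('a)) * I * indicator {\<sigma>..1} t"
    proof (cases "t \<in> {\<sigma>..1}")
      case True
      then have t: "t > 0" "1 / t \<le> 2" using l by (auto simp: field_simps)
      let ?k = "\<lambda>x. ennreal ((norm (gradient f x))\<^sup>2) * indicator A' x :: ennreal"
      have "(\<integral>\<^sup>+x. ?g x t * indicator A x \<partial>lborel) \<le> (\<integral>\<^sup>+x. ?k (0 + t *\<^sub>R x) \<partial>lborel)"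
        using True AA by (intro nn_integral_mono) (auto simp: indicator_def)
      also have "\<dots> = ennreal ((1 / t) ^ DIM('a)) * (ennreal (\<bar>t\<bar> ^ DIM('a)) * (\<integral>\<^sup>+x. ?k (0 + t *\<^sub>R x) \<partial>lborel))"
        using t by (simp add: mult.assoc[symmetric] power_mult_distrib[symmetric] flip: ennreal_mult)
      also have "ennreal (\<bar>t\<bar> ^ DIM('a)) * (\<integral>\<^sup>+x. ?k (0 + t *\<^sub>R x) \<partial>lborel) = I"
        unfolding I_def using t by (intro nn_integral_affine[symmetric]) auto
      also have "ennreal ((1 / t) ^ DIM('a)) * I \<le> ennreal (2 ^ DIM('a)) * I"
        using t by (intro mult_right_mono ennreal_leI power_mono) auto
      finally show ?thesis using True by simp
    qed auto
  qed
  also have "\<dots> = ennreal (2 ^ DIM('a)) * I * ennreal (1 - \<sigma>)"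
    using l by (subst nn_integral_cmult_indicator) auto
  finally have "(\<integral>\<^sup>+x. ennreal ((f (\<sigma> *\<^sub>R x) - f x)\<^sup>2 / (norm x)\<^sup>2) * indicator A x \<partial>lborel) \<le>
     ennreal (1 - \<sigma>) * (ennreal (2 ^ DIM('a)) * I * ennreal (1 - \<sigma>))"
    using mult_left_mono by (metis zero_le)
  also have "\<dots> = ennreal (2 ^ DIM('a) * (1 - \<sigma>)\<^sup>2) * I"
    using l by (simp add: ennreal_mult power2_eq_square mult_ac)
  finally show ?thesis unfolding I_def .
qed

text \<open>Supplies the pointwise convergence that Fatou's lemma requires.\<close>

lemma Lto_AE_subseq:
  fixes f :: "'a::euclidean_space \<Rightarrow> real"
  assumes F: "Lto r F f" and r: "r > 0"
  obtains k :: "nat \<Rightarrow> nat" where "strict_mono k" "AE x in lborel. (\<lambda>n. F (k n) x) \<longlonglongrightarrow> f x"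
proof -
  have "\<exists>k::nat\<Rightarrow>nat. strict_mono k \<and> (AE x in lborel. (\<lambda>n. \<bar>F (k n) x - f x\<bar> powr r) \<longlonglongrightarrow> 0)"
    by (rule tendsto_L1_AE_subseq) (use Lto_real[OF F] in auto)
  then obtain k :: "nat \<Rightarrow> nat" where k: "strict_mono k" "AE x in lborel. (\<lambda>n. \<bar>F (k n) x - f x\<bar> powr r) \<longlonglongrightarrow> 0" by blast
  have "AE x in lborel. (\<lambda>n. F (k n) x) \<longlonglongrightarrow> f x"
    using k(2)
  proof eventually_elim
    case (elim x)
    have "(\<lambda>n. (\<bar>F (k n) x - f x\<bar> powr r) powr (1 / r)) \<longlonglongrightarrow> 0 powr (1 / r)"
      by (rule tendsto_powr2[OF elim]) (use r in auto)
    then have "(\<lambda>n. \<bar>F (k n) x - f x\<bar>) \<longlonglongrightarrow> 0" using r by (simp add: powr_powr)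
    then have "(\<lambda>n. F (k n) x - f x) \<longlonglongrightarrow> 0" by (rule tendsto_rabs_zero_cancel)
    then show ?case by (rule LIM_zero_cancel)
  qed
  with k(1) show ?thesis using that by blast
qed

lemma norm_sq_sum: "(norm x)\<^sup>2 = (\<Sum>i\<in>Basis. (x \<bullet> i)\<^sup>2)" for x :: "'a::euclidean_space"
  by (subst power2_norm_eq_inner, subst euclidean_inner) (simp add: power2_eq_square)

text \<open>The smooth estimate is applied to mollifications: Fatou along an almost everywhere
  convergent subsequence treats the left side, L^2 convergence of the gradients the right side. The
  extra factor 2 comes from |a|^2 \<le> 2 |b|^2 + 2 |a - b|^2.\<close>

lemma dilation_weak:
  fixes u :: "'a::euclidean_space \<Rightarrow> real" and G :: "'a \<Rightarrow> 'a"
  assumes u[measurable]: "u \<in> borel_measurable borel" and ui: "nnr r u < \<infinity>" and r: "r \<ge> 1"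
    and G[measurable]: "G \<in> borel_measurable borel" and Gi: "\<And>i. i \<in> Basis \<Longrightarrow> nnr 2 (\<lambda>x. G x \<bullet> i) < \<infinity>"
    and weak: "\<And>\<phi> i. \<phi> \<in> test_functions \<Longrightarrow> i \<in> Basis \<Longrightarrow> (LINT y|lborel. u y * pd \<phi> i y) = - (LINT y|lborel. \<phi> y * (G y \<bullet> i))"
    and l: "1 / 2 \<le> \<sigma>" "\<sigma> \<le> 1" and A[measurable]: "A \<in> sets borel" "A' \<in> sets borel"
    and AA: "\<And>x t. x \<in> A \<Longrightarrow> \<sigma> \<le> t \<Longrightarrow> t \<le> 1 \<Longrightarrow> t *\<^sub>R x \<in> A'"
  shows "(\<integral>\<^sup>+x. ennreal ((u (\<sigma> *\<^sub>R x) - u x)\<^sup>2 / (norm x)\<^sup>2) * indicator A x \<partial>lborel) \<le>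
     ennreal (2 ^ (DIM('a) + 1) * (1 - \<sigma>)\<^sup>2) * (\<integral>\<^sup>+x. ennreal ((norm (G x))\<^sup>2) * indicator A' x \<partial>lborel)"
proof -
  obtain \<rho> :: "'a \<Rightarrow> real" where rho: "mollifier \<rho>"
    using mollifier_exists unfolding mollifier_def by metis
  have rt: "\<rho> \<in> test_functions" using rho by (simp add: mollifier_def)
  define \<epsilon> where "\<epsilon> = (\<lambda>k::nat. 1 / (real k + 1))"
  have e: "\<epsilon> k > 0" for k by (simp add: \<epsilon>_def)
  define U where "U = (\<lambda>k. moll \<rho> (\<epsilon> k) u)"
  have U: "Lto r U u" unfolding U_def \<epsilon>_def by (rule Lto_moll[OF rho u ui r])
  have lu: "locint u" by (rule nnr_locint[OF u ui r])
  have Us: "smooth (U k)" for k unfolding U_def by (rule smooth_moll[OF lu rt e])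
  have [measurable]: "U k \<in> borel_measurable borel" for k by (rule smooth_measurable[OF Us])
  have gU: "gradient (U k) x \<bullet> i = moll \<rho> (\<epsilon> k) (\<lambda>x. G x \<bullet> i) x" if "i \<in> Basis" for k x i
    unfolding U_def by (rule gradient_moll[OF lu _ rt e that]) (use weak that in auto)
  have Gc: "Lto 2 (\<lambda>k x. gradient (U k) x \<bullet> i) (\<lambda>x. G x \<bullet> i)" if "i \<in> Basis" for i
    unfolding gU[OF that] \<epsilon>_def by (rule Lto_moll[OF rho _ Gi[OF that]]) auto
  let ?I = "\<integral>\<^sup>+x. ennreal ((norm (G x))\<^sup>2) * indicator A' x \<partial>lborel"
  \<comment> \<open>The approximation error is integrated over the whole space instead of
    \<open>A'\<close>: it tends to 0 anyway, and only the main term has to remember the set.\<close>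
  have bI: "(\<integral>\<^sup>+x. ennreal ((norm (gradient (U k) x))\<^sup>2) * indicator A' x \<partial>lborel) \<le>
      2 * ?I + 2 * (\<Sum>i\<in>Basis. nnr 2 (\<lambda>x. gradient (U k) x \<bullet> i - G x \<bullet> i))" for k
  proof -
    have [measurable]: "gradient (U k) \<in> borel_measurable borel" by (rule gradient_measurable[OF Us])
    have "(\<integral>\<^sup>+x. ennreal ((norm (gradient (U k) x))\<^sup>2) * indicator A' x \<partial>lborel) \<le>
       (\<integral>\<^sup>+x. 2 * (ennreal ((norm (G x))\<^sup>2) * indicator A' x) +
         2 * (\<Sum>i\<in>Basis. ennreal (\<bar>gradient (U k) x \<bullet> i - G x \<bullet> i\<bar> powr 2)) \<partial>lborel)"
    proof (rule nn_integral_mono)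
      fix x
      have "(norm (gradient (U k) x))\<^sup>2 \<le> 2 * (norm (G x))\<^sup>2 + 2 * (norm (gradient (U k) x - G x))\<^sup>2"
      proof -
        have "norm (gradient (U k) x) \<le> norm (G x) + norm (gradient (U k) x - G x)"
          using norm_triangle_ineq[of "G x" "gradient (U k) x - G x"] by simp
        then have "(norm (gradient (U k) x))\<^sup>2 \<le> (norm (G x) + norm (gradient (U k) x - G x))\<^sup>2"
          by (rule power_mono) simp
        also have "\<dots> \<le> 2 * (norm (G x))\<^sup>2 + 2 * (norm (gradient (U k) x - G x))\<^sup>2"
          using zero_le_power2[of "norm (G x) - norm (gradient (U k) x - G x)"] by (simp add: power2_sum power2_diff)
        finally show ?thesis .
      qed
      also have "(norm (gradient (U k) x - G x))\<^sup>2 = (\<Sum>i\<in>Basis. \<bar>gradient (U k) x \<bullet> i - G x \<bullet> i\<bar> powr 2)"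
        by (simp add: norm_sq_sum inner_diff_left)
      finally have "ennreal ((norm (gradient (U k) x))\<^sup>2) \<le>
          ennreal (2 * (norm (G x))\<^sup>2 + 2 * (\<Sum>i\<in>Basis. \<bar>gradient (U k) x \<bullet> i - G x \<bullet> i\<bar> powr 2))"
        by (rule ennreal_leI)
      also have "\<dots> = 2 * ennreal ((norm (G x))\<^sup>2) + 2 * (\<Sum>i\<in>Basis. ennreal (\<bar>gradient (U k) x \<bullet> i - G x \<bullet> i\<bar> powr 2))"
        by (simp add: ennreal_plus ennreal_mult sum_nonneg)
      finally show "ennreal ((norm (gradient (U k) x))\<^sup>2) * indicator A' x \<le>
         2 * (ennreal ((norm (G x))\<^sup>2) * indicator A' x) +
         2 * (\<Sum>i\<in>Basis. ennreal (\<bar>gradient (U k) x \<bullet> i - G x \<bullet> i\<bar> powr 2))"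
        by (auto simp: indicator_def)
    qed
    also have "\<dots> = (\<integral>\<^sup>+x. 2 * (ennreal ((norm (G x))\<^sup>2) * indicator A' x) \<partial>lborel) +
         (\<integral>\<^sup>+x. 2 * (\<Sum>i\<in>Basis. ennreal (\<bar>gradient (U k) x \<bullet> i - G x \<bullet> i\<bar> powr 2)) \<partial>lborel)"
      by (rule nn_integral_add) measurable
    also have "(\<integral>\<^sup>+x. 2 * (ennreal ((norm (G x))\<^sup>2) * indicator A' x) \<partial>lborel) = 2 * ?I"
      by (rule nn_integral_cmult) measurable
    also have "(\<integral>\<^sup>+x. 2 * (\<Sum>i\<in>Basis. ennreal (\<bar>gradient (U k) x \<bullet> i - G x \<bullet> i\<bar> powr 2)) \<partial>lborel)
      = 2 * (\<integral>\<^sup>+x. (\<Sum>i\<in>Basis. ennreal (\<bar>gradient (U k) x \<bullet> i - G x \<bullet> i\<bar> powr 2)) \<partial>lborel)"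
      by (rule nn_integral_cmult) measurable
    also have "(\<integral>\<^sup>+x. (\<Sum>i\<in>Basis. ennreal (\<bar>gradient (U k) x \<bullet> i - G x \<bullet> i\<bar> powr 2)) \<partial>lborel)
      = (\<Sum>i\<in>Basis. nnr 2 (\<lambda>x. gradient (U k) x \<bullet> i - G x \<bullet> i))"
      unfolding nnr_def by (rule nn_integral_sum) measurable
    finally show ?thesis .
  qed
  define z where "z = (\<lambda>x. u (\<sigma> *\<^sub>R x) - u x)"
  define Z where "Z = (\<lambda>k x. U k (\<sigma> *\<^sub>R x) - U k x)"
  have "Lto r (\<lambda>k x. U k (\<sigma> *\<^sub>R x) + (-1) * U k x) (\<lambda>x. u (\<sigma> *\<^sub>R x) + (-1) * u x)"
    using l r by (intro Lto_add Lto_scale Lto_mult_bounded[where B=1] U) auto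
  then have Zz: "Lto r Z z" by (simp add: Z_def z_def)
  then obtain k :: "nat \<Rightarrow> nat" where k: "strict_mono k" "AE x in lborel. (\<lambda>n. Z (k n) x) \<longlonglongrightarrow> z x"
    using Lto_AE_subseq[OF Zz] r by auto
  have [measurable]: "Z n \<in> borel_measurable borel" "z \<in> borel_measurable borel" for n
    using Zz by (auto simp: Lto_def)
  let ?c = "ennreal (2 ^ DIM('a) * (1 - \<sigma>)\<^sup>2)"
  let ?S = "\<lambda>n. \<Sum>i\<in>Basis. nnr 2 (\<lambda>x. gradient (U (k n)) x \<bullet> i - G x \<bullet> i)"
  have "(\<integral>\<^sup>+x. ennreal ((z x)\<^sup>2 / (norm x)\<^sup>2) * indicator A x \<partial>lborel) \<le>
     (\<integral>\<^sup>+x. liminf (\<lambda>n. ennreal ((Z (k n) x)\<^sup>2 / (norm x)\<^sup>2) * indicator A x) \<partial>lborel)"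
  proof (rule nn_integral_mono_AE)
    show "AE x in lborel. ennreal ((z x)\<^sup>2 / (norm x)\<^sup>2) * indicator A x \<le> liminf (\<lambda>n. ennreal ((Z (k n) x)\<^sup>2 / (norm x)\<^sup>2) * indicator A x)"
      using k(2)
    proof eventually_elim
      case (elim x)
      have "(\<lambda>n. (Z (k n) x)\<^sup>2 / (norm x)\<^sup>2 * indicator A x) \<longlonglongrightarrow> (z x)\<^sup>2 / (norm x)\<^sup>2 * indicator A x"
        unfolding divide_inverse by (intro tendsto_intros elim)
      then have "(\<lambda>n. ennreal ((Z (k n) x)\<^sup>2 / (norm x)\<^sup>2 * indicator A x)) \<longlonglongrightarrow> ennreal ((z x)\<^sup>2 / (norm x)\<^sup>2 * indicator A x)"
        by (rule tendsto_ennrealI)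
      then have "(\<lambda>n. ennreal ((Z (k n) x)\<^sup>2 / (norm x)\<^sup>2) * indicator A x) \<longlonglongrightarrow> ennreal ((z x)\<^sup>2 / (norm x)\<^sup>2) * indicator A x"
        by (cases "x \<in> A") simp_all
      from lim_imp_Liminf[OF _ this] show ?case by simp
    qed
  qed
  also have "\<dots> \<le> liminf (\<lambda>n. \<integral>\<^sup>+x. ennreal ((Z (k n) x)\<^sup>2 / (norm x)\<^sup>2) * indicator A x \<partial>lborel)"
    by (rule nn_integral_liminf) measurable
  also have "\<dots> \<le> liminf (\<lambda>n. ?c * (2 * ?I + 2 * ?S n))"
  proof (intro Liminf_mono always_eventually allI)
    fix n
    have "(\<integral>\<^sup>+x. ennreal ((Z (k n) x)\<^sup>2 / (norm x)\<^sup>2) * indicator A x \<partial>lborel) \<le>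
      ?c * (\<integral>\<^sup>+x. ennreal ((norm (gradient (U (k n)) x))\<^sup>2) * indicator A' x \<partial>lborel)"
      unfolding Z_def by (rule dilation_smooth[OF Us l A AA])
    also have "\<dots> \<le> ?c * (2 * ?I + 2 * ?S n)" by (intro mult_left_mono bI) simp
    finally show "(\<integral>\<^sup>+x. ennreal ((Z (k n) x)\<^sup>2 / (norm x)\<^sup>2) * indicator A x \<partial>lborel) \<le> ?c * (2 * ?I + 2 * ?S n)" .
  qed
  also have "\<dots> = ?c * (2 * ?I)"
  proof (rule lim_imp_Liminf)
    have "?S \<longlonglongrightarrow> (\<Sum>i\<in>(Basis::'a set). 0)"
    proof (rule tendsto_sum)
      fix i :: 'a assume "i \<in> Basis"
      from Gc[OF this] have "(\<lambda>n. nnr 2 (\<lambda>x. gradient (U n) x \<bullet> i - G x \<bullet> i)) \<longlonglongrightarrow> 0" by (simp add: Lto_def)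
      from LIMSEQ_subseq_LIMSEQ[OF this k(1)]
      show "(\<lambda>n. nnr 2 (\<lambda>x. gradient (U (k n)) x \<bullet> i - G x \<bullet> i)) \<longlonglongrightarrow> 0" by (simp add: o_def)
    qed
    then have S: "?S \<longlonglongrightarrow> 0" by simp
    have "(\<lambda>n. 2 * ?S n) \<longlonglongrightarrow> 2 * 0" by (rule ennreal_tendsto_cmult[OF _ S]) simp
    then have "(\<lambda>n. 2 * ?I + 2 * ?S n) \<longlonglongrightarrow> 2 * ?I + 2 * 0"
      by (rule tendsto_add[OF tendsto_const])
    from ennreal_tendsto_cmult[OF _ this, of ?c]
    show "(\<lambda>n. ?c * (2 * ?I + 2 * ?S n)) \<longlonglongrightarrow> ?c * (2 * ?I)" by simp
  qed simp
  also have "?c * (2 * ?I) = ennreal (2 ^ (DIM('a) + 1) * (1 - \<sigma>)\<^sup>2) * ?I"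
    by (simp add: ennreal_mult mult_ac)
  finally show ?thesis unfolding z_def .
qed

section \<open>A smooth cutoff function\<close>

lemma cutoff_exists:
  obtains \<theta> :: "'a::euclidean_space \<Rightarrow> real" and M where "\<theta> \<in> test_functions" "M > 0"
    "\<And>x. 0 \<le> \<theta> x" "\<And>x. \<theta> x \<le> 1" "\<And>x. norm x \<le> 1 \<Longrightarrow> \<theta> x = 1" "\<And>x. norm x \<ge> 2 \<Longrightarrow> \<theta> x = 0"
    "\<And>x. norm (gradient \<theta> x) \<le> M" "\<And>x. norm x < 1 \<or> norm x > 2 \<Longrightarrow> gradient \<theta> x = 0"
proof -
  obtain \<rho> :: "'a \<Rightarrow> real" where rho: "mollifier \<rho>"
    using mollifier_exists unfolding mollifier_def by metis
  note p = mollifier_props[OF rho]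
  \<comment> \<open>Radius 3/2 combined with mollification radius 1/2: the averages stay inside the
    ball when \<open>norm x \<le> 1\<close> and miss it when \<open>norm x \<ge> 2\<close>.\<close>
  define w where "w = (indicator (cball 0 (3 / 2)) :: 'a \<Rightarrow> real)"
  have m[measurable]: "w \<in> borel_measurable borel" unfolding w_def by (rule borel_measurable_indicator) auto
  have "nnr 1 (\<lambda>x. 1 * indicator (cball (0::'a) (3/2)) x) < \<infinity>" by (rule nnr_indicator_finite) simp
  then have fin: "nnr 1 w < \<infinity>" by (simp add: w_def)
  define \<theta> where "\<theta> = moll \<rho> (1/2) w"
  have s: "smooth \<theta>" unfolding \<theta>_def by (rule smooth_moll[OF nnr_locint[OF m fin] p(1)]) auto
  have i: "integrable lborel (\<lambda>y. w (x - (1/2) *\<^sub>R y) * \<rho> y)" for x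
    by (rule moll_integrable(2)[OF rho m fin]) auto
  have 0: "0 \<le> \<theta> x" for x unfolding \<theta>_def moll_def using p(2) by (intro Bochner_Integration.integral_nonneg) (auto simp: w_def)
  have 1: "\<theta> x \<le> 1" for x
  proof -
    have "\<theta> x \<le> (LINT y|lborel. \<rho> y)"
      unfolding \<theta>_def moll_def using p(2) by (intro integral_mono i p) (auto simp: w_def indicator_def)
    then show ?thesis by (simp add: p)
  qed
  have th1: "\<theta> x = 1" if "norm x \<le> 1" for x
  proof -
    have "w (x - (1/2) *\<^sub>R y) * \<rho> y = \<rho> y" for y
    proof (cases "norm y < 1")
      case True
      have "norm (x - (1/2) *\<^sub>R y) \<le> norm x + norm ((1/2) *\<^sub>R y)" by (rule norm_triangle_ineq4)
      then have "norm (x - (1/2) *\<^sub>R y) \<le> 3/2" using True that by simp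
      then show ?thesis by (simp add: w_def)
    qed (simp add: p)
    then show ?thesis unfolding \<theta>_def moll_def by (simp only: p(4))
  qed
  have th0: "\<theta> x = 0" if "norm x \<ge> 2" for x
  proof -
    have "w (x - (1/2) *\<^sub>R y) * \<rho> y = 0" for y
    proof (cases "norm y < 1")
      case True
      have "norm (x - (1/2) *\<^sub>R y) \<ge> norm x - norm ((1/2) *\<^sub>R y)" by (rule norm_triangle_ineq2)
      then have "\<not> norm (x - (1/2) *\<^sub>R y) \<le> 3/2" using True that by simp
      then show ?thesis by (simp add: w_def)
    qed (simp add: p)
    then show ?thesis unfolding \<theta>_def moll_def by (simp only: Bochner_Integration.integral_zero)
  qed
  have t: "\<theta> \<in> test_functions" using s th0 by (auto simp: test_functions_iff intro!: exI[of _ 2])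
  obtain M where M: "M > 0" "\<And>x h. \<bar>frechet_derivative \<theta> (at x) h\<bar> \<le> M * norm h" using pd_bound[OF t] by metis
  \<comment> \<open>The bound on directional derivatives is applied in the direction of the gradient
    itself.\<close>
  have g: "norm (gradient \<theta> x) \<le> M" for x
  proof -
    have "(norm (gradient \<theta> x))\<^sup>2 = gradient \<theta> x \<bullet> gradient \<theta> x" by (simp add: power2_norm_eq_inner)
    also have "\<dots> \<le> M * norm (gradient \<theta> x)" using M(2)[of x "gradient \<theta> x"] by (simp add: inner_gradient[OF s])
    finally show ?thesis using M(1) by (cases "gradient \<theta> x = 0") (auto simp: power2_eq_square)
  qed
  have z: "gradient \<theta> x = 0" if "norm x < 1 \<or> norm x > 2" for x
  proof (rule gradient_eqI)
    have "(\<theta> has_derivative (\<lambda>_. 0)) (at x)"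
    proof (cases "norm x < 1")
      case True
      then show ?thesis using th1
        by (intro has_derivative_transform_within_open[OF has_derivative_const[of 1] open_ball, of _ 0 1]) auto
    next
      case False
      have "open {y::'a. norm y > 2}" by (intro open_Collect_less continuous_intros)
      then show ?thesis using th0 that False
        by (intro has_derivative_transform_within_open[OF has_derivative_const[of 0], of "{y. norm y > 2}"]) auto
    qed
    then show "(\<theta> has_derivative (\<lambda>h. 0 \<bullet> h)) (at x)" by simp
  qed
  show ?thesis by (rule that[OF t M(1) 0 1 th1 th0 g z])
qed

section \<open>Testing the equation with its own dilations\<close>

text \<open>On a bounded support a higher power controls a lower one through |g|^s \<le> 1 + |g|^t.
  This lowers known integrability to the dual exponents that the pairings ask for.\<close>

lemma integrable_powr_bounded_support:
  fixes g :: "'a::euclidean_space \<Rightarrow> real"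
  assumes [measurable]: "g \<in> borel_measurable borel" and i: "integrable lborel (\<lambda>x. \<bar>g x\<bar> powr t)"
    and s: "0 < s" "s \<le> t" and R: "\<And>x. norm x > R \<Longrightarrow> g x = 0"
  shows "integrable lborel (\<lambda>x. \<bar>g x\<bar> powr s)"
proof -
  have 1: "integrable lborel (\<lambda>x. indicator (cball 0 R) x + \<bar>g x\<bar> powr t :: real)"
    by (intro Bochner_Integration.integrable_add i integrable_real_indicator emeasure_lborel_cball_finite) auto
  show ?thesis
  proof (rule Bochner_Integration.integrable_bound[OF 1])
    show "AE x in lborel. norm (\<bar>g x\<bar> powr s) \<le> norm (indicator (cball 0 R) x + \<bar>g x\<bar> powr t :: real)"
    proof (rule AE_I2)
      fix x
      show "norm (\<bar>g x\<bar> powr s) \<le> norm (indicator (cball 0 R) x + \<bar>g x\<bar> powr t :: real)"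
      proof (cases "norm x \<le> R")
        case True
        have "\<bar>g x\<bar> powr s \<le> 1 + \<bar>g x\<bar> powr t"
        proof (cases "\<bar>g x\<bar> \<le> 1")
          case True
          then have "\<bar>g x\<bar> powr s \<le> 1" using s by (intro powr_le1) auto
          then show ?thesis by (simp add: add_increasing2)
        next
          case False
          then have "\<bar>g x\<bar> powr s \<le> \<bar>g x\<bar> powr t" using s by (intro powr_mono) auto
          then show ?thesis by linarith
        qed
        then show ?thesis using True by (simp add: abs_of_nonneg)
      next
        case False
        then show ?thesis using R[of x] s by simp
      qed
    qed
  qed simp
qed

text \<open>This semiconvexity replaces the regularity of the solution.\<close>

lemma power_difference_semiconvex:
  fixes s t p q :: real
  assumes s: "s > 0" and t: "t > 0" and p: "1 < p" "p < q"
  shows "(s powr q - s powr p) * (t - s) \<le>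
    (t powr (q + 1) / (q + 1) - t powr (p + 1) / (p + 1)) - (s powr (q + 1) / (q + 1) - s powr (p + 1) / (p + 1)) + p / 2 * (t - s)\<^sup>2"
proof -
  let ?f = "\<lambda>t. t powr (q + 1) / (q + 1) - t powr (p + 1) / (p + 1) + p / 2 * t\<^sup>2"
  let ?f' = "\<lambda>t. t powr q - t powr p + p * t"
  let ?f'' = "\<lambda>t. q * t powr (q - 1) - p * t powr (p - 1) + p"
  have "?f' s * (t - s) \<le> ?f t - ?f s"
  proof (rule f''_imp_f'[where C = "{0<..}" and f'' = ?f''])
    fix x :: real assume "x \<in> {0<..}"
    then have x: "x > 0" by simp
    have d: "((\<lambda>t. t powr (c + 1) / (c + 1)) has_field_derivative x powr c) (at x)" if "c > 0" for c :: real
      using DERIV_cdivide[OF has_real_derivative_powr[OF x, of "c + 1"], of "c + 1"] that by simp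
    have "((\<lambda>t. p / 2 * t\<^sup>2) has_field_derivative p * x) (at x)"
      by (auto intro!: derivative_eq_intros)
    with d show "(?f has_field_derivative ?f' x) (at x)"
      using p by (intro DERIV_add DERIV_diff) auto
    have "((\<lambda>t. p * t) has_field_derivative p) (at x)"
      by (auto intro!: derivative_eq_intros)
    then show "(?f' has_field_derivative ?f'' x) (at x)"
      by (intro DERIV_add DERIV_diff has_real_derivative_powr x)
    \<comment> \<open>The only negative term is p x^(p-1). For x \<le> 1 the added \<open>p\<close>
      outweighs it, for x > 1 the term with the larger exponent does; this is where the coefficient
      p/2 of the square comes from.\<close>
    show "?f'' x \<ge> 0"
    proof (cases "x \<le> 1")
      case True
      then have "x powr (p - 1) \<le> 1" using x p by (intro powr_le1) auto
      then have "p * x powr (p - 1) \<le> p" using p by (simp add: mult_left_le)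
      then show ?thesis using p by (smt (verit) mult_nonneg_nonneg powr_ge_zero)
    next
      case False
      then have "x powr (p - 1) \<le> x powr (q - 1)" using p by (intro powr_mono) auto
      then have "p * x powr (p - 1) \<le> q * x powr (q - 1)" using p by (intro mult_mono) auto
      then show ?thesis using p by simp
    qed
  qed (use s t in auto)
  then show ?thesis by (simp add: power2_eq_square field_simps)
qed

text \<open>In both bounds the constant \<open>c\<close> comes from the tangent at 1 and the
  constant 1 from comparing s^c with s. The upper bound will be used for the amplitude factor with
  exponent \<open>\<alpha>\<close>, the lower one for the supercritical scaling defect.\<close>

lemma bernoulli_powr:
  fixes s c :: real assumes "0 < s" "s \<le> 1" "c > 0"
  shows "1 - s powr c \<le> max 1 c * (1 - s)" "1 - s powr c \<ge> min 1 c * (1 - s)"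
proof -
  have A: "1 + c * (s - 1) \<le> s powr c" if "c \<ge> 1"
  proof -
    have "(c * 1 powr (c - 1)) * (s - 1) \<le> s powr c - 1 powr c"
      by (rule f''_imp_f'[where C = "{0<..}" and f' = "\<lambda>x. c * x powr (c - 1)" and f'' = "\<lambda>x. c * ((c - 1) * x powr (c - 2))"])
         (use that assms in \<open>auto intro!: derivative_eq_intros simp: field_simps\<close>)
    then show ?thesis by simp
  qed
  have B: "s \<le> s powr c" if "c \<le> 1" using powr_mono'[of c 1 s] that assms by simp
  have C: "s powr c \<le> s" if "c \<ge> 1" using powr_mono'[of 1 c s] that assms by simp
  have D: "s powr c \<le> 1 + c * (s - 1)" if "c \<le> 1"
    using Youngs_inequality_0[of c "1 - c" s 1] that assms by (simp add: algebra_simps)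
  show "1 - s powr c \<le> max 1 c * (1 - s)" using A B by (cases "c \<ge> 1") (auto simp: max_def algebra_simps)
  show "1 - s powr c \<ge> min 1 c * (1 - s)" using C D by (cases "c \<ge> 1") (auto simp: min_def algebra_simps)
qed

section \<open>The equation for an everywhere positive Borel representative\<close>

text \<open>The analysis is done with Borel functions, \<open>lborel\<close> and positivity at every
  point; \<open>no_weak_solution\<close> produces such representatives from data given almost
  everywhere. \<open>\<alpha>\<close> is the amplitude exponent of the critical dilation.\<close>

locale critical_equation =
  fixes u :: "'a::euclidean_space \<Rightarrow> real" and G :: "'a \<Rightarrow> 'a" and \<mu> q \<beta> \<alpha> :: real
  defines "\<beta> \<equiv> critical_exponent DIM('a)" and "\<alpha> \<equiv> (real DIM('a) - 2) / 2"
  assumes dim: "DIM('a) \<ge> 3" and q: "q > \<beta> - 1"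
    and um [measurable]: "u \<in> borel_measurable borel" and pos: "\<And>x. u x > 0"
    and ub: "integrable lborel (\<lambda>x. u x powr \<beta>)" and uq: "integrable lborel (\<lambda>x. u x powr (q + 1))"
    and Gm [measurable]: "G \<in> borel_measurable borel" and Gi: "integrable lborel (\<lambda>x. (norm (G x))\<^sup>2)"
    and weak: "\<And>\<phi> i. \<phi> \<in> test_functions \<Longrightarrow> i \<in> Basis \<Longrightarrow>
        (LINT y|lborel. u y * pd \<phi> i y) = - (LINT y|lborel. \<phi> y * (G y \<bullet> i))"
    and eqn: "\<And>\<phi>. \<phi> \<in> test_functions \<Longrightarrow>
        (LINT x|lborel. G x \<bullet> gradient \<phi> x) - \<mu> * (LINT x|lborel. u x * \<phi> x / (norm x)\<^sup>2)
          = (LINT x|lborel. (u x powr (\<beta> - 1) - u x powr q) * \<phi> x)"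
begin

text \<open>The two equations with \<alpha> express dilation invariance of the critical term and of
  the quadratic terms, the inequality with \<open>q\<close> the supercritical defect. The last three
  facts concern the conjugate exponent of \<beta>, which lies below 2 and so can be reached from L^2
  on bounded sets.\<close>

lemma exponents: "\<beta> > 2" "\<alpha> > 0" "\<alpha> * \<beta> = real DIM('a)" "2 * \<alpha> + 2 = real DIM('a)" "\<alpha> * (q + 1) > real DIM('a)"
  "\<beta> / (\<beta> - 1) > 1" "\<beta> / (\<beta> - 1) < 2" "1 / (\<beta> / (\<beta> - 1)) + 1 / \<beta> = 1"
proof -
  have d: "real DIM('a) \<ge> 3" using dim by simp
  show b: "\<beta> > 2" using d by (simp add: \<beta>_def critical_exponent_def field_simps)
  show a: "\<alpha> > 0" using d by (simp add: \<alpha>_def)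
  show ab: "\<alpha> * \<beta> = real DIM('a)" using d by (simp add: \<alpha>_def \<beta>_def critical_exponent_def)
  show "2 * \<alpha> + 2 = real DIM('a)" by (simp add: \<alpha>_def field_simps)
  have "\<alpha> * \<beta> < \<alpha> * (q + 1)" using a q by simp
  then show "\<alpha> * (q + 1) > real DIM('a)" using ab by simp
  show "\<beta> / (\<beta> - 1) > 1" "\<beta> / (\<beta> - 1) < 2" "1 / (\<beta> / (\<beta> - 1)) + 1 / \<beta> = 1"
    using b by (auto simp: field_simps)
qed

lemma G_component: "i \<in> Basis \<Longrightarrow> integrable lborel (\<lambda>x. \<bar>G x \<bullet> i\<bar> powr 2)"
proof (rule Bochner_Integration.integrable_bound[OF Gi])
  assume i: "i \<in> Basis"
  show "AE x in lborel. norm (\<bar>G x \<bullet> i\<bar> powr 2) \<le> norm ((norm (G x))\<^sup>2)"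
    using power_mono[OF Basis_le_norm[OF i] abs_ge_zero, where n=2] by auto
qed simp

text \<open>Since \<open>\<eta> x * z x\<close> is not smooth, the equation is tested with
  \<open>\<eta>\<close> times the dilation difference of mollifications of \<open>u\<close>, and
  every term passes to the limit by \<open>Lto_pairing\<close>. That \<open>\<eta>\<close> vanishes
  near 0 keeps \<eta>/|x|^2 bounded.\<close>

lemma tested:
  assumes \<eta>: "\<eta> \<in> test_functions" and r0: "r0 > 0" "\<And>x. norm x < r0 \<Longrightarrow> \<eta> x = 0" and \<sigma>: "\<sigma> > 0"
  defines "z \<equiv> \<lambda>x. \<sigma> powr \<alpha> * u (\<sigma> *\<^sub>R x) - u x"
    and "H \<equiv> \<lambda>x. \<sigma> powr (\<alpha> + 1) *\<^sub>R G (\<sigma> *\<^sub>R x)"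
  shows "integrable lborel (\<lambda>x. (G x \<bullet> gradient \<eta> x) * z x)"
    "integrable lborel (\<lambda>x. \<eta> x * (G x \<bullet> (H x - G x)))"
    "integrable lborel (\<lambda>x. u x * (\<eta> x / (norm x)\<^sup>2) * z x)"
    "integrable lborel (\<lambda>x. u x powr (\<beta> - 1) * \<eta> x * z x)"
    "integrable lborel (\<lambda>x. u x powr q * \<eta> x * z x)"
    "(LINT x|lborel. (G x \<bullet> gradient \<eta> x) * z x) + (LINT x|lborel. \<eta> x * (G x \<bullet> (H x - G x)))
      - \<mu> * (LINT x|lborel. u x * (\<eta> x / (norm x)\<^sup>2) * z x) =
      (LINT x|lborel. u x powr (\<beta> - 1) * \<eta> x * z x) - (LINT x|lborel. u x powr q * \<eta> x * z x)"
proof -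
  let ?IG = "\<lambda>f. LINT x|lborel. (G x \<bullet> gradient \<eta> x) * f x"
  let ?IM = "\<lambda>f. LINT x|lborel. u x * (\<eta> x / (norm x)\<^sup>2) * f x"
  let ?IP = "\<lambda>r f. LINT x|lborel. u x powr r * \<eta> x * f x"
  let ?IH = "\<lambda>i f. LINT x|lborel. \<eta> x * (G x \<bullet> i) * f x i"
  note e = exponents
  have q1: "q + 1 > 1" "(q + 1) / q > 1" "1 / ((q + 1) / q) + 1 / (q + 1) = 1" "q > 0"
    using e(1) q by (auto simp: field_simps)
  have \<eta>s: "smooth \<eta>" by (rule test_smooth[OF \<eta>])
  have \<eta>m[measurable]: "\<eta> \<in> borel_measurable borel" "gradient \<eta> \<in> borel_measurable borel"
    by (auto intro: smooth_measurable gradient_measurable \<eta>s)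
  obtain B where B: "B > 0" "\<And>x. \<bar>\<eta> x\<bar> \<le> B" using test_bounded[OF \<eta>] by metis
  obtain R where R: "\<And>x. norm x > R \<Longrightarrow> \<eta> x = 0" using \<eta> by (auto simp: test_functions_iff)
  obtain M where M: "M > 0" "\<And>x h. \<bar>frechet_derivative \<eta> (at x) h\<bar> \<le> M * norm h" using pd_bound[OF \<eta>] by metis
  have gR: "\<exists>R. \<forall>x. norm x > R \<longrightarrow> gradient \<eta> x = 0"
  proof (intro exI allI impI gradient_eqI)
    fix x :: 'a assume x: "norm x > R"
    have "open {y::'a. norm y > R}" by (intro open_Collect_less continuous_intros)
    then have "(\<eta> has_derivative (\<lambda>_. 0)) (at x)" using R x
      by (intro has_derivative_transform_within_open[OF has_derivative_const[of 0], of "{y. norm y > R}"]) auto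
    then show "(\<eta> has_derivative (\<lambda>h. 0 \<bullet> h)) (at x)" by simp
  qed
  obtain \<rho> :: "'a \<Rightarrow> real" where rho: "mollifier \<rho>"
    using mollifier_exists unfolding mollifier_def by metis
  have rt: "\<rho> \<in> test_functions" using rho by (simp add: mollifier_def)
  define \<epsilon> where "\<epsilon> = (\<lambda>k::nat. 1 / (real k + 1))"
  have \<epsilon>: "\<epsilon> k > 0" for k by (simp add: \<epsilon>_def)
  define U where "U = (\<lambda>k. moll \<rho> (\<epsilon> k) u)"
  have ufin: "nnr \<beta> u < \<infinity>" "nnr (q + 1) u < \<infinity>"
    using ub uq nnr_finite_integrable[OF um] pos by (auto simp: abs_of_pos)
  have U: "Lto \<beta> U u" "Lto (q + 1) U u" unfolding U_def \<epsilon>_def using e(1) q1(1)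
    by (auto intro!: Lto_moll[OF rho um] ufin)
  have lu: "locint u" by (rule nnr_locint[OF um ufin(2)]) (use q1 in auto)
  have Us: "smooth (U k)" for k unfolding U_def by (rule smooth_moll[OF lu rt \<epsilon>])
  have gU: "gradient (U k) x \<bullet> i = moll \<rho> (\<epsilon> k) (\<lambda>x. G x \<bullet> i) x" if "i \<in> Basis" for k x i
    unfolding U_def by (rule gradient_moll[OF lu _ rt \<epsilon> that]) (use weak that in auto)
  have Gc: "Lto 2 (\<lambda>k x. gradient (U k) x \<bullet> i) (\<lambda>x. G x \<bullet> i)" if "i \<in> Basis" for i
    unfolding gU[OF that] \<epsilon>_def using G_component[OF that] nnr_finite_integrable[of "\<lambda>x. G x \<bullet> i" 2]
    by (intro Lto_moll[OF rho]) auto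
  \<comment> \<open>The shapes \<open>+ 0\<close> and \<open>(-1) * U k x\<close> match the affine
    and additive rules for smoothness and gradients.\<close>
  define W where "W = (\<lambda>k x. \<sigma> powr \<alpha> * U k (\<sigma> *\<^sub>R x + 0) + (-1) * U k x)"
  have Ws: "smooth (W k)" for k unfolding W_def
    by (intro smooth_add smooth_mult smooth_const smooth_affine Us)
  have Wz: "Lto r W z" if "r \<in> {\<beta>, q + 1}" for r
  proof -
    have "r \<ge> 0" "Lto r U u" using that U e(1) q1 by auto
    then have "Lto r (\<lambda>k x. \<sigma> powr \<alpha> * U k (\<sigma> *\<^sub>R x) + (-1) * U k x) (\<lambda>x. \<sigma> powr \<alpha> * u (\<sigma> *\<^sub>R x) + (-1) * u x)"
      by (intro Lto_add Lto_mult_bounded[where B = "\<sigma> powr \<alpha>"] Lto_mult_bounded[where B = 1] Lto_scale \<sigma>) auto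
    then show ?thesis by (simp add: W_def z_def)
  qed
  have gW: "gradient (W k) x = \<sigma> powr (\<alpha> + 1) *\<^sub>R gradient (U k) (\<sigma> *\<^sub>R x) - gradient (U k) x" for k x
  proof -
    have "gradient (W k) x = gradient (\<lambda>x. \<sigma> powr \<alpha> * U k (\<sigma> *\<^sub>R x + 0)) x + gradient (\<lambda>x. (-1) * U k x) x"
      unfolding W_def by (intro gradient_add smooth_mult smooth_const smooth_affine Us)
    also have "\<dots> = \<sigma> powr \<alpha> *\<^sub>R (\<sigma> *\<^sub>R gradient (U k) (\<sigma> *\<^sub>R x + 0)) + (-1) *\<^sub>R gradient (U k) x"
      by (simp only: gradient_cmult[OF smooth_affine[OF Us]] gradient_cmult[OF Us] gradient_affine[OF Us])
    finally show ?thesis using \<sigma> by (simp add: powr_add)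
  qed
  define T where "T = (\<lambda>k x. \<eta> x * W k x)"
  have T: "T k \<in> test_functions" for k unfolding T_def by (rule test_mult_smooth[OF \<eta> Ws])
  have gT: "G x \<bullet> gradient (T k) x = (G x \<bullet> gradient \<eta> x) * W k x +
     (\<Sum>i\<in>Basis. \<eta> x * (G x \<bullet> i) * (\<sigma> powr (\<alpha> + 1) * (gradient (U k) (\<sigma> *\<^sub>R x) \<bullet> i) + (-1) * (gradient (U k) x \<bullet> i)))" for k x
  proof -
    have "G x \<bullet> (\<eta> x *\<^sub>R (\<sigma> powr (\<alpha> + 1) *\<^sub>R gradient (U k) (\<sigma> *\<^sub>R x) - gradient (U k) x)) =
      (\<Sum>i\<in>Basis. \<eta> x * (G x \<bullet> i) * (\<sigma> powr (\<alpha> + 1) * (gradient (U k) (\<sigma> *\<^sub>R x) \<bullet> i) + (-1) * (gradient (U k) x \<bullet> i)))"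
      by (subst euclidean_inner) (intro sum.cong refl, simp add: inner_simps)
    then show ?thesis
      unfolding T_def gradient_mult[OF \<eta>s Ws] inner_add_right gW by (simp add: mult.commute)
  qed
  have limG: "integrable lborel (\<lambda>x. (G x \<bullet> gradient \<eta> x) * z x)"
      "\<And>k. integrable lborel (\<lambda>x. (G x \<bullet> gradient \<eta> x) * W k x)"
      "(\<lambda>k. ?IG (W k)) \<longlonglongrightarrow> ?IG z"
  proof -
    obtain R' where R': "\<And>x. norm x > R' \<Longrightarrow> gradient \<eta> x = 0" using gR by blast
    \<comment> \<open>\<open>G\<close> is only square integrable while \<open>W\<close> converges in
      L^\<beta>. The bounded support of the gradient of \<open>\<eta>\<close> lowers L^2 to the
      conjugate exponent of \<beta>.\<close>
    have "integrable lborel (\<lambda>x. \<bar>G x \<bullet> gradient \<eta> x\<bar> powr 2)"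
    proof (rule Bochner_Integration.integrable_bound)
      show "integrable lborel (\<lambda>x. M\<^sup>2 * (norm (G x))\<^sup>2)" using Gi by simp
      have "\<bar>G x \<bullet> gradient \<eta> x\<bar> \<le> M * norm (G x)" for x
        using M(2)[of x "G x"] inner_gradient[OF \<eta>s, of x "G x"] by (simp add: inner_commute)
      from power_mono[OF this, where n=2]
      show "AE x in lborel. norm (\<bar>G x \<bullet> gradient \<eta> x\<bar> powr 2) \<le> norm (M\<^sup>2 * (norm (G x))\<^sup>2)"
        by (auto simp: power_mult_distrib)
    qed simp
    then have i: "integrable lborel (\<lambda>x. \<bar>G x \<bullet> gradient \<eta> x\<bar> powr (\<beta> / (\<beta> - 1)))"
    proof (rule integrable_powr_bounded_support[rotated])
      show "\<beta> / (\<beta> - 1) > 0" "\<beta> / (\<beta> - 1) \<le> 2" using e(6,7) by linarith+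
      show "G x \<bullet> gradient \<eta> x = 0" if "norm x > R'" for x using R'[OF that] by simp
    qed measurable
    have "\<beta> > 1" using e(1) by simp
    note L = Lto_pairing[OF Wz this e(6,8) _ i]
    show "integrable lborel (\<lambda>x. (G x \<bullet> gradient \<eta> x) * z x)"
      "\<And>k. integrable lborel (\<lambda>x. (G x \<bullet> gradient \<eta> x) * W k x)"
      "(\<lambda>k. ?IG (W k)) \<longlonglongrightarrow> ?IG z"
      by (rule L; simp)+
  qed
  show "integrable lborel (\<lambda>x. (G x \<bullet> gradient \<eta> x) * z x)" by (rule limG)
  let ?d = "\<lambda>k x i. \<sigma> powr (\<alpha> + 1) * (gradient (U k) (\<sigma> *\<^sub>R x) \<bullet> i) + (-1) * (gradient (U k) x \<bullet> i)"
  let ?e = "\<lambda>x i. \<sigma> powr (\<alpha> + 1) * (G (\<sigma> *\<^sub>R x) \<bullet> i) + (-1) * (G x \<bullet> i)"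
  have limH: "integrable lborel (\<lambda>x. \<eta> x * (G x \<bullet> i) * ?e x i)"
      "\<And>k. integrable lborel (\<lambda>x. \<eta> x * (G x \<bullet> i) * ?d k x i)"
      "(\<lambda>k. ?IH i (?d k)) \<longlonglongrightarrow> (?IH i ?e)"
    if i: "i \<in> Basis" for i
  proof -
    have 1: "Lto 2 (\<lambda>k x. ?d k x i) (\<lambda>x. ?e x i)"
      by (intro Lto_add Lto_mult_bounded[where B = "\<sigma> powr (\<alpha>+1)"] Lto_mult_bounded[where B = 1]
           Lto_scale[OF Gc[OF i] \<sigma>] Gc[OF i]) auto
    have 2: "integrable lborel (\<lambda>x. \<bar>\<eta> x * (G x \<bullet> i)\<bar> powr 2)"
    proof (rule Bochner_Integration.integrable_bound)
      show "integrable lborel (\<lambda>x. B\<^sup>2 * \<bar>G x \<bullet> i\<bar> powr 2)" using G_component[OF i] by (rule integrable_mult_right)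
      have "(\<eta> x)\<^sup>2 \<le> B\<^sup>2" for x using power_mono[OF B(2)[of x], of 2] by simp
      then show "AE x in lborel. norm (\<bar>\<eta> x * (G x \<bullet> i)\<bar> powr 2) \<le> norm (B\<^sup>2 * \<bar>G x \<bullet> i\<bar> powr 2)"
        by (auto simp: power_mult_distrib intro!: mult_right_mono)
    qed simp
    note L = Lto_pairing[OF 1 _ _ _ _ 2]
    show "integrable lborel (\<lambda>x. \<eta> x * (G x \<bullet> i) * ?e x i)"
      "\<And>k. integrable lborel (\<lambda>x. \<eta> x * (G x \<bullet> i) * ?d k x i)"
      "(\<lambda>k. ?IH i (?d k)) \<longlonglongrightarrow> (?IH i ?e)"
      by (rule L; simp)+
  qed
  have He: "\<eta> x * (G x \<bullet> (H x - G x)) = (\<Sum>i\<in>Basis. \<eta> x * (G x \<bullet> i) * ?e x i)" for x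
    unfolding H_def by (subst euclidean_inner) (simp add: inner_simps sum_distrib_left mult.assoc)
  show "integrable lborel (\<lambda>x. \<eta> x * (G x \<bullet> (H x - G x)))"
    unfolding He by (intro Bochner_Integration.integrable_sum limH)
  have limM: "integrable lborel (\<lambda>x. u x * (\<eta> x / (norm x)\<^sup>2) * z x)"
      "\<And>k. integrable lborel (\<lambda>x. u x * (\<eta> x / (norm x)\<^sup>2) * W k x)"
      "(\<lambda>k. ?IM (W k)) \<longlonglongrightarrow> ?IM z"
  proof -
    have w: "\<bar>\<eta> x / (norm x)\<^sup>2\<bar> \<le> B / r0\<^sup>2" for x
    proof (cases "norm x < r0")
      case False
      then have "r0\<^sup>2 \<le> (norm x)\<^sup>2" using r0 by (intro power_mono) auto
      then show ?thesis using B r0 by (auto simp: abs_divide intro!: frac_le)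
    qed (use r0 B in auto)
    have "integrable lborel (\<lambda>x. \<bar>u x * (\<eta> x / (norm x)\<^sup>2)\<bar> powr \<beta>)"
    proof (rule Bochner_Integration.integrable_bound)
      show "integrable lborel (\<lambda>x. (B / r0\<^sup>2) powr \<beta> * u x powr \<beta>)" using ub by (rule integrable_mult_right)
      have "\<bar>u x * (\<eta> x / (norm x)\<^sup>2)\<bar> powr \<beta> \<le> (B / r0\<^sup>2) powr \<beta> * u x powr \<beta>" for x
        unfolding abs_mult abs_of_pos[OF pos] powr_mult mult.commute[of "u x powr \<beta>"]
        by (intro mult_right_mono powr_mono2 w) (use e(1) in auto)
      then show "AE x in lborel. norm (\<bar>u x * (\<eta> x / (norm x)\<^sup>2)\<bar> powr \<beta>) \<le> norm ((B / r0\<^sup>2) powr \<beta> * u x powr \<beta>)"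
        by (auto intro: order_trans[OF _ abs_ge_self])
    qed simp
    then have i: "integrable lborel (\<lambda>x. \<bar>u x * (\<eta> x / (norm x)\<^sup>2)\<bar> powr (\<beta> / (\<beta> - 1)))"
    proof (rule integrable_powr_bounded_support[rotated])
      show "\<beta> / (\<beta> - 1) > 0" "\<beta> / (\<beta> - 1) \<le> \<beta>" using e(1,6,7) by linarith+
      show "u x * (\<eta> x / (norm x)\<^sup>2) = 0" if "norm x > R" for x using R[OF that] by simp
    qed measurable
    have "\<beta> > 1" using e(1) by simp
    note L = Lto_pairing[OF Wz this e(6,8) _ i]
    show "integrable lborel (\<lambda>x. u x * (\<eta> x / (norm x)\<^sup>2) * z x)"
      "\<And>k. integrable lborel (\<lambda>x. u x * (\<eta> x / (norm x)\<^sup>2) * W k x)"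
      "(\<lambda>k. ?IM (W k)) \<longlonglongrightarrow> ?IM z"
      by (rule L; simp)+
  qed
  show "integrable lborel (\<lambda>x. u x * (\<eta> x / (norm x)\<^sup>2) * z x)" by (rule limM)
  have limP: "integrable lborel (\<lambda>x. u x powr r * \<eta> x * z x)"
      "\<And>k. integrable lborel (\<lambda>x. u x powr r * \<eta> x * W k x)"
      "(\<lambda>k. ?IP r (W k)) \<longlonglongrightarrow> ?IP r z"
    if r: "r \<in> {\<beta> - 1, q}" for r
  proof -
    \<comment> \<open>u^r lies in the dual of L^(r+1) because \<open>u\<close> lies in L^(r+1).
      Hence each power term uses convergence in its own space, with exponent \<open>\<beta>\<close>
      or \<open>q + 1\<close>.\<close>
    have r': "r > 0" "r + 1 > 1" "(r + 1) / r > 1" "1 / ((r + 1) / r) + 1 / (r + 1) = 1" "r + 1 \<in> {\<beta>, q + 1}"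
      using r e(1) q1 by (auto simp: field_simps)
    have "integrable lborel (\<lambda>x. \<bar>u x powr r * \<eta> x\<bar> powr ((r + 1) / r))"
    proof (rule Bochner_Integration.integrable_bound)
      have "integrable lborel (\<lambda>x. u x powr (r + 1))" using r ub uq by auto
      then show "integrable lborel (\<lambda>x. B powr ((r + 1) / r) * u x powr (r + 1))" by (rule integrable_mult_right)
      have "\<bar>u x powr r * \<eta> x\<bar> powr ((r + 1) / r) \<le> B powr ((r + 1) / r) * u x powr (r + 1)" for x
      proof -
        have "\<bar>u x powr r * \<eta> x\<bar> powr ((r + 1) / r) = \<bar>\<eta> x\<bar> powr ((r + 1) / r) * u x powr (r + 1)"
          using r' by (simp add: abs_mult powr_mult powr_powr mult.commute)
        also have "\<dots> \<le> B powr ((r + 1) / r) * u x powr (r + 1)"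
          using r' by (intro mult_right_mono powr_mono2 B) auto
        finally show ?thesis .
      qed
      then show "AE x in lborel. norm (\<bar>u x powr r * \<eta> x\<bar> powr ((r + 1) / r)) \<le> norm (B powr ((r + 1) / r) * u x powr (r + 1))"
        by (auto intro: order_trans[OF _ abs_ge_self])
    qed simp
    note L = Lto_pairing[OF Wz[OF r'(5)] r'(2,3,4) _ this]
    show "integrable lborel (\<lambda>x. u x powr r * \<eta> x * z x)"
      "\<And>k. integrable lborel (\<lambda>x. u x powr r * \<eta> x * W k x)"
      "(\<lambda>k. ?IP r (W k)) \<longlonglongrightarrow> ?IP r z"
      by (rule L; simp)+
  qed
  show "integrable lborel (\<lambda>x. u x powr (\<beta> - 1) * \<eta> x * z x)" "integrable lborel (\<lambda>x. u x powr q * \<eta> x * z x)"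
    by (auto intro: limP)
  have eq: "?IG (W k) + (\<Sum>i\<in>Basis. ?IH i (?d k))
      - \<mu> * ?IM (W k) =
      ?IP (\<beta> - 1) (W k) - ?IP q (W k)" for k
  proof -
    have 1: "(LINT x|lborel. G x \<bullet> gradient (T k) x) = ?IG (W k) + (\<Sum>i\<in>Basis. ?IH i (?d k))"
      unfolding gT
      by (simp only: Bochner_Integration.integral_add[OF limG(2) Bochner_Integration.integrable_sum[OF limH(2)]]
          Bochner_Integration.integral_sum[OF limH(2)])
    have 2: "(LINT x|lborel. u x * T k x / (norm x)\<^sup>2) = ?IM (W k)"
      by (simp add: T_def mult_ac)
    have 3: "(LINT x|lborel. (u x powr (\<beta> - 1) - u x powr q) * T k x) =
      ?IP (\<beta> - 1) (W k) - ?IP q (W k)"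
    proof -
      have "(u x powr (\<beta> - 1) - u x powr q) * T k x = u x powr (\<beta> - 1) * \<eta> x * W k x - u x powr q * \<eta> x * W k x" for x
        by (simp add: T_def left_diff_distrib mult.assoc)
      then show ?thesis
        by (simp only: Bochner_Integration.integral_diff[OF limP(2) limP(2)] insert_iff simp_thms)
    qed
    show ?thesis using eqn[OF T[of k]] unfolding 1 2 3 .
  qed
  have "(\<lambda>k. ?IG (W k) + (\<Sum>i\<in>Basis. ?IH i (?d k))
      - \<mu> * ?IM (W k)) \<longlonglongrightarrow>
      ?IG z + (\<Sum>i\<in>Basis. ?IH i ?e)
      - \<mu> * ?IM z"
    by (intro tendsto_intros limG(3) limH(3) limM(3))
  moreover have "(\<lambda>k. ?IG (W k) + (\<Sum>i\<in>Basis. ?IH i (?d k))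
      - \<mu> * ?IM (W k)) \<longlonglongrightarrow>
      ?IP (\<beta> - 1) z - ?IP q z"
    unfolding eq by (intro tendsto_intros limP(3)) auto
  ultimately have "?IG z + (\<Sum>i\<in>Basis. ?IH i ?e)
      - \<mu> * ?IM z =
      ?IP (\<beta> - 1) z - ?IP q z"
    by (rule LIMSEQ_unique)
  moreover have "(LINT x|lborel. \<eta> x * (G x \<bullet> (H x - G x))) = (\<Sum>i\<in>Basis. ?IH i ?e)"
    unfolding He by (rule Bochner_Integration.integral_sum) (rule limH)
  ultimately show "?IG z + (LINT x|lborel. \<eta> x * (G x \<bullet> (H x - G x)))
      - \<mu> * ?IM z =
      ?IP (\<beta> - 1) z - ?IP q z"
    by simp
qed

section \<open>Energy densities and the tested inequality\<close>

text \<open>The part of the energy density whose integral is invariant under the dilation. The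
  supercritical part is kept apart in \<open>e1\<close> because it alone picks up a power of
  \<sigma>.\<close>

definition e0 :: "'a \<Rightarrow> real" where
  "e0 x = (norm (G x))\<^sup>2 / 2 - \<mu> * (u x)\<^sup>2 / (2 * (norm x)\<^sup>2) - u x powr \<beta> / \<beta>"

definition e1 :: "'a \<Rightarrow> real" where
  "e1 x = u x powr (q + 1) / (q + 1)"

text \<open>A majorant of all energy terms, free of signs and coefficients; the errors are measured
  in it.\<close>

definition dens :: "'a \<Rightarrow> real" where
  "dens x = (norm (G x))\<^sup>2 + (u x)\<^sup>2 / (norm x)\<^sup>2 + u x powr \<beta> + u x powr (q + 1)"

abbreviation mass :: "'a set \<Rightarrow> real" where
  "mass S \<equiv> LINT x|lborel. indicator S x * dens x"

lemma dens_nonneg: "dens x \<ge> 0" by (simp add: dens_def)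

lemma e_measurable [measurable]: "e0 \<in> borel_measurable borel" "e1 \<in> borel_measurable borel" "dens \<in> borel_measurable borel"
  unfolding e0_def[abs_def] e1_def[abs_def] dens_def[abs_def] by measurable

text \<open>Every coefficient in the energy has modulus at most 1 + |\<mu>|, because 2,
  \<open>\<beta>\<close> and \<open>q + 1\<close> exceed 1.\<close>

lemma e_bound: "\<bar>e0 x + e1 x\<bar> \<le> (1 + \<bar>\<mu>\<bar>) * dens x" "\<bar>e0 x\<bar> \<le> (1 + \<bar>\<mu>\<bar>) * dens x" "\<bar>e1 x\<bar> \<le> (1 + \<bar>\<mu>\<bar>) * dens x"
proof -
  let ?k = "1 + \<bar>\<mu>\<bar>"
  have 1: "\<bar>(norm (G x))\<^sup>2 / 2\<bar> \<le> ?k * (norm (G x))\<^sup>2"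
    using mult_right_mono[of "1/2" ?k "(norm (G x))\<^sup>2"] by simp
  have 2: "\<bar>\<mu> * (u x)\<^sup>2 / (2 * (norm x)\<^sup>2)\<bar> \<le> ?k * ((u x)\<^sup>2 / (norm x)\<^sup>2)"
    using mult_right_mono[of "\<bar>\<mu>\<bar> / 2" ?k "(u x)\<^sup>2 / (norm x)\<^sup>2"] by (simp add: abs_mult abs_divide)
  have 3: "\<bar>u x powr \<beta> / \<beta>\<bar> \<le> ?k * u x powr \<beta>"
  proof -
    have "1 / \<beta> \<le> 1" using exponents(1) by simp
    then have "1 / \<beta> \<le> ?k" by linarith
    from mult_right_mono[OF this, of "u x powr \<beta>"] show ?thesis using exponents(1) by simp
  qed
  have 4: "\<bar>e1 x\<bar> \<le> ?k * u x powr (q + 1)"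
  proof -
    have "1 / (q + 1) \<le> 1" using exponents(1) q by simp
    then have "1 / (q + 1) \<le> ?k" by linarith
    from mult_right_mono[OF this, of "u x powr (q + 1)"] show ?thesis using exponents(1) q by (simp add: e1_def)
  qed
  have nn: "?k * (norm (G x))\<^sup>2 \<ge> 0" "?k * ((u x)\<^sup>2 / (norm x)\<^sup>2) \<ge> 0" "?k * u x powr \<beta> \<ge> 0" "?k * u x powr (q + 1) \<ge> 0"
    by auto
  have d: "?k * dens x = ?k * (norm (G x))\<^sup>2 + ?k * ((u x)\<^sup>2 / (norm x)\<^sup>2) + ?k * u x powr \<beta> + ?k * u x powr (q + 1)"
    by (simp add: dens_def distrib_left)
  show "\<bar>e0 x + e1 x\<bar> \<le> ?k * dens x" "\<bar>e0 x\<bar> \<le> ?k * dens x" "\<bar>e1 x\<bar> \<le> ?k * dens x"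
    unfolding d e0_def using 1 2 3 4 nn by linarith+
qed

text \<open>The singular term is integrable here because |x|^2 is bounded below on \<open>S\<close>
  and u^2 \<le> 1 + u^\<beta>, where the 1 is integrated over a ball only.\<close>

lemma dens_integrable:
  assumes [measurable]: "S \<in> sets borel" and S: "\<And>x. x \<in> S \<Longrightarrow> r \<le> norm x \<and> norm x \<le> R" and r: "r > 0"
  shows "integrable lborel (\<lambda>x. indicator S x * dens x)"
proof (rule Bochner_Integration.integrable_bound)
  let ?g = "\<lambda>x. (norm (G x))\<^sup>2 + (indicator (cball 0 R) x + u x powr \<beta>) / r\<^sup>2 + u x powr \<beta> + u x powr (q + 1) :: real"
  show "integrable lborel ?g"
    by (intro Bochner_Integration.integrable_add integrable_divide Gi ub uq integrable_real_indicator emeasure_lborel_cball_finite) auto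
  have "indicator S x * dens x \<le> ?g x" for x
  proof (cases "x \<in> S")
    case True
    have "(u x)\<^sup>2 \<le> 1 + u x powr \<beta>"
    proof (cases "u x \<le> 1")
      case True
      then have "(u x)\<^sup>2 \<le> 1" using pos[of x] by (intro power_le_one) auto
      then show ?thesis by (simp add: add_increasing2)
    next
      case False
      then have "u x powr 2 \<le> u x powr \<beta>" using exponents(1) by (intro powr_mono) auto
      then show ?thesis using pos[of x] by simp
    qed
    moreover have "r\<^sup>2 \<le> (norm x)\<^sup>2" using S[OF True] r by (intro power_mono) auto
    ultimately have "(u x)\<^sup>2 / (norm x)\<^sup>2 \<le> (1 + u x powr \<beta>) / r\<^sup>2" using r
      by (intro frac_le) auto
    then show ?thesis using True S[OF True] by (simp add: dens_def)
  next
    case False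
    then show ?thesis using r by (auto simp: indicator_def)
  qed
  then show "AE x in lborel. norm (indicator S x * dens x) \<le> norm (?g x)"
    using dens_nonneg by (auto intro: order_trans[OF _ abs_ge_self] simp: abs_mult)
qed simp

text \<open>The scaling \<open>c\<close> anticipates the change of variables that moves the dilation
  from \<open>u\<close> onto the cutoff.\<close>

lemma cutoff_integrable:
  assumes \<eta>: "\<eta> \<in> test_functions" and r0: "r0 > 0" "\<And>x. norm x < r0 \<Longrightarrow> \<eta> x = 0" and c: "0 < c"
  shows "integrable lborel (\<lambda>x. \<eta> (c *\<^sub>R x) * e0 x)" "integrable lborel (\<lambda>x. \<eta> (c *\<^sub>R x) * e1 x)"
proof -
  have [measurable]: "\<eta> \<in> borel_measurable borel" by (intro smooth_measurable test_smooth \<eta>)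
  obtain B where B: "B > 0" "\<And>x. \<bar>\<eta> x\<bar> \<le> B" using test_bounded[OF \<eta>] by metis
  obtain R where R: "\<And>x. norm x > R \<Longrightarrow> \<eta> x = 0" using \<eta> by (auto simp: test_functions_iff)
  define S where "S = {x::'a. r0 / c \<le> norm x \<and> norm x \<le> R / c}"
  have S[measurable]: "S \<in> sets borel" unfolding S_def by measurable
  have i: "integrable lborel (\<lambda>x. B * (1 + \<bar>\<mu>\<bar>) * (indicator S x * dens x))"
    by (intro integrable_mult_right dens_integrable[OF S, of "r0/c" "R/c"]) (use r0 c in \<open>auto simp: S_def\<close>)
  have b: "norm (\<eta> (c *\<^sub>R x) * e x) \<le> norm (B * (1 + \<bar>\<mu>\<bar>) * (indicator S x * dens x))"
    if "\<bar>e x\<bar> \<le> (1 + \<bar>\<mu>\<bar>) * dens x" for e x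
  proof (cases "x \<in> S")
    case True
    have "\<bar>\<eta> (c *\<^sub>R x)\<bar> * \<bar>e x\<bar> \<le> B * ((1 + \<bar>\<mu>\<bar>) * dens x)"
      using that B by (intro mult_mono) auto
    then show ?thesis using True B(1) dens_nonneg[of x] by (simp add: abs_mult mult.assoc)
  next
    case False
    then have "c * norm x < r0 \<or> c * norm x > R" using c by (auto simp: S_def field_simps)
    then have "\<eta> (c *\<^sub>R x) = 0" using r0(2)[of "c *\<^sub>R x"] R[of "c *\<^sub>R x"] c by auto
    then show ?thesis by simp
  qed
  show "integrable lborel (\<lambda>x. \<eta> (c *\<^sub>R x) * e0 x)"
    by (rule Bochner_Integration.integrable_bound[OF i]) (use b e_bound in auto)
  show "integrable lborel (\<lambda>x. \<eta> (c *\<^sub>R x) * e1 x)"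
    by (rule Bochner_Integration.integrable_bound[OF i]) (use b e_bound in auto)
qed

text \<open>Each term linear in \<open>z\<close> is bounded by an energy difference plus a quadratic
  remainder: the gradient term by convexity of the square, the singular term by an exact expansion,
  the powers by semiconvexity. Scaling then turns the energy of the dilated function into that of
  \<open>u\<close> under a dilated cutoff. \<open>P\<close> majorises the remainders together with
  the term containing the gradient of the cutoff.\<close>

lemma tested_inequality:
  assumes \<eta>: "\<eta> \<in> test_functions" and r0: "r0 > 0" "\<And>x. norm x < r0 \<Longrightarrow> \<eta> x = 0" and \<eta>0: "\<And>x. \<eta> x \<ge> 0"
    and \<sigma>: "\<sigma> > 0"
  defines "z \<equiv> \<lambda>x. \<sigma> powr \<alpha> * u (\<sigma> *\<^sub>R x) - u x"
    and "\<kappa> \<equiv> \<alpha> * (q + 1) - real DIM('a)"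
  assumes P: "integrable lborel P"
    and Pb: "\<And>x. \<bar>(G x \<bullet> gradient \<eta> x) * z x\<bar> + \<eta> x * ((z x)\<^sup>2 * ((\<beta> - 1) / 2 + \<bar>\<mu>\<bar> / (2 * (norm x)\<^sup>2))) \<le> P x"
  shows "(1 - \<sigma> powr \<kappa>) * (LINT x|lborel. \<eta> ((1 / \<sigma>) *\<^sub>R x) * e1 x) \<le>
     (LINT x|lborel. (\<eta> ((1 / \<sigma>) *\<^sub>R x) - \<eta> x) * (e0 x + e1 x)) + (LINT x|lborel. P x)"
proof -
  define H where "H = (\<lambda>x. \<sigma> powr (\<alpha> + 1) *\<^sub>R G (\<sigma> *\<^sub>R x))"
  define v where "v = (\<lambda>x. \<sigma> powr \<alpha> * u (\<sigma> *\<^sub>R x))"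
  have zx: "\<sigma> powr \<alpha> * u (\<sigma> *\<^sub>R x) - u x = z x" and Hx: "\<sigma> powr (\<alpha> + 1) *\<^sub>R G (\<sigma> *\<^sub>R x) = H x" for x
    by (simp_all add: z_def H_def)
  note t = tested[OF \<eta> r0 \<sigma>, unfolded zx Hx]
  have [measurable]: "\<eta> \<in> borel_measurable borel" by (intro smooth_measurable test_smooth \<eta>)
  have p: "\<beta> - 1 > 1" "\<beta> - 1 < q" using exponents(1) q by auto
  \<comment> \<open>All terms of the tested identity on one side: the integral is zero, and the
    estimates can be made pointwise.\<close>
  define \<Phi> where "\<Phi> = (\<lambda>x. (G x \<bullet> gradient \<eta> x) * z x + \<eta> x * (G x \<bullet> (H x - G x)) - \<mu> * (u x * (\<eta> x / (norm x)\<^sup>2) * z x)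
      - (u x powr (\<beta> - 1) * \<eta> x * z x - u x powr q * \<eta> x * z x))"
  have \<Phi>i: "integrable lborel \<Phi>" unfolding \<Phi>_def
    by (intro Bochner_Integration.integrable_diff Bochner_Integration.integrable_add integrable_mult_right t)
  have "(LINT x|lborel. \<Phi> x) = 0"
    unfolding \<Phi>_def using t(6)
    by (simp only: Bochner_Integration.integral_diff Bochner_Integration.integral_add t(1-5)
        Bochner_Integration.integrable_diff Bochner_Integration.integrable_add
        integral_mult_right_zero integrable_mult_right)
  let ?N = "\<sigma> ^ DIM('a)"
  \<comment> \<open>Energy density of the dilated function minus that of \<open>u\<close>, expressed
    through \<open>e0\<close> and \<open>e1\<close> at the dilated point so that a change of
    variables applies.\<close>
  let ?E = "\<lambda>x. \<eta> x * (?N * e0 (\<sigma> *\<^sub>R x)) + \<sigma> powr \<kappa> * (\<eta> x * (?N * e1 (\<sigma> *\<^sub>R x))) - \<eta> x * e0 x - \<eta> x * e1 x"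
  have bound: "\<Phi> x \<le> P x + ?E x" for x
  proof (cases "norm x < r0")
    case True
    then show ?thesis using r0(2)[OF True] Pb[of x] by (simp add: \<Phi>_def)
  next
    case False
    then have x0: "norm x > 0" using r0 by auto
    have vp: "v x > 0" using pos \<sigma> by (simp add: v_def)
    have z: "z x = v x - u x" by (simp add: z_def v_def)
    have N: "?N = \<sigma> powr real DIM('a)" using \<sigma> by (simp add: powr_realpow)
    \<comment> \<open>The Jacobian \<sigma>^N is exactly what the three terms need: it equals the
      square of \<sigma>^(\<alpha>+1), the square of \<sigma>^\<alpha> times \<sigma>^2, and the
      power \<beta> of \<sigma>^\<alpha>.\<close>
    have e0v: "?N * e0 (\<sigma> *\<^sub>R x) = (norm (H x))\<^sup>2 / 2 - \<mu> * (v x)\<^sup>2 / (2 * (norm x)\<^sup>2) - v x powr \<beta> / \<beta>"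
    proof -
      have a: "?N = (\<sigma> powr (\<alpha> + 1))\<^sup>2"
        unfolding N exponents(4)[symmetric] using \<sigma> by (simp add: power2_eq_square flip: powr_add)
      have b: "?N = (\<sigma> powr \<alpha>)\<^sup>2 * \<sigma>\<^sup>2"
        unfolding a using \<sigma> by (simp add: powr_add power_mult_distrib)
      have c: "?N = (\<sigma> powr \<alpha>) powr \<beta>" unfolding N by (simp add: powr_powr exponents(3))
      have 1: "?N * (norm (G (\<sigma> *\<^sub>R x)))\<^sup>2 = (norm (H x))\<^sup>2"
        unfolding a H_def using \<sigma> by (simp add: power_mult_distrib)
      have 2: "?N * ((u (\<sigma> *\<^sub>R x))\<^sup>2 / (norm (\<sigma> *\<^sub>R x))\<^sup>2) = (v x)\<^sup>2 / (norm x)\<^sup>2"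
        unfolding b v_def using \<sigma> by (simp add: power_mult_distrib)
      have 3: "?N * u (\<sigma> *\<^sub>R x) powr \<beta> = v x powr \<beta>"
        unfolding c v_def using pos[of "\<sigma> *\<^sub>R x"] by (simp add: powr_mult)
      have "?N * e0 (\<sigma> *\<^sub>R x) = (?N * (norm (G (\<sigma> *\<^sub>R x)))\<^sup>2) / 2 - \<mu> * (?N * ((u (\<sigma> *\<^sub>R x))\<^sup>2 / (norm (\<sigma> *\<^sub>R x))\<^sup>2)) / 2
          - (?N * u (\<sigma> *\<^sub>R x) powr \<beta>) / \<beta>"
        by (simp add: e0_def right_diff_distrib mult_ac)
      then show ?thesis unfolding 1 2 3 by (simp add: mult_ac)
    qed
    have e1v: "\<sigma> powr \<kappa> * (?N * e1 (\<sigma> *\<^sub>R x)) = v x powr (q + 1) / (q + 1)"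
    proof -
      have "\<sigma> powr \<kappa> * ?N = (\<sigma> powr \<alpha>) powr (q + 1)"
        unfolding N by (simp add: \<kappa>_def powr_powr flip: powr_add)
      then have "\<sigma> powr \<kappa> * ?N * u (\<sigma> *\<^sub>R x) powr (q + 1) = v x powr (q + 1)"
        using pos[of "\<sigma> *\<^sub>R x"] by (simp add: v_def powr_mult)
      then show ?thesis by (simp add: e1_def mult.assoc)
    qed
    have A: "G x \<bullet> (H x - G x) \<le> (norm (H x))\<^sup>2 / 2 - (norm (G x))\<^sup>2 / 2"
    proof -
      have "0 \<le> (norm (H x - G x))\<^sup>2" by simp
      then show ?thesis unfolding power2_norm_eq_inner by (simp add: inner_simps inner_commute field_simps)
    qed
    \<comment> \<open>Expanding the square of v = u + z is exact; the remainder has the sign of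
      \<open>\<mu>\<close>, hence the absolute value in the bound.\<close>
    have B: "- \<mu> * (u x * z x / (norm x)\<^sup>2) \<le> - \<mu> * (v x)\<^sup>2 / (2 * (norm x)\<^sup>2) + \<mu> * (u x)\<^sup>2 / (2 * (norm x)\<^sup>2) + (z x)\<^sup>2 * (\<bar>\<mu>\<bar> / (2 * (norm x)\<^sup>2))"
    proof -
      have "- \<mu> * (u x * z x / (norm x)\<^sup>2) = - \<mu> * (v x)\<^sup>2 / (2 * (norm x)\<^sup>2) + \<mu> * (u x)\<^sup>2 / (2 * (norm x)\<^sup>2) + (z x)\<^sup>2 * (\<mu> / (2 * (norm x)\<^sup>2))"
        using x0 unfolding z by (simp add: field_simps power2_eq_square)
      moreover have "(z x)\<^sup>2 * (\<mu> / (2 * (norm x)\<^sup>2)) \<le> (z x)\<^sup>2 * (\<bar>\<mu>\<bar> / (2 * (norm x)\<^sup>2))"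
        by (intro mult_left_mono divide_right_mono) auto
      ultimately show ?thesis by linarith
    qed
    have C: "(u x powr q - u x powr (\<beta> - 1)) * z x \<le> (v x powr (q + 1) / (q + 1) - v x powr \<beta> / \<beta>) - (e1 x - u x powr \<beta> / \<beta>) + (z x)\<^sup>2 * ((\<beta> - 1) / 2)"
      using power_difference_semiconvex[OF pos[of x] vp p] unfolding z e1_def by (simp add: mult.commute)
    have "\<Phi> x = (G x \<bullet> gradient \<eta> x) * z x + \<eta> x * (G x \<bullet> (H x - G x) + (- \<mu> * (u x * z x / (norm x)\<^sup>2)) + (u x powr q - u x powr (\<beta> - 1)) * z x)"
      by (simp add: \<Phi>_def algebra_simps)
    also have "\<dots> \<le> \<bar>(G x \<bullet> gradient \<eta> x) * z x\<bar> + \<eta> x * (((norm (H x))\<^sup>2 / 2 - (norm (G x))\<^sup>2 / 2) +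
      (- \<mu> * (v x)\<^sup>2 / (2 * (norm x)\<^sup>2) + \<mu> * (u x)\<^sup>2 / (2 * (norm x)\<^sup>2) + (z x)\<^sup>2 * (\<bar>\<mu>\<bar> / (2 * (norm x)\<^sup>2))) +
      ((v x powr (q + 1) / (q + 1) - v x powr \<beta> / \<beta>) - (e1 x - u x powr \<beta> / \<beta>) + (z x)\<^sup>2 * ((\<beta> - 1) / 2)))"
      by (intro add_mono mult_left_mono \<eta>0 A B C) auto
    also have "\<dots> = \<bar>(G x \<bullet> gradient \<eta> x) * z x\<bar> + \<eta> x * ((z x)\<^sup>2 * ((\<beta> - 1) / 2 + \<bar>\<mu>\<bar> / (2 * (norm x)\<^sup>2))) +
      \<eta> x * (?N * e0 (\<sigma> *\<^sub>R x) + \<sigma> powr \<kappa> * (?N * e1 (\<sigma> *\<^sub>R x)) - e0 x - e1 x)"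
      unfolding e0v e1v e0_def[of x] by (simp add: distrib_left right_diff_distrib add_divide_distrib)
    also have "\<dots> \<le> P x + \<eta> x * (?N * e0 (\<sigma> *\<^sub>R x) + \<sigma> powr \<kappa> * (?N * e1 (\<sigma> *\<^sub>R x)) - e0 x - e1 x)"
      using Pb[of x] by simp
    also have "\<dots> = P x + ?E x" by (simp add: algebra_simps)
    finally show ?thesis .
  qed
  have s1: "\<eta> x = \<eta> ((1 / \<sigma>) *\<^sub>R (0 + \<sigma> *\<^sub>R x))" for x using \<sigma> by simp
  \<comment> \<open>Substitution of the dilated point as new variable: the dilation leaves the
    energy density and acts on the cutoff.\<close>
  have I1: "integrable lborel (\<lambda>x. \<eta> x * (?N * f (\<sigma> *\<^sub>R x)))"
       "(LINT x|lborel. \<eta> x * (?N * f (\<sigma> *\<^sub>R x))) = (LINT x|lborel. \<eta> ((1 / \<sigma>) *\<^sub>R x) * f x)"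
    if f: "f \<in> borel_measurable borel" and i: "integrable lborel (\<lambda>x. \<eta> ((1 / \<sigma>) *\<^sub>R x) * f x)" for f
  proof -
    have [measurable]: "f \<in> borel_measurable borel" by (rule f)
    have "integrable lborel (\<lambda>x. ?N * (\<eta> ((1 / \<sigma>) *\<^sub>R (0 + \<sigma> *\<^sub>R x)) * f (0 + \<sigma> *\<^sub>R x)))"
      using integrable_affine[OF i, of \<sigma> 0] \<sigma> by (intro integrable_mult_right) auto
    then show "integrable lborel (\<lambda>x. \<eta> x * (?N * f (\<sigma> *\<^sub>R x)))"
      using \<sigma> by (simp add: mult.left_commute)
    have "(LINT x|lborel. \<eta> ((1 / \<sigma>) *\<^sub>R x) * f x) = \<bar>\<sigma>\<bar> ^ DIM('a) * (LINT x|lborel. \<eta> ((1 / \<sigma>) *\<^sub>R (0 + \<sigma> *\<^sub>R x)) * f (0 + \<sigma> *\<^sub>R x))"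
      using \<sigma> by (intro integral_affine) auto
    moreover have "\<eta> x * (?N * f (\<sigma> *\<^sub>R x)) = ?N * (\<eta> x * f (\<sigma> *\<^sub>R x))" for x by simp
    ultimately show "(LINT x|lborel. \<eta> x * (?N * f (\<sigma> *\<^sub>R x))) = (LINT x|lborel. \<eta> ((1 / \<sigma>) *\<^sub>R x) * f x)"
      using \<sigma> by (simp only: integral_mult_right_zero) simp
  qed
  have c: "1 / \<sigma> > 0" "(0::real) < 1" using \<sigma> by auto
  note ci = cutoff_integrable[OF \<eta> r0 c(1)] cutoff_integrable[OF \<eta> r0 c(2), unfolded scaleR_one]
  note J0 = I1[OF e_measurable(1) ci(1)] and J1 = I1[OF e_measurable(2) ci(2)]
  have Ei: "integrable lborel ?E"
    by (intro Bochner_Integration.integrable_diff Bochner_Integration.integrable_add integrable_mult_right J0 J1 ci)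
  have E: "(LINT x|lborel. ?E x) = (LINT x|lborel. \<eta> ((1 / \<sigma>) *\<^sub>R x) * e0 x) + \<sigma> powr \<kappa> * (LINT x|lborel. \<eta> ((1 / \<sigma>) *\<^sub>R x) * e1 x)
      - (LINT x|lborel. \<eta> x * e0 x) - (LINT x|lborel. \<eta> x * e1 x)"
    by (simp only: Bochner_Integration.integral_diff Bochner_Integration.integral_add integral_mult_right_zero
        Bochner_Integration.integrable_diff Bochner_Integration.integrable_add integrable_mult_right J0 J1 ci)
  have "0 = (LINT x|lborel. \<Phi> x)" using \<open>(LINT x|lborel. \<Phi> x) = 0\<close> by simp
  also have "\<dots> \<le> (LINT x|lborel. P x + ?E x)"
    by (rule integral_mono[OF \<Phi>i Bochner_Integration.integrable_add[OF P Ei] bound])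
  also have "\<dots> = (LINT x|lborel. P x) + (LINT x|lborel. ?E x)"
    by (rule Bochner_Integration.integral_add[OF P Ei])
  finally have ineq: "0 \<le> (LINT x|lborel. P x) + (LINT x|lborel. ?E x)" .
  have "(LINT x|lborel. (\<eta> ((1 / \<sigma>) *\<^sub>R x) - \<eta> x) * (e0 x + e1 x)) =
    (LINT x|lborel. (\<eta> ((1 / \<sigma>) *\<^sub>R x) * e0 x + \<eta> ((1 / \<sigma>) *\<^sub>R x) * e1 x) - (\<eta> x * e0 x + \<eta> x * e1 x))"
    by (simp add: algebra_simps)
  also have "\<dots> = (LINT x|lborel. \<eta> ((1 / \<sigma>) *\<^sub>R x) * e0 x) + (LINT x|lborel. \<eta> ((1 / \<sigma>) *\<^sub>R x) * e1 x)
     - ((LINT x|lborel. \<eta> x * e0 x) + (LINT x|lborel. \<eta> x * e1 x))"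
    by (simp only: Bochner_Integration.integral_diff Bochner_Integration.integral_add
        Bochner_Integration.integrable_diff Bochner_Integration.integrable_add ci)
  finally show ?thesis using ineq unfolding E by (simp add: algebra_simps)
qed

end

section \<open>Annular cutoffs and the limit\<close>

text \<open>Where the gradient of the \<open>n\<close>-th cutoff may be nonzero: one annulus near
  the origin and one far out.\<close>

definition annuli :: "real \<Rightarrow> 'a::euclidean_space set" where
  "annuli n = {x. (1 / n \<le> norm x \<and> norm x \<le> 2 / n) \<or> (n \<le> norm x \<and> norm x \<le> 2 * n)}"

text \<open>The inner radii are halved, so that the set contains every \<open>t *\<^sub>R x\<close>
  with \<open>x\<close> in \<open>annuli n\<close> and \<open>t\<close> in [1/2, 1].\<close>

definition annuli_nbhd :: "real \<Rightarrow> 'a::euclidean_space set" where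
  "annuli_nbhd n = {x. (1 / (2 * n) \<le> norm x \<and> norm x \<le> 2 / n) \<or> (n / 2 \<le> norm x \<and> norm x \<le> 2 * n)}"

definition shell :: "real \<Rightarrow> real \<Rightarrow> 'a::euclidean_space set" where
  "shell r R = {x. r \<le> norm x \<and> norm x \<le> R}"

lemma annuli_sets [measurable]:
  "(annuli n :: 'a::euclidean_space set) \<in> sets borel" "(annuli_nbhd n :: 'a set) \<in> sets borel"
  "(shell r R :: 'a set) \<in> sets borel"
  unfolding annuli_def annuli_nbhd_def shell_def by measurable

text \<open>The cutoff is \<theta>(x/n) - \<theta>(n x). Multiplying the gradient of a dilate of
  \<theta> by |x| gives a function of the dilated point alone, so \<open>C\<close> does not depend
  on \<open>n\<close>. The gradient at 0 is recorded separately because the weighted bound says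
  nothing there.\<close>

lemma annular_cutoffs:
  obtains C and \<eta> :: "real \<Rightarrow> 'a::euclidean_space \<Rightarrow> real" where "C > 0"
    "\<And>n. n \<ge> 2 \<Longrightarrow> \<eta> n \<in> test_functions" "\<And>n x. n \<ge> 2 \<Longrightarrow> 0 \<le> \<eta> n x" "\<And>n x. n \<ge> 2 \<Longrightarrow> \<eta> n x \<le> 1"
    "\<And>n x. n \<ge> 2 \<Longrightarrow> x \<notin> shell (1 / n) (2 * n) \<Longrightarrow> \<eta> n x = 0"
    "\<And>n x. n \<ge> 2 \<Longrightarrow> x \<in> shell (2 / n) n \<Longrightarrow> \<eta> n x = 1"
    "\<And>n. n \<ge> 2 \<Longrightarrow> gradient (\<eta> n) 0 = 0"
    "\<And>n x. n \<ge> 2 \<Longrightarrow> norm (gradient (\<eta> n) x) * norm x \<le> C * indicator (annuli n) x"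
proof -
  obtain \<theta> :: "'a \<Rightarrow> real" and M where t: "\<theta> \<in> test_functions" "M > 0"
    "\<And>x. 0 \<le> \<theta> x" "\<And>x. \<theta> x \<le> 1" "\<And>x. norm x \<le> 1 \<Longrightarrow> \<theta> x = 1" "\<And>x. norm x \<ge> 2 \<Longrightarrow> \<theta> x = 0"
    "\<And>x. norm (gradient \<theta> x) \<le> M" "\<And>x. norm x < 1 \<or> norm x > 2 \<Longrightarrow> gradient \<theta> x = 0"
    using cutoff_exists by metis
  have s: "smooth \<theta>" by (rule test_smooth[OF t(1)])
  define \<eta> where "\<eta> = (\<lambda>n x. \<theta> ((1 / n) *\<^sub>R x + 0) + \<theta> (n *\<^sub>R x + 0) * (-1))"
  show ?thesis
  proof (rule that[of "4 * M" \<eta>])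
    show "4 * M > 0" using t by simp
    fix n :: real assume n: "n \<ge> 2"
    show "\<eta> n \<in> test_functions" unfolding \<eta>_def
      by (intro test_add test_mult_smooth[OF _ smooth_const] test_affine t) (use n in auto)
    fix x :: 'a
    have T: "\<theta> ((1 / n) *\<^sub>R x + 0) = 1" if "norm x \<le> n" using that n by (intro t(5)) (simp add: divide_le_eq)
    have T': "\<theta> ((1 / n) *\<^sub>R x + 0) = 0" if "2 * n \<le> norm x" using that n by (intro t(6)) (simp add: le_divide_eq)
    have V: "\<theta> (n *\<^sub>R x + 0) = 1" if "n * norm x \<le> 1" using that n by (intro t(5)) simp
    have V': "\<theta> (n *\<^sub>R x + 0) = 0" if "2 \<le> n * norm x" using that n by (intro t(6)) simp
    show "\<eta> n x \<le> 1" using t(3)[of "n *\<^sub>R x + 0"] t(4)[of "(1 / n) *\<^sub>R x + 0"] by (simp add: \<eta>_def)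
    show "0 \<le> \<eta> n x"
    proof (cases "norm x \<le> n")
      case True
      then show ?thesis using t(4)[of "n *\<^sub>R x + 0"] T by (simp add: \<eta>_def)
    next
      case False
      have "2 * 1 \<le> n * norm x" using False n by (intro mult_mono) auto
      then show ?thesis using t(3)[of "(1 / n) *\<^sub>R x + 0"] V' by (simp add: \<eta>_def)
    qed
    show "\<eta> n x = 0" if "x \<notin> shell (1 / n) (2 * n)"
    proof (cases "norm x < 1 / n")
      case True
      then have "n * norm x \<le> 1" using n by (simp add: field_simps)
      moreover have "1 / n \<le> 1" using n by simp
      moreover have "norm x \<le> n" using True \<open>1 / n \<le> 1\<close> n by linarith
      ultimately show ?thesis using T V by (simp add: \<eta>_def)
    next
      case False
      then have x: "norm x > 2 * n" using that by (auto simp: shell_def)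
      have "2 * 1 \<le> n * norm x" using x n by (intro mult_mono) auto
      then show ?thesis using T' V' x by (simp add: \<eta>_def)
    qed
    show "\<eta> n x = 1" if "x \<in> shell (2 / n) n"
    proof -
      have "norm x \<le> n" "2 \<le> n * norm x" using that n by (auto simp: shell_def field_simps)
      then show ?thesis using T V' by (simp add: \<eta>_def)
    qed
    have g: "gradient (\<eta> n) x = (1 / n) *\<^sub>R gradient \<theta> ((1 / n) *\<^sub>R x + 0) - n *\<^sub>R gradient \<theta> (n *\<^sub>R x + 0)" for x
    proof -
      have "gradient (\<eta> n) x = gradient (\<lambda>x. \<theta> ((1 / n) *\<^sub>R x + 0)) x + gradient (\<lambda>x. (-1) * \<theta> (n *\<^sub>R x + 0)) x"
        unfolding \<eta>_def mult.commute[of _ "-1"] by (intro gradient_add smooth_mult smooth_const smooth_affine s)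
      also have "\<dots> = (1 / n) *\<^sub>R gradient \<theta> ((1 / n) *\<^sub>R x + 0) + (-1) *\<^sub>R (n *\<^sub>R gradient \<theta> (n *\<^sub>R x + 0))"
        by (simp only: gradient_cmult[OF smooth_affine[OF s]] gradient_affine[OF s])
      finally show ?thesis by simp
    qed
    have "\<And>x. gradient (\<eta> n) x = (1 / n) *\<^sub>R gradient \<theta> ((1 / n) *\<^sub>R x + 0) - n *\<^sub>R gradient \<theta> (n *\<^sub>R x + 0)" by (rule g)
    from this[of 0] show "gradient (\<eta> n) 0 = 0" by (simp add: t(8))
    have b: "norm (c *\<^sub>R gradient \<theta> (c *\<^sub>R x + 0)) * norm x \<le> 2 * M * indicator {x. 1 \<le> c * norm x \<and> c * norm x \<le> 2} x"
      if c: "c > 0" for c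
    proof (cases "1 \<le> c * norm x \<and> c * norm x \<le> 2")
      case True
      have "norm (c *\<^sub>R gradient \<theta> (c *\<^sub>R x + 0)) * norm x = norm (gradient \<theta> (c *\<^sub>R x + 0)) * (c * norm x)" using c by simp
      also have "\<dots> \<le> M * 2" using True t(2) by (intro mult_mono t(7)) auto
      finally show ?thesis using True by (simp add: mult.commute)
    next
      case False
      then have "gradient \<theta> (c *\<^sub>R x + 0) = 0" using c by (intro t(8)) auto
      then show ?thesis using t(2) by simp
    qed
    have "norm (gradient (\<eta> n) x) * norm x \<le> (norm ((1 / n) *\<^sub>R gradient \<theta> ((1 / n) *\<^sub>R x + 0)) + norm (n *\<^sub>R gradient \<theta> (n *\<^sub>R x + 0))) * norm x"
      unfolding g[of x] by (intro mult_right_mono norm_triangle_ineq4) auto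
    also have "\<dots> \<le> 2 * M * indicator {x. 1 \<le> (1 / n) * norm x \<and> (1 / n) * norm x \<le> 2} x + 2 * M * indicator {x. 1 \<le> n * norm x \<and> n * norm x \<le> 2} x"
      unfolding distrib_right by (intro add_mono b) (use n in auto)
    also have "\<dots> \<le> 4 * M * indicator (annuli n) x"
      using n t(2) by (auto simp: indicator_def annuli_def field_simps)
    finally show "norm (gradient (\<eta> n) x) * norm x \<le> 4 * M * indicator (annuli n) x" .
  qed
qed

lemma annuli_scale:
  fixes x :: "'a::euclidean_space"
  assumes "x \<in> annuli n" "1 / 2 \<le> t" "t \<le> 1" "n > 0"
  shows "t *\<^sub>R x \<in> annuli_nbhd n"
proof -
  have "t * norm x \<ge> (1 / 2) * norm x" by (rule mult_right_mono[OF assms(2)]) simp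
  moreover have "t * norm x \<le> norm x" using assms by (auto intro: mult_left_le_one_le)
  moreover have "1 / (2 * n) = (1 / n) / 2" "norm (t *\<^sub>R x) = t * norm x" using assms by auto
  ultimately show ?thesis
    using assms(1) unfolding annuli_def annuli_nbhd_def mem_Collect_eq by linarith
qed

lemma shell_scale:
  fixes x :: "'a::euclidean_space"
  assumes "x \<in> shell r R" "1 / 2 \<le> t" "t \<le> 1"
  shows "t *\<^sub>R x \<in> shell (r / 2) R"
proof -
  have "t * norm x \<ge> (1 / 2) * norm x" by (rule mult_right_mono[OF assms(2)]) simp
  moreover have "t * norm x \<le> norm x" using assms by (auto intro: mult_left_le_one_le)
  ultimately show ?thesis using assms by (auto simp: shell_def abs_of_pos)
qed

section \<open>Quadratic smallness of the dilation difference\<close>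

context critical_equation
begin

text \<open>The difference splits into \<sigma>^\<alpha> times u(\<sigma> x) - u(x), of order 1 -
  \<sigma> by \<open>dilation_weak\<close>, and (\<sigma>^\<alpha> - 1) u(x), of the same order by
  \<open>bernoulli_powr\<close>. \<open>C\<close> is twice the constant of the former plus twice the
  squared constant of the latter.\<close>

lemma dilation_estimate:
  assumes \<sigma>: "1 / 2 \<le> \<sigma>" "\<sigma> < 1" and S[measurable]: "S \<in> sets borel" "S' \<in> sets borel"
    and SS: "\<And>x t. x \<in> S \<Longrightarrow> 1 / 2 \<le> t \<Longrightarrow> t \<le> 1 \<Longrightarrow> t *\<^sub>R x \<in> S'"
    and S': "\<And>x. x \<in> S' \<Longrightarrow> r \<le> norm x \<and> norm x \<le> R" and r: "r > 0"
  defines "z \<equiv> \<lambda>x. \<sigma> powr \<alpha> * u (\<sigma> *\<^sub>R x) - u x"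
    and "C \<equiv> 2 ^ (DIM('a) + 2) + 2 * (max 1 \<alpha>)\<^sup>2"
  shows "integrable lborel (\<lambda>x. indicator S x * ((z x)\<^sup>2 / (norm x)\<^sup>2))"
    "(LINT x|lborel. indicator S x * ((z x)\<^sup>2 / (norm x)\<^sup>2)) \<le> C * (1 - \<sigma>)\<^sup>2 * mass S'"
proof -
  define h where "h = 1 - \<sigma>"
  have h: "h > 0" using \<sigma> by (simp add: h_def)
  let ?I = "\<lambda>f. \<integral>\<^sup>+x. ennreal (f x) * indicator S' x \<partial>lborel"
  have uf: "nnr (q + 1) u < \<infinity>" using uq nnr_finite_integrable[OF um] pos by (auto simp: abs_of_pos)
  have Gf: "nnr 2 (\<lambda>x. G x \<bullet> i) < \<infinity>" if "i \<in> Basis" for i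
    using G_component[OF that] nnr_finite_integrable[of "\<lambda>x. G x \<bullet> i" 2] by simp
  have q1: "q + 1 \<ge> 1" using exponents(1) q by simp
  have d: "(\<integral>\<^sup>+x. ennreal ((u (\<sigma> *\<^sub>R x) - u x)\<^sup>2 / (norm x)\<^sup>2) * indicator S x \<partial>lborel) \<le>
     ennreal (2 ^ (DIM('a) + 1) * (1 - \<sigma>)\<^sup>2) * ?I (\<lambda>x. (norm (G x))\<^sup>2)"
    by (rule dilation_weak[OF um uf q1 Gm Gf weak]) (use \<sigma> SS in auto)
  have zb: "(z x)\<^sup>2 / (norm x)\<^sup>2 \<le> 2 * ((u (\<sigma> *\<^sub>R x) - u x)\<^sup>2 / (norm x)\<^sup>2) + 2 * (max 1 \<alpha>)\<^sup>2 * h\<^sup>2 * ((u x)\<^sup>2 / (norm x)\<^sup>2)" for x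
  proof -
    have s: "\<sigma> powr \<alpha> \<le> 1" "\<sigma> powr \<alpha> \<ge> 0" using \<sigma> exponents(2) by (auto intro!: powr_le1)
    define X where "X = \<sigma> powr \<alpha> * (u (\<sigma> *\<^sub>R x) - u x)"
    define Y where "Y = (\<sigma> powr \<alpha> - 1) * u x"
    have "\<bar>X\<bar> \<le> \<bar>u (\<sigma> *\<^sub>R x) - u x\<bar>" using s by (simp add: X_def abs_mult mult_left_le_one_le)
    then have X: "X\<^sup>2 \<le> (u (\<sigma> *\<^sub>R x) - u x)\<^sup>2" by (simp add: abs_le_square_iff)
    have "\<bar>\<sigma> powr \<alpha> - 1\<bar> \<le> max 1 \<alpha> * h"
      using bernoulli_powr(1)[of \<sigma> \<alpha>] \<sigma> s exponents(2) by (simp add: h_def)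
    then have "\<bar>Y\<bar> \<le> \<bar>max 1 \<alpha> * h * u x\<bar>" using h pos[of x] by (simp add: Y_def abs_mult mult_right_mono)
    then have Y: "Y\<^sup>2 \<le> (max 1 \<alpha> * h * u x)\<^sup>2" by (simp only: abs_le_square_iff)
    have "z x = X + Y" by (simp add: z_def X_def Y_def algebra_simps)
    then have "(z x)\<^sup>2 \<le> 2 * X\<^sup>2 + 2 * Y\<^sup>2" using zero_le_power2[of "X - Y"] by (simp add: power2_sum power2_diff)
    also have "\<dots> \<le> 2 * (u (\<sigma> *\<^sub>R x) - u x)\<^sup>2 + 2 * (max 1 \<alpha> * h * u x)\<^sup>2" using X Y by simp
    finally have "(z x)\<^sup>2 / (norm x)\<^sup>2 \<le> (2 * (u (\<sigma> *\<^sub>R x) - u x)\<^sup>2 + 2 * (max 1 \<alpha> * h * u x)\<^sup>2) / (norm x)\<^sup>2"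
      by (rule divide_right_mono) simp
    then show ?thesis by (simp add: add_divide_distrib power_mult_distrib mult_ac)
  qed
  have [measurable]: "z \<in> borel_measurable borel" unfolding z_def by measurable
  have Di: "integrable lborel (\<lambda>x. indicator S' x * dens x)" by (rule dens_integrable[OF S(2) S' r])
  have D: "?I dens = ennreal (mass S')"
  proof -
    have "?I dens = (\<integral>\<^sup>+x. ennreal (indicator S' x * dens x) \<partial>lborel)"
      by (intro nn_integral_cong) (auto simp: indicator_def)
    also have "\<dots> = ennreal (mass S')"
      by (rule nn_integral_eq_integral[OF Di]) (auto simp: dens_nonneg)
    finally show ?thesis .
  qed
  have "S \<subseteq> S'" using SS[of _ 1] by auto
  have "(\<integral>\<^sup>+x. ennreal (indicator S x * ((z x)\<^sup>2 / (norm x)\<^sup>2)) \<partial>lborel) \<le>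
    (\<integral>\<^sup>+x. 2 * (ennreal ((u (\<sigma> *\<^sub>R x) - u x)\<^sup>2 / (norm x)\<^sup>2) * indicator S x) +
        ennreal (2 * (max 1 \<alpha>)\<^sup>2 * h\<^sup>2) * (ennreal ((u x)\<^sup>2 / (norm x)\<^sup>2) * indicator S' x) \<partial>lborel)"
  proof (rule nn_integral_mono)
    fix x
    have "ennreal ((z x)\<^sup>2 / (norm x)\<^sup>2) \<le> 2 * ennreal ((u (\<sigma> *\<^sub>R x) - u x)\<^sup>2 / (norm x)\<^sup>2) + ennreal (2 * (max 1 \<alpha>)\<^sup>2 * h\<^sup>2) * ennreal ((u x)\<^sup>2 / (norm x)\<^sup>2)"
    proof -
      have "ennreal (2 * P + k * Q) = 2 * ennreal P + ennreal k * ennreal Q" if "P \<ge> 0" "Q \<ge> 0" "k \<ge> 0" for P Q k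
        using that by (simp add: ennreal_plus ennreal_mult)
      from this[of "(u (\<sigma> *\<^sub>R x) - u x)\<^sup>2 / (norm x)\<^sup>2" "(u x)\<^sup>2 / (norm x)\<^sup>2" "2 * (max 1 \<alpha>)\<^sup>2 * h\<^sup>2"]
      show ?thesis using ennreal_leI[OF zb[of x]] by simp
    qed
    then show "ennreal (indicator S x * ((z x)\<^sup>2 / (norm x)\<^sup>2)) \<le> 2 * (ennreal ((u (\<sigma> *\<^sub>R x) - u x)\<^sup>2 / (norm x)\<^sup>2) * indicator S x) +
        ennreal (2 * (max 1 \<alpha>)\<^sup>2 * h\<^sup>2) * (ennreal ((u x)\<^sup>2 / (norm x)\<^sup>2) * indicator S' x)"
      using \<open>S \<subseteq> S'\<close> by (cases "x \<in> S") auto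
  qed
  also have "\<dots> = (\<integral>\<^sup>+x. 2 * (ennreal ((u (\<sigma> *\<^sub>R x) - u x)\<^sup>2 / (norm x)\<^sup>2) * indicator S x) \<partial>lborel) +
     (\<integral>\<^sup>+x. ennreal (2 * (max 1 \<alpha>)\<^sup>2 * h\<^sup>2) * (ennreal ((u x)\<^sup>2 / (norm x)\<^sup>2) * indicator S' x) \<partial>lborel)"
    by (rule nn_integral_add) measurable
  also have "\<dots> = 2 * (\<integral>\<^sup>+x. ennreal ((u (\<sigma> *\<^sub>R x) - u x)\<^sup>2 / (norm x)\<^sup>2) * indicator S x \<partial>lborel) +
     ennreal (2 * (max 1 \<alpha>)\<^sup>2 * h\<^sup>2) * ?I (\<lambda>x. (u x)\<^sup>2 / (norm x)\<^sup>2)"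
    by (intro arg_cong2[where f="(+)"] nn_integral_cmult) measurable
  also have "\<dots> \<le> 2 * (ennreal (2 ^ (DIM('a) + 1) * h\<^sup>2) * ?I dens) + ennreal (2 * (max 1 \<alpha>)\<^sup>2 * h\<^sup>2) * ?I dens"
  proof -
    have 1: "?I (\<lambda>x. (norm (G x))\<^sup>2) \<le> ?I dens" "?I (\<lambda>x. (u x)\<^sup>2 / (norm x)\<^sup>2) \<le> ?I dens"
      by (intro nn_integral_mono mult_right_mono ennreal_leI; simp add: dens_def)+
    show ?thesis
      by (intro add_mono mult_left_mono 1 order_trans[OF d[folded h_def]]) auto
  qed
  also have "\<dots> = ennreal (C * h\<^sup>2) * ?I dens"
  proof -
    have "2 * (ennreal (2 ^ (DIM('a) + 1) * h\<^sup>2) * ?I dens) = ennreal (2 * (2 ^ (DIM('a) + 1) * h\<^sup>2)) * ?I dens"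
      by (subst ennreal_mult) (auto simp: mult.assoc)
    then have "2 * (ennreal (2 ^ (DIM('a) + 1) * h\<^sup>2) * ?I dens) + ennreal (2 * (max 1 \<alpha>)\<^sup>2 * h\<^sup>2) * ?I dens =
      (ennreal (2 * (2 ^ (DIM('a) + 1) * h\<^sup>2)) + ennreal (2 * (max 1 \<alpha>)\<^sup>2 * h\<^sup>2)) * ?I dens"
      by (simp add: distrib_right)
    also have "ennreal (2 * (2 ^ (DIM('a) + 1) * h\<^sup>2)) + ennreal (2 * (max 1 \<alpha>)\<^sup>2 * h\<^sup>2) = ennreal (C * h\<^sup>2)"
      by (subst ennreal_plus[symmetric]) (auto simp: C_def algebra_simps)
    finally show ?thesis .
  qed
  also have "\<dots> = ennreal (C * h\<^sup>2 * mass S')"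
    unfolding D by (subst ennreal_mult) (auto simp: C_def dens_nonneg intro!: Bochner_Integration.integral_nonneg)
  finally have fin: "(\<integral>\<^sup>+x. ennreal (indicator S x * ((z x)\<^sup>2 / (norm x)\<^sup>2)) \<partial>lborel) \<le>
     ennreal (C * h\<^sup>2 * mass S')" .
  show i: "integrable lborel (\<lambda>x. indicator S x * ((z x)\<^sup>2 / (norm x)\<^sup>2))"
  proof (rule integrableI_nonneg)
    show "(\<integral>\<^sup>+x. ennreal (indicator S x * ((z x)\<^sup>2 / (norm x)\<^sup>2)) \<partial>lborel) < \<infinity>"
      by (rule le_less_trans[OF fin]) simp
  qed auto
  have "ennreal (LINT x|lborel. indicator S x * ((z x)\<^sup>2 / (norm x)\<^sup>2)) \<le> ennreal (C * h\<^sup>2 * mass S')"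
    using fin by (subst (asm) nn_integral_eq_integral[OF i]) auto
  then show "(LINT x|lborel. indicator S x * ((z x)\<^sup>2 / (norm x)\<^sup>2)) \<le> C * (1 - \<sigma>)\<^sup>2 * mass S'"
    unfolding h_def[symmetric] by (subst (asm) ennreal_le_iff) (auto simp: C_def dens_nonneg intro!: Bochner_Integration.integral_nonneg mult_nonneg_nonneg)
qed

end

text \<open>The limit h -> 0 in an inequality, used once for h = 1 - \<sigma> and once for the small
  parameter of Young's inequality.\<close>

lemma le_of_le_add_small:
  fixes X Y Z :: real
  assumes "\<And>h. 0 < h \<Longrightarrow> h \<le> 1 / 2 \<Longrightarrow> X \<le> Y + Z * h"
  shows "X \<le> Y"
proof (rule ccontr)
  assume "\<not> X \<le> Y"
  then have d: "X - Y > 0" by simp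
  define h where "h = min (1 / 2) ((X - Y) / (2 * (\<bar>Z\<bar> + 1)))"
  have "0 < h" using d by (auto simp: h_def intro!: divide_pos_pos)
  moreover have "h \<le> 1 / 2" unfolding h_def by (rule min.cobounded1)
  ultimately have h: "0 < h" "h \<le> 1 / 2" .
  have "Z * h \<le> (\<bar>Z\<bar> + 1) * h" using h by (intro mult_right_mono) auto
  also have "\<dots> \<le> (\<bar>Z\<bar> + 1) * ((X - Y) / (2 * (\<bar>Z\<bar> + 1)))" by (intro mult_left_mono) (auto simp: h_def)
  also have "\<dots> = (X - Y) / 2" by (simp add: field_simps)
  finally show False using assms[OF h] d by simp
qed

text \<open>Mean value theorem on the segment from \<open>x\<close> to x/\<sigma>: the intermediate
  point is y = c x with 1 \<le> c \<le> 2, so |x| \<le> |y| and the weighted gradient bound applies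
  at \<open>y\<close>. Returning from \<open>y\<close> to \<open>x\<close> enlarges the
  annuli.\<close>

lemma cutoff_dilation_difference:
  fixes \<eta> :: "'a::euclidean_space \<Rightarrow> real"
  assumes \<eta>: "smooth \<eta>" and C: "C \<ge> 0" and n: "n > 0"
    and g: "\<And>x. norm (gradient \<eta> x) * norm x \<le> C * indicator (annuli n) x"
    and \<sigma>: "1 / 2 \<le> \<sigma>" "\<sigma> < 1"
  shows "\<bar>\<eta> ((1 / \<sigma>) *\<^sub>R x) - \<eta> x\<bar> \<le> 2 * (1 - \<sigma>) * C * indicator (annuli_nbhd n) x"
proof -
  define s where "s = 1 / \<sigma> - 1"
  have s: "0 < s" "s \<le> 1" "s \<le> 2 * (1 - \<sigma>)"
  proof -
    show "0 < s" "s \<le> 1" using \<sigma> by (auto simp: s_def field_simps)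
    have "s = (1 / \<sigma>) * (1 - \<sigma>)" using \<sigma> by (simp add: s_def field_simps)
    also have "\<dots> \<le> 2 * (1 - \<sigma>)" using \<sigma> by (intro mult_right_mono) (auto simp: field_simps)
    finally show "s \<le> 2 * (1 - \<sigma>)" .
  qed
  obtain t where t: "0 < t" "t < 1" "\<eta> (x + s *\<^sub>R x) - \<eta> x = frechet_derivative \<eta> (at (x + t *\<^sub>R s *\<^sub>R x)) (s *\<^sub>R x)"
    using smooth_mvt[OF \<eta>, of x "s *\<^sub>R x"] by metis
  define c where "c = 1 + t * s"
  have ts: "0 \<le> t * s" "t * s \<le> 1" using t s by (auto intro: mult_le_one)
  have c: "1 \<le> c" "c \<le> 2" using ts by (auto simp: c_def)
  define y where "y = c *\<^sub>R x"
  have y: "x + t *\<^sub>R s *\<^sub>R x = y" by (simp add: y_def c_def algebra_simps)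
  have xy: "x = (1 / c) *\<^sub>R y" using c by (simp add: y_def)
  have eq: "x + s *\<^sub>R x = (1 / \<sigma>) *\<^sub>R x" by (simp add: s_def algebra_simps)
  have "\<bar>\<eta> ((1 / \<sigma>) *\<^sub>R x) - \<eta> x\<bar> = \<bar>gradient \<eta> y \<bullet> (s *\<^sub>R x)\<bar>"
    using t(3) unfolding y eq inner_gradient[OF \<eta>] by (simp only:)
  also have "\<dots> \<le> norm (gradient \<eta> y) * norm (s *\<^sub>R x)" by (rule Cauchy_Schwarz_ineq2)
  also have "\<dots> \<le> norm (gradient \<eta> y) * (s * norm y)"
    using c s by (intro mult_left_mono) (auto simp: y_def mult_le_cancel_right1)
  also have "\<dots> = s * (norm (gradient \<eta> y) * norm y)" by simp
  also have "\<dots> \<le> (2 * (1 - \<sigma>)) * (C * indicator (annuli n) y)"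
    using s C by (intro mult_mono g) auto
  also have "\<dots> \<le> (2 * (1 - \<sigma>)) * (C * indicator (annuli_nbhd n) x)"
  proof -
    have "x \<in> annuli_nbhd n" if "y \<in> annuli n"
      unfolding xy by (rule annuli_scale[OF that]) (use c n in \<open>auto simp: field_simps\<close>)
    then have "indicator (annuli n) y \<le> (indicator (annuli_nbhd n) x :: real)" by (auto simp: indicator_def)
    then show ?thesis using C \<sigma> by (intro mult_left_mono) auto
  qed
  finally show ?thesis by (simp add: mult.assoc)
qed

section \<open>The limit of vanishing dilation and the exhaustion of the space\<close>

context critical_equation
begin

text \<open>With h = 1 - \<sigma> and \<open>n\<close> fixed, the tested inequality bounds h times
  the left side by h times the right side plus O(h^2). Dividing by \<open>h\<close> and letting it
  vanish removes the remainder, whose factor depends on \<open>n\<close>; the constants that stay do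
  not.\<close>

lemma shell_estimate:
  obtains c K :: real where "c > 0" "K \<ge> 0"
    "\<And>n. n \<ge> 2 \<Longrightarrow> c * (LINT x|lborel. indicator (shell (2 / n) (n / 2)) x * e1 x) \<le> K * mass (annuli_nbhd n)"
proof -
  obtain C and \<eta> :: "real \<Rightarrow> 'a \<Rightarrow> real" where C: "C > 0" and
    \<eta>: "\<And>n. n \<ge> 2 \<Longrightarrow> \<eta> n \<in> test_functions" "\<And>n x. n \<ge> 2 \<Longrightarrow> 0 \<le> \<eta> n x" "\<And>n x. n \<ge> 2 \<Longrightarrow> \<eta> n x \<le> 1"
    "\<And>n x. n \<ge> 2 \<Longrightarrow> x \<notin> shell (1 / n) (2 * n) \<Longrightarrow> \<eta> n x = 0"
    "\<And>n x. n \<ge> 2 \<Longrightarrow> x \<in> shell (2 / n) n \<Longrightarrow> \<eta> n x = 1"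
    "\<And>n. n \<ge> 2 \<Longrightarrow> gradient (\<eta> n) 0 = 0"
    "\<And>n x. n \<ge> 2 \<Longrightarrow> norm (gradient (\<eta> n) x) * norm x \<le> C * indicator (annuli n) x"
    by (rule annular_cutoffs) (rule that; blast)
  define \<kappa> where "\<kappa> = \<alpha> * (q + 1) - real DIM('a)"
  have \<kappa>: "\<kappa> > 0" using exponents(5) by (simp add: \<kappa>_def)
  define k where "k = 1 + \<bar>\<mu>\<bar>"
  define C1 where "C1 = 2 ^ (DIM('a) + 2) + 2 * (max 1 \<alpha>)\<^sup>2"
  have C1: "C1 \<ge> 0" by (simp add: C1_def)
  \<comment> \<open>\<open>2 * C * k\<close> accounts for the change of the dilated cutoff, weighed
    with the energy density; \<open>C * C1\<close> and \<open>C\<close> are the two halves of the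
    weighted product estimate for the gradient of the cutoff.\<close>
  define K where "K = 2 * C * k + C * C1 + C"
  have "min 1 \<kappa> * (LINT x|lborel. indicator (shell (2 / n) (n / 2)) x * e1 x) \<le> K * mass (annuli_nbhd n)"
    if n: "n \<ge> 2" for n
  proof -
    define Q where "Q = mass (annuli_nbhd n)"
    define R where "R = mass (shell (1 / (2 * n)) (2 * n))"
    define I where "I = (LINT x|lborel. indicator (shell (2 / n) (n / 2)) x * e1 x)"
    \<comment> \<open>Bounds the weight of the quadratic remainder times |x|^2 on the support of the
      cutoff. Its growth in \<open>n\<close> is harmless because it is multiplied by h^2.\<close>
    define D where "D = (\<beta> - 1) / 2 * (2 * n)\<^sup>2 + \<bar>\<mu>\<bar> / 2"
    have D: "D \<ge> 0" using exponents(1) by (simp add: D_def)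
    have r: "1 / (2 * n) > 0" "1 / n > 0" using n by auto
    have nb: "1 / (2 * n) \<le> norm x \<and> norm x \<le> 2 * n" if "x \<in> annuli_nbhd n" for x :: 'a
    proof -
      have "1 / (2 * n) \<le> n / 2" "2 / n \<le> 2 * n"
      proof -
        have "1 / (2 * n) \<le> 1 / 2" using n by (intro frac_le) auto
        then show "1 / (2 * n) \<le> n / 2" using n by linarith
        have "2 / n \<le> 2 / 1" using n by (intro frac_le) auto
        then show "2 / n \<le> 2 * n" using n by linarith
      qed
      then show ?thesis using that by (auto simp: annuli_nbhd_def)
    qed
    have an: "annuli n \<subseteq> (annuli_nbhd n :: 'a set)"
      using annuli_scale[of _ n 1] n by auto
    have iQ: "integrable lborel (\<lambda>x. indicator (annuli_nbhd n) x * dens x)"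
      by (rule dens_integrable[OF annuli_sets(2) nb r(1)])
    have iA: "integrable lborel (\<lambda>x. indicator (annuli n) x * dens x)"
      by (rule dens_integrable[OF annuli_sets(1) _ r(1)]) (use nb an in auto)
    have AQ: "mass (annuli n) \<le> Q"
      unfolding Q_def using an dens_nonneg by (intro integral_mono iA iQ) (auto simp: indicator_def)
    have \<eta>s: "smooth (\<eta> n)" by (rule test_smooth[OF \<eta>(1)[OF n]])
    have \<eta>0: "\<eta> n x = 0" if "norm x < 1 / n" for x using that by (intro \<eta>(4) n) (auto simp: shell_def)
    have main: "min 1 \<kappa> * I \<le> K * Q + (D * C1 * R) * h" if h: "0 < h" "h \<le> 1 / 2" for h
    proof -
      define \<sigma> where "\<sigma> = 1 - h"
      have \<sigma>: "1 / 2 \<le> \<sigma>" "\<sigma> < 1" "\<sigma> > 0" "1 - \<sigma> = h" using h by (auto simp: \<sigma>_def)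
      define z where "z = (\<lambda>x. \<sigma> powr \<alpha> * u (\<sigma> *\<^sub>R x) - u x)"
      \<comment> \<open>The weights 1/h and h balance: the integral of z^2/|x|^2 is O(h^2), so both
        terms produced by the gradient of the cutoff are of order h.\<close>
      define P where "P = (\<lambda>x. C / h * (indicator (annuli n) x * ((z x)\<^sup>2 / (norm x)\<^sup>2)) + C * h * (indicator (annuli n) x * dens x)
          + D * (indicator (shell (1 / n) (2 * n)) x * ((z x)\<^sup>2 / (norm x)\<^sup>2)))"
      have sA: "t *\<^sub>R x \<in> annuli_nbhd n" if "x \<in> annuli n" "1 / 2 \<le> t" "t \<le> 1" for x :: 'a and t
        using annuli_scale[OF that] n by simp
      have sB: "t *\<^sub>R x \<in> shell (1 / (2 * n)) (2 * n)" if "x \<in> shell (1 / n) (2 * n)" "1 / 2 \<le> t" "t \<le> 1" for x :: 'a and t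
        using shell_scale[OF that] by (simp add: mult.commute)
      have nB: "1 / (2 * n) \<le> norm x \<and> norm x \<le> 2 * n" if "x \<in> shell (1 / (2 * n)) (2 * n)" for x :: 'a
        using that by (simp add: shell_def)
      note zA = dilation_estimate[OF \<sigma>(1,2) annuli_sets(1) annuli_sets(2) sA nb r(1), folded C1_def, unfolded \<sigma>(4)]
      note zB = dilation_estimate[OF \<sigma>(1,2) annuli_sets(3) annuli_sets(3) sB nB r(1), folded C1_def, unfolded \<sigma>(4)]
      have zA': "integrable lborel (\<lambda>x. indicator (annuli n) x * ((z x)\<^sup>2 / (norm x)\<^sup>2))"
        "(LINT x|lborel. indicator (annuli n) x * ((z x)\<^sup>2 / (norm x)\<^sup>2)) \<le> C1 * h\<^sup>2 * Q"
        using zA unfolding z_def Q_def by blast+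
      have zB': "integrable lborel (\<lambda>x. indicator (shell (1 / n) (2 * n)) x * ((z x)\<^sup>2 / (norm x)\<^sup>2))"
        "(LINT x|lborel. indicator (shell (1 / n) (2 * n)) x * ((z x)\<^sup>2 / (norm x)\<^sup>2)) \<le> C1 * h\<^sup>2 * R"
        using zB unfolding z_def R_def by blast+
      have Pi: "integrable lborel P" unfolding P_def
        by (intro Bochner_Integration.integrable_add integrable_mult_right zA' zB' iA)
      have Pint: "(LINT x|lborel. P x) \<le> C / h * (C1 * h\<^sup>2 * Q) + C * h * Q + D * (C1 * h\<^sup>2 * R)"
      proof -
        have "(LINT x|lborel. P x) = C / h * (LINT x|lborel. indicator (annuli n) x * ((z x)\<^sup>2 / (norm x)\<^sup>2))
          + C * h * mass (annuli n)
          + D * (LINT x|lborel. indicator (shell (1 / n) (2 * n)) x * ((z x)\<^sup>2 / (norm x)\<^sup>2))"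
          unfolding P_def
          by (simp only: Bochner_Integration.integral_add integral_mult_right_zero
            Bochner_Integration.integrable_add integrable_mult_right zA'(1) zB'(1) iA)
        also have "\<dots> \<le> C / h * (C1 * h\<^sup>2 * Q) + C * h * Q + D * (C1 * h\<^sup>2 * R)"
          using C h D by (intro add_mono mult_left_mono zA'(2) zB'(2) AQ) auto
        finally show ?thesis .
      qed
      have Pb: "\<bar>(G x \<bullet> gradient (\<eta> n) x) * z x\<bar> + \<eta> n x * ((z x)\<^sup>2 * ((\<beta> - 1) / 2 + \<bar>\<mu>\<bar> / (2 * (norm x)\<^sup>2))) \<le> P x" for x
      proof -
        have "\<bar>(G x \<bullet> gradient (\<eta> n) x) * z x\<bar> \<le> C / h * (indicator (annuli n) x * ((z x)\<^sup>2 / (norm x)\<^sup>2)) + C * h * (indicator (annuli n) x * dens x)"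
        \<comment> \<open>The quotient |z|/|x| is useless at the origin, but the gradient of the
          cutoff vanishes there.\<close>
        proof (cases "x = 0")
          case True
          then show ?thesis using \<eta>(6)[OF n] C h dens_nonneg by (simp add: zero_le_mult_iff)
        next
          case False
          define a where "a = \<bar>z x\<bar> / norm x"
          have "0 \<le> (a - h * norm (G x))\<^sup>2" by simp
          then have "2 * h * (a * norm (G x)) \<le> a\<^sup>2 + h\<^sup>2 * (norm (G x))\<^sup>2" by (simp add: power2_diff power_mult_distrib mult_ac)
          then have "(2 * h * (a * norm (G x))) / h \<le> (a\<^sup>2 + h\<^sup>2 * (norm (G x))\<^sup>2) / h" using h by (intro divide_right_mono) auto
          then have "2 * (a * norm (G x)) \<le> a\<^sup>2 / h + h * (norm (G x))\<^sup>2" using h by (simp add: add_divide_distrib power2_eq_square)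
          moreover have "0 \<le> a * norm (G x)" by (simp add: a_def)
          ultimately have am: "a * norm (G x) \<le> a\<^sup>2 / h + h * (norm (G x))\<^sup>2" by linarith
          have gd: "(norm (G x))\<^sup>2 \<le> dens x" by (simp add: dens_def)
          have "\<bar>(G x \<bullet> gradient (\<eta> n) x) * z x\<bar> \<le> (norm (G x) * norm (gradient (\<eta> n) x)) * \<bar>z x\<bar>"
            unfolding abs_mult by (intro mult_right_mono Cauchy_Schwarz_ineq2) auto
          also have "\<dots> = (norm (gradient (\<eta> n) x) * norm x) * (a * norm (G x))" using False by (simp add: a_def)
          also have "\<dots> \<le> (C * indicator (annuli n) x) * (a\<^sup>2 / h + h * dens x)"
            using C h gd am dens_nonneg[of x]
            by (intro mult_mono \<eta>(7) n order_trans[OF am] add_mono) (auto simp: a_def)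
          also have "a\<^sup>2 = (z x)\<^sup>2 / (norm x)\<^sup>2" by (simp add: a_def power_divide)
          finally show ?thesis by (simp add: distrib_left mult_ac)
        qed
        moreover have "\<eta> n x * ((z x)\<^sup>2 * ((\<beta> - 1) / 2 + \<bar>\<mu>\<bar> / (2 * (norm x)\<^sup>2))) \<le> D * (indicator (shell (1 / n) (2 * n)) x * ((z x)\<^sup>2 / (norm x)\<^sup>2))"
        proof (cases "x \<in> shell (1 / n) (2 * n)")
          case True
          then have x: "1 / n \<le> norm x" "norm x \<le> 2 * n" by (auto simp: shell_def)
          then have x0: "norm x > 0" using r by linarith
          have "(norm x)\<^sup>2 \<le> (2 * n)\<^sup>2" using x(2) by (rule power_mono) simp
          then have "(\<beta> - 1) / 2 * (norm x)\<^sup>2 + \<bar>\<mu>\<bar> / 2 \<le> D" unfolding D_def using exponents(1)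
            by (intro add_mono mult_left_mono) auto
          then have "((z x)\<^sup>2 / (norm x)\<^sup>2) * ((\<beta> - 1) / 2 * (norm x)\<^sup>2 + \<bar>\<mu>\<bar> / 2) \<le> ((z x)\<^sup>2 / (norm x)\<^sup>2) * D"
            by (intro mult_left_mono) auto
          also have "((z x)\<^sup>2 / (norm x)\<^sup>2) * ((\<beta> - 1) / 2 * (norm x)\<^sup>2 + \<bar>\<mu>\<bar> / 2) = (z x)\<^sup>2 * ((\<beta> - 1) / 2 + \<bar>\<mu>\<bar> / (2 * (norm x)\<^sup>2))"
            using x0 by (simp add: field_simps)
          finally have 1: "(z x)\<^sup>2 * ((\<beta> - 1) / 2 + \<bar>\<mu>\<bar> / (2 * (norm x)\<^sup>2)) \<le> D * ((z x)\<^sup>2 / (norm x)\<^sup>2)" by (simp add: mult.commute)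
          have "\<eta> n x * ((z x)\<^sup>2 * ((\<beta> - 1) / 2 + \<bar>\<mu>\<bar> / (2 * (norm x)\<^sup>2))) \<le> (z x)\<^sup>2 * ((\<beta> - 1) / 2 + \<bar>\<mu>\<bar> / (2 * (norm x)\<^sup>2))"
            using exponents(1) by (intro mult_left_le_one_le \<eta>(2,3) n mult_nonneg_nonneg add_nonneg_nonneg) auto
          then show ?thesis using 1 True by simp
        next
          case False
          then show ?thesis using \<eta>(4)[OF n False] by simp
        qed
        ultimately show ?thesis unfolding P_def by linarith
      qed
      have T: "(1 - \<sigma> powr \<kappa>) * (LINT x|lborel. \<eta> n ((1 / \<sigma>) *\<^sub>R x) * e1 x) \<le>
         (LINT x|lborel. (\<eta> n ((1 / \<sigma>) *\<^sub>R x) - \<eta> n x) * (e0 x + e1 x)) + (LINT x|lborel. P x)"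
        unfolding \<kappa>_def by (rule tested_inequality[OF \<eta>(1)[OF n] r(2) \<eta>0 \<eta>(2)[OF n] \<sigma>(3) Pi Pb[unfolded z_def]])
      have T1: "(LINT x|lborel. (\<eta> n ((1 / \<sigma>) *\<^sub>R x) - \<eta> n x) * (e0 x + e1 x)) \<le> 2 * h * C * k * Q"
      proof -
        have "(LINT x|lborel. (\<eta> n ((1 / \<sigma>) *\<^sub>R x) - \<eta> n x) * (e0 x + e1 x)) \<le> (LINT x|lborel. 2 * h * C * k * (indicator (annuli_nbhd n) x * dens x))"
        proof (rule integral_mono')
          show "integrable lborel (\<lambda>x. 2 * h * C * k * (indicator (annuli_nbhd n) x * dens x))"
            by (rule integrable_mult_right[OF iQ])
          fix x :: 'a
          show "0 \<le> 2 * h * C * k * (indicator (annuli_nbhd n) x * dens x)"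
            using h C dens_nonneg by (auto simp: k_def)
          have "(\<eta> n ((1 / \<sigma>) *\<^sub>R x) - \<eta> n x) * (e0 x + e1 x) \<le> \<bar>\<eta> n ((1 / \<sigma>) *\<^sub>R x) - \<eta> n x\<bar> * \<bar>e0 x + e1 x\<bar>"
            by (metis abs_ge_self abs_mult)
          also have "\<dots> \<le> (2 * (1 - \<sigma>) * C * indicator (annuli_nbhd n) x) * (k * dens x)"
            unfolding k_def using C n h dens_nonneg \<sigma>
            by (intro mult_mono cutoff_dilation_difference \<eta>s \<eta>(7) e_bound) auto
          finally show "(\<eta> n ((1 / \<sigma>) *\<^sub>R x) - \<eta> n x) * (e0 x + e1 x) \<le> 2 * h * C * k * (indicator (annuli_nbhd n) x * dens x)"
            unfolding \<sigma>(4) by (simp add: mult_ac)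
        qed
        then show ?thesis by (simp add: Q_def)
      qed
      \<comment> \<open>The factor 1/\<sigma> \<le> 2 may push the outer radius from n/2 up to n,
        where the cutoff is still 1; this is why the shell stops at n/2.\<close>
      have T2: "I \<le> (LINT x|lborel. \<eta> n ((1 / \<sigma>) *\<^sub>R x) * e1 x)"
        unfolding I_def
      proof (rule integral_mono')
        show "integrable lborel (\<lambda>x. \<eta> n ((1 / \<sigma>) *\<^sub>R x) * e1 x)"
          by (rule cutoff_integrable(2)[OF \<eta>(1)[OF n] r(2) \<eta>0]) (use \<sigma> in auto)
        fix x :: 'a
        have e1: "e1 x \<ge> 0" using exponents(1) q by (simp add: e1_def)
        then show nn: "0 \<le> \<eta> n ((1 / \<sigma>) *\<^sub>R x) * e1 x" using \<eta>(2)[OF n] by simp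
        show "indicator (shell (2 / n) (n / 2)) x * e1 x \<le> \<eta> n ((1 / \<sigma>) *\<^sub>R x) * e1 x"
        proof (cases "x \<in> shell (2 / n) (n / 2)")
          case True
          have "(1 / \<sigma>) * norm x \<ge> 1 * norm x" "(1 / \<sigma>) * norm x \<le> 2 * norm x"
            using \<sigma> by (intro mult_right_mono; simp add: field_simps)+
          then have "(1 / \<sigma>) *\<^sub>R x \<in> shell (2 / n) n" using True \<sigma> by (auto simp: shell_def)
          from \<eta>(5)[OF n this] show ?thesis using True by simp
        qed (use nn in simp)
      qed
      have I0: "I \<ge> 0" unfolding I_def using exponents(1) q by (intro Bochner_Integration.integral_nonneg) (auto simp: e1_def)
      have "(min 1 \<kappa> * h) * I \<le> (1 - \<sigma> powr \<kappa>) * (LINT x|lborel. \<eta> n ((1 / \<sigma>) *\<^sub>R x) * e1 x)"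
      proof (intro mult_mono T2 I0)
        show "min 1 \<kappa> * h \<le> 1 - \<sigma> powr \<kappa>"
          using bernoulli_powr(2)[of \<sigma> \<kappa>] \<sigma> \<kappa> by simp
        show "0 \<le> 1 - \<sigma> powr \<kappa>" using \<sigma> \<kappa> by (simp add: powr_le1)
      qed
      also have "\<dots> \<le> 2 * h * C * k * Q + (C / h * (C1 * h\<^sup>2 * Q) + C * h * Q + D * (C1 * h\<^sup>2 * R))"
        using T T1 Pint by linarith
      also have "\<dots> = h * (K * Q + (D * C1 * R) * h)"
      proof -
        have "C / h * (C1 * h\<^sup>2 * Q) = C * C1 * h * Q" using h by (simp add: power2_eq_square)
        then show ?thesis by (simp add: K_def algebra_simps power2_eq_square)
      qed
      finally have "h * (min 1 \<kappa> * I) \<le> h * (K * Q + (D * C1 * R) * h)" by (simp add: mult_ac)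
      then show ?thesis using h by simp
    qed
    show ?thesis using le_of_le_add_small[OF main] unfolding I_def Q_def .
  qed
  moreover have "K \<ge> 0" using C C1 by (simp add: K_def k_def)
  ultimately show ?thesis using that[of "min 1 \<kappa>" K] \<kappa> by simp
qed

lemma measure_cball_scale: "r \<ge> 0 \<Longrightarrow> measure lborel (cball (0::'a) r) = r ^ DIM('a) * measure lborel (ball (0::'a) 1)"
  by (simp only: content_cball_conv_ball) (rule content_ball_conv_unit_ball)

text \<open>A bound independent of \<open>n\<close>: the weight is \<open>|x|\<close> to the power minus the dimension, which is scale
  invariant.\<close>

lemma annuli_weight:
  assumes n: "n > 0"
  shows "integrable lborel (\<lambda>x::'a. indicator (annuli_nbhd n) x * (1 / (norm x)\<^sup>2) powr (real DIM('a) / 2))"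
    "(LINT x::'a|lborel. indicator (annuli_nbhd n) x * (1 / (norm x)\<^sup>2) powr (real DIM('a) / 2)) \<le> 2 * 4 ^ DIM('a) * measure lborel (ball (0::'a) 1)"
proof -
  let ?N = "DIM('a)"
  let ?f = "\<lambda>x::'a. indicator (annuli_nbhd n) x * (1 / (norm x)\<^sup>2) powr (real ?N / 2) :: real"
  \<comment> \<open>On each annulus the weight is at most its value at the inner radius, and the
    annulus is enlarged to a ball; the powers of \<open>n\<close> then cancel against the
    volumes.\<close>
  let ?g = "\<lambda>x::'a. (2 * n) ^ ?N * indicator (cball 0 (2 / n)) x + (2 / n) ^ ?N * indicator (cball 0 (2 * n)) x :: real"
  have p: "(1 / (norm x)\<^sup>2) powr (real ?N / 2) \<le> (1 / m) ^ ?N" if m: "0 < m" "m \<le> norm x" for m and x :: 'a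
  proof -
    have "1 / norm x \<le> 1 / m" using m by (intro frac_le) auto
    have x: "norm x > 0" using m by linarith
    then have "(1 / (norm x)\<^sup>2) powr (real ?N / 2) = ((1 / norm x) powr 2) powr (real ?N / 2)"
      by (simp add: power_divide)
    also have "\<dots> = (1 / norm x) ^ ?N" using x by (simp only: powr_powr) (simp add: powr_realpow)
    also have "\<dots> \<le> (1 / m) ^ ?N" using \<open>1 / norm x \<le> 1 / m\<close> by (rule power_mono) simp
    finally show ?thesis .
  qed
  have b: "?f x \<le> ?g x" for x
  proof (cases "x \<in> annuli_nbhd n")
    case True
    have gn: "(2 * n) ^ ?N \<ge> 0" "(2 / n) ^ ?N \<ge> 0" using n by auto
    from True consider "1 / (2 * n) \<le> norm x" "norm x \<le> 2 / n" | "n / 2 \<le> norm x" "norm x \<le> 2 * n"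
      by (auto simp: annuli_nbhd_def)
    then show ?thesis
    proof cases
      case 1
      then have "(1 / (norm x)\<^sup>2) powr (real ?N / 2) \<le> (2 * n) ^ ?N" using p[of "1 / (2 * n)" x] n by simp
      moreover have "(2 / n) ^ ?N * indicator (cball 0 (2 * n)) x \<ge> 0" using gn by simp
      moreover have "?f x = (1 / (norm x)\<^sup>2) powr (real ?N / 2)" "(2 * n) ^ ?N * indicator (cball 0 (2 / n)) x = (2 * n) ^ ?N"
        using True 1 by simp_all
      ultimately show ?thesis by linarith
    next
      case 2
      then have "(1 / (norm x)\<^sup>2) powr (real ?N / 2) \<le> (2 / n) ^ ?N" using p[of "n / 2" x] n by simp
      moreover have "(2 * n) ^ ?N * indicator (cball 0 (2 / n)) x \<ge> 0" using gn by simp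
      moreover have "?f x = (1 / (norm x)\<^sup>2) powr (real ?N / 2)" "(2 / n) ^ ?N * indicator (cball 0 (2 * n)) x = (2 / n) ^ ?N"
        using True 2 by simp_all
      ultimately show ?thesis by linarith
    qed
  next
    case False
    then show ?thesis using n by simp
  qed
  have i1: "integrable lborel (\<lambda>x::'a. indicator (cball 0 s) x :: real)" for s
    by (intro integrable_real_indicator emeasure_lborel_cball_finite) auto
  have gi: "integrable lborel ?g"
    by (intro Bochner_Integration.integrable_add integrable_mult_right i1)
  show fi: "integrable lborel ?f"
    by (rule Bochner_Integration.integrable_bound[OF gi]) (use b in \<open>auto intro: order_trans[OF _ abs_ge_self]\<close>)
  have "(LINT x|lborel. ?f x) \<le> (LINT x|lborel. ?g x)" by (rule integral_mono[OF fi gi b])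
  also have "\<dots> = (2 * n) ^ ?N * measure lborel (cball (0::'a) (2 / n)) + (2 / n) ^ ?N * measure lborel (cball (0::'a) (2 * n))"
    by (simp only: Bochner_Integration.integral_add integral_mult_right_zero integrable_mult_right i1)
       simp
  also have "\<dots> = (2 * n) ^ ?N * ((2 / n) ^ ?N * measure lborel (ball (0::'a) 1)) + (2 / n) ^ ?N * ((2 * n) ^ ?N * measure lborel (ball (0::'a) 1))"
    using n by (subst (1 2) measure_cball_scale) auto
  also have "\<dots> = 2 * ((2 * n) * (2 / n)) ^ ?N * measure lborel (ball (0::'a) 1)"
  proof -
    have "a * (b * v) + b * (a * v) = 2 * (a * b) * v" for a b v :: real by (simp add: algebra_simps)
    then show ?thesis unfolding power_mult_distrib[of "2 * n" "2 / n"] .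
  qed
  also have "(2 * n) * (2 / n) = 4" using n by simp
  finally show "(LINT x|lborel. ?f x) \<le> 2 * 4 ^ DIM('a) * measure lborel (ball (0::'a) 1)" .
qed

text \<open>By \<open>shell_estimate\<close> it suffices that the mass of the end annuli tends to 0.
  For the globally integrable terms of \<open>dens\<close> this is dominated convergence; u^2/|x|^2
  is split by Young's inequality into a small multiple of |x|^(-N) and a multiple of u^\<beta>. The
  integral of \<open>e1\<close> is then zero, against the positivity of \<open>u\<close>.\<close>

theorem no_solution: False
proof -
  obtain c K where c: "c > 0" "K \<ge> 0" and
    est: "\<And>n. n \<ge> 2 \<Longrightarrow> c * (LINT x|lborel. indicator (shell (2 / n) (n / 2)) x * e1 x) \<le> K * mass (annuli_nbhd n)"
    using shell_estimate by metis
  \<comment> \<open>The part of \<open>dens\<close> known to be integrable over the whole space: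
    everything but the singular term.\<close>
  define w where "w = (\<lambda>x. (norm (G x))\<^sup>2 + u x powr \<beta> + u x powr (q + 1))"
  have [measurable]: "w \<in> borel_measurable borel" unfolding w_def by measurable
  have w0: "w x \<ge> 0" for x by (simp add: w_def)
  have wi: "integrable lborel w" unfolding w_def by (intro Bochner_Integration.integrable_add Gi ub uq)
  have e1i: "integrable lborel e1" unfolding e1_def[abs_def] by (intro integrable_divide uq)
  have e1p: "e1 x > 0" for x using pos[of x] exponents(1) q by (simp add: e1_def)
  \<comment> \<open>Shifted by 2 so that \<open>est\<close> applies for every index.\<close>
  define m where "m = (\<lambda>k::nat. real k + 2)"
  have m: "m k \<ge> 2" "m k > 0" for k by (auto simp: m_def)
  have ml: "filterlim m at_top sequentially" unfolding m_def
    by (intro filterlim_tendsto_add_at_top[OF tendsto_const, of _ _ 2, simplified add.commute] filterlim_real_sequentially)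
  have ev: "\<forall>\<^sub>F k in sequentially. 2 / m k < norm x \<and> norm x < m k / 2" if x: "x \<noteq> 0" for x :: 'a
  proof -
    have "\<forall>\<^sub>F k in sequentially. m k > max (2 / norm x) (2 * norm x)"
      using ml unfolding filterlim_at_top_dense by blast
    then show ?thesis
    proof eventually_elim
      case (elim k)
      then have "2 / norm x < m k" "2 * norm x < m k" by auto
      then show ?case using x m(2)[of k] by (auto simp: field_simps)
    qed
  qed
  define w' where "w' = (\<lambda>k. LINT x|lborel. indicator (annuli_nbhd (m k)) x * w x)"
  have w'0: "w' \<longlonglongrightarrow> 0"
  proof -
    have "w' \<longlonglongrightarrow> (LINT x::'a|lborel. 0)" unfolding w'_def
    proof (rule integral_dominated_convergence[where w = w])
      show "AE x in lborel. (\<lambda>k. indicator (annuli_nbhd (m k)) x * w x) \<longlonglongrightarrow> 0"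
      proof (rule AE_I2)
        fix x :: 'a
        have "\<forall>\<^sub>F k in sequentially. x \<notin> annuli_nbhd (m k)"
        proof (cases "x = 0")
          case True
          have "(0::'a) \<notin> annuli_nbhd (m k)" for k using m[of k] by (simp add: annuli_nbhd_def not_le)
          then show ?thesis using True by simp
        next
          case False
          from ev[OF this] show ?thesis by eventually_elim (auto simp: annuli_nbhd_def)
        qed
        then have "\<forall>\<^sub>F k in sequentially. indicator (annuli_nbhd (m k)) x * w x = 0" by eventually_elim simp
        then show "(\<lambda>k. indicator (annuli_nbhd (m k)) x * w x) \<longlonglongrightarrow> 0" by (rule tendsto_eventually)
      qed
      show "AE x in lborel. norm (indicator (annuli_nbhd (m k)) x * w x) \<le> w x" for k
        using w0 by (auto simp: indicator_def)
    qed (use wi in auto)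
    then show ?thesis by simp
  qed
  define E where "E = (LINT x|lborel. e1 x)"
  have I: "(\<lambda>k. LINT x|lborel. indicator (shell (2 / m k) (m k / 2)) x * e1 x) \<longlonglongrightarrow> E"
    unfolding E_def
  proof (rule integral_dominated_convergence[where w = e1])
    have "AE x in lborel. x \<noteq> (0::'a)" by (rule AE_lborel_singleton)
    then show "AE x in lborel. (\<lambda>k. indicator (shell (2 / m k) (m k / 2)) x * e1 x) \<longlonglongrightarrow> e1 x"
    proof eventually_elim
      case (elim x)
      from ev[OF this] have "\<forall>\<^sub>F k in sequentially. indicator (shell (2 / m k) (m k / 2)) x * e1 x = e1 x"
        by eventually_elim (simp add: shell_def)
      then show ?case by (rule tendsto_eventually)
    qed
    show "AE x in lborel. norm (indicator (shell (2 / m k) (m k / 2)) x * e1 x) \<le> e1 x" for k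
      using e1p by (auto simp: indicator_def less_imp_le)
  qed (use e1i in auto)
  \<comment> \<open>The exponents N/2 and \<beta>/2 are conjugate and turn 1/|x|^2 into |x|^(-N) and
    u^2 into u^\<beta>.\<close>
  define s where "s = real DIM('a) / 2"
  define r where "r = \<beta> / 2"
  have sr: "s > 1" "r > 1" "1 / s + 1 / r = 1"
  proof -
    have d: "real DIM('a) \<ge> 3" using dim by simp
    then show "s > 1" by (simp add: s_def)
    show "r > 1" using exponents(1) by (simp add: r_def)
    show "1 / s + 1 / r = 1" using d by (simp add: s_def r_def \<beta>_def critical_exponent_def field_simps)
  qed
  define V where "V = 2 * 4 ^ DIM('a) * measure lborel (ball (0::'a) 1)"
  have V: "V \<ge> 0" by (simp add: V_def)
  \<comment> \<open>For fixed \<epsilon> the limit in \<open>k\<close> removes both terms with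
    \<open>w' k\<close>, also the one whose factor is large when \<epsilon> is small.
    \<open>V\<close> does not depend on \<open>k\<close>, so \<epsilon> can be sent to 0
    afterwards.\<close>
  have bound: "c * E \<le> 0 + (K * V) * \<epsilon>" if \<epsilon>: "0 < \<epsilon>" "\<epsilon> \<le> 1 / 2" for \<epsilon>
  proof -
    define \<delta> where "\<delta> = \<epsilon> powr (1 / s)"
    have \<delta>: "\<delta> > 0" "\<delta> powr s = \<epsilon>" using \<epsilon> sr by (auto simp: \<delta>_def powr_powr)
    have "mass (annuli_nbhd (m k)) \<le> w' k + \<epsilon> * V + \<delta> powr (-r) * w' k" for k
    proof -
      let ?A = "annuli_nbhd (m k) :: 'a set"
      have iw: "integrable lborel (\<lambda>x. indicator ?A x * w x)"
        by (rule Bochner_Integration.integrable_bound[OF wi]) (use w0 in \<open>auto simp: indicator_def\<close>)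
      note aw = annuli_weight[OF m(2)[of k]]
      have "mass ?A \<le>
        (LINT x|lborel. indicator ?A x * w x + \<epsilon> * (indicator ?A x * (1 / (norm x)\<^sup>2) powr (real DIM('a) / 2)) + \<delta> powr (-r) * (indicator ?A x * w x))"
      proof (rule integral_mono')
        show "integrable lborel (\<lambda>x. indicator ?A x * w x + \<epsilon> * (indicator ?A x * (1 / (norm x)\<^sup>2) powr (real DIM('a) / 2)) + \<delta> powr (-r) * (indicator ?A x * w x))"
          by (intro Bochner_Integration.integrable_add integrable_mult_right iw aw)
        fix x :: 'a
        show "0 \<le> indicator ?A x * w x + \<epsilon> * (indicator ?A x * (1 / (norm x)\<^sup>2) powr (real DIM('a) / 2)) + \<delta> powr (-r) * (indicator ?A x * w x)"
          using w0[of x] \<epsilon> by simp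
        have "(u x)\<^sup>2 / (norm x)\<^sup>2 \<le> \<epsilon> * (1 / (norm x)\<^sup>2) powr (real DIM('a) / 2) + \<delta> powr (-r) * w x"
        proof -
          have "(u x)\<^sup>2 / (norm x)\<^sup>2 = \<bar>1 / (norm x)\<^sup>2 * (u x)\<^sup>2\<bar>" by simp
          also have "\<dots> \<le> \<delta> powr s * \<bar>1 / (norm x)\<^sup>2\<bar> powr s + \<delta> powr (-r) * \<bar>(u x)\<^sup>2\<bar> powr r"
            by (rule young_scaled[OF sr(2,1,3) \<delta>(1)])
          also have "\<bar>1 / (norm x)\<^sup>2\<bar> = 1 / (norm x)\<^sup>2" by simp
          also have "\<bar>(u x)\<^sup>2\<bar> powr r = u x powr \<beta>"
          proof -
            have "\<bar>(u x)\<^sup>2\<bar> = u x powr 2" using pos[of x] by simp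
            then show ?thesis by (simp only: powr_powr) (simp add: r_def)
          qed
          also have "\<delta> powr s * (1 / (norm x)\<^sup>2) powr s + \<delta> powr (-r) * u x powr \<beta> \<le> \<epsilon> * (1 / (norm x)\<^sup>2) powr (real DIM('a) / 2) + \<delta> powr (-r) * w x"
            unfolding \<delta>(2) unfolding s_def using \<epsilon> by (intro add_mono mult_left_mono) (auto simp: w_def)
          finally show ?thesis .
        qed
        then show "indicator ?A x * dens x \<le> indicator ?A x * w x + \<epsilon> * (indicator ?A x * (1 / (norm x)\<^sup>2) powr (real DIM('a) / 2)) + \<delta> powr (-r) * (indicator ?A x * w x)"
          by (auto simp: indicator_def dens_def w_def)
      qed
      also have "\<dots> = w' k + \<epsilon> * (LINT x|lborel. indicator ?A x * (1 / (norm x)\<^sup>2) powr (real DIM('a) / 2)) + \<delta> powr (-r) * w' k"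
        unfolding w'_def
        by (simp only: Bochner_Integration.integral_add integral_mult_right_zero
            Bochner_Integration.integrable_add integrable_mult_right iw aw(1))
      also have "\<dots> \<le> w' k + \<epsilon> * V + \<delta> powr (-r) * w' k"
        using aw(2) \<epsilon> unfolding V_def by (intro add_mono mult_left_mono) auto
      finally show ?thesis .
    qed
    then have "c * (LINT x|lborel. indicator (shell (2 / m k) (m k / 2)) x * e1 x) \<le> K * (w' k + \<epsilon> * V + \<delta> powr (-r) * w' k)" for k
      using order_trans[OF est[OF m(1)] mult_left_mono[OF _ c(2)]] by blast
    moreover have "(\<lambda>k. c * (LINT x|lborel. indicator (shell (2 / m k) (m k / 2)) x * e1 x)) \<longlonglongrightarrow> c * E"
      by (intro tendsto_intros I)
    moreover have "(\<lambda>k. K * (w' k + \<epsilon> * V + \<delta> powr (-r) * w' k)) \<longlonglongrightarrow> K * (0 + \<epsilon> * V + \<delta> powr (-r) * 0)"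
      by (intro tendsto_intros w'0)
    ultimately have "c * E \<le> K * (0 + \<epsilon> * V + \<delta> powr (-r) * 0)"
      by (intro LIMSEQ_le[of _ "c * E" _ "K * (0 + \<epsilon> * V + \<delta> powr (-r) * 0)"]) auto
    then show ?thesis by (simp add: mult_ac)
  qed
  from le_of_le_add_small[OF bound] have "E \<le> 0" using c by (simp add: mult_le_0_iff)
  moreover have "E \<ge> 0" unfolding E_def using e1p by (intro Bochner_Integration.integral_nonneg) (auto simp: less_imp_le)
  ultimately have "(LINT x|lborel. e1 x) = 0" unfolding E_def by simp
  then have "AE x in lborel. e1 x = 0"
    using integral_nonneg_eq_0_iff_AE[OF e1i] e1p by (auto simp: less_imp_le)
  then have "AE x in lborel. x \<notin> ball (0::'a) 1" by eventually_elim (use e1p in \<open>auto simp: less_le\<close>)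
  then have "ball (0::'a) 1 \<in> null_sets lborel" by (simp only: AE_iff_null_sets sets_lborel open_ball borel_open)
  then have "measure lborel (ball (0::'a) 1) = 0" by (rule measure_eq_0_null_sets)
  then show False using content_ball_pos[OF zero_less_one, of "0::'a"] by linarith
qed

end

section \<open>Borel representatives\<close>

lemma lebesgue_borel_representative:
  fixes f :: "'a::euclidean_space \<Rightarrow> real"
  assumes "f \<in> borel_measurable lebesgue"
  obtains f' where "f' \<in> borel_measurable borel" "AE x in lebesgue. f x = f' x"
proof -
  obtain f' where f': "f' \<in> borel_measurable lborel" "AE x in lborel. f x = f' x"
    using completion_ex_borel_measurable_real[OF assms] by blast
  show ?thesis using f' by (intro that[of f']) (auto intro: AE_completion)
qed

lemma lebesgue_borel_representative_vector:
  fixes f :: "'a::euclidean_space \<Rightarrow> 'a"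
  assumes [measurable]: "f \<in> borel_measurable lebesgue"
  obtains f' where "f' \<in> borel_measurable borel" "AE x in lebesgue. f x = f' x"
proof -
  have "\<exists>g. g \<in> borel_measurable borel \<and> (AE x in lebesgue. f x \<bullet> i = g x)" for i
  proof -
    have "(\<lambda>x. f x \<bullet> i) \<in> borel_measurable lebesgue" by measurable
    from lebesgue_borel_representative[OF this] show ?thesis by blast
  qed
  then obtain g where g: "\<And>i. g i \<in> borel_measurable borel" "\<And>i. AE x in lebesgue. f x \<bullet> i = g i x" by metis
  have "AE x in lebesgue. \<forall>i\<in>Basis. f x \<bullet> i = g i x"
    by (intro AE_finite_allI) (auto simp: g)
  then have "AE x in lebesgue. f x = (\<Sum>i\<in>Basis. g i x *\<^sub>R i)"
  proof eventually_elim
    case (elim x)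
    have "f x = (\<Sum>i\<in>Basis. (f x \<bullet> i) *\<^sub>R i)" by (rule euclidean_representation[symmetric])
    also have "\<dots> = (\<Sum>i\<in>Basis. g i x *\<^sub>R i)" using elim by (intro sum.cong) auto
    finally show ?case .
  qed
  then show ?thesis using g(1) by (intro that[of "\<lambda>x. \<Sum>i\<in>Basis. g i x *\<^sub>R i"]) auto
qed

text \<open>Moves integrals and integrability conditions of the problem from \<open>lebesgue\<close>
  to \<open>lborel\<close>, once Borel representatives are chosen.\<close>

lemma lebesgue_integral_representative:
  fixes f g :: "'a::euclidean_space \<Rightarrow> real"
  assumes fl: "f \<in> borel_measurable lebesgue" and g: "g \<in> borel_measurable borel" and ae: "AE x in lebesgue. f x = g x"
  shows "(LINT x|lebesgue. f x) = (LINT x|lborel. g x)" "integrable lebesgue f \<longleftrightarrow> integrable lborel g"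
proof -
  have gb: "g \<in> borel_measurable lborel" using g by simp
  then have gl: "g \<in> borel_measurable lebesgue" by (rule measurable_completion)
  have "(LINT x|lebesgue. f x) = (LINT x|lebesgue. g x)"
    by (rule integral_cong_AE[OF fl gl ae])
  then show "(LINT x|lebesgue. f x) = (LINT x|lborel. g x)" by (simp add: integral_completion[OF gb])
  have "integrable lebesgue f \<longleftrightarrow> integrable lebesgue g"
    by (rule integrable_cong_AE[OF fl gl ae])
  then show "integrable lebesgue f \<longleftrightarrow> integrable lborel g" by (simp add: integrable_completion[OF gb])
qed

section \<open>Weak gradients paired with test functions\<close>

lemma absolutely_integrable_test:
  fixes F :: "'a::euclidean_space \<Rightarrow> 'b::euclidean_space"
  assumes F: "\<And>K. compact K \<Longrightarrow> F absolutely_integrable_on K" and \<phi>: "\<phi> \<in> test_functions"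
  shows "integrable lebesgue (\<lambda>x. \<phi> x *\<^sub>R F x)"
proof -
  obtain R where R: "\<And>x. norm x > R \<Longrightarrow> \<phi> x = 0" using \<phi> by (auto simp: test_functions_iff)
  obtain B where B: "\<And>x. \<bar>\<phi> x\<bar> \<le> B" using test_bounded[OF \<phi>] by metis
  let ?F = "\<lambda>x. indicator (cball 0 R) x *\<^sub>R F x"
  have i: "integrable lebesgue ?F" using F[of "cball 0 R"] by (simp add: set_integrable_def)
  then have [measurable]: "?F \<in> borel_measurable lebesgue" by simp
  have [measurable]: "\<phi> \<in> borel_measurable lebesgue"
    using smooth_measurable[OF test_smooth[OF \<phi>]] by (intro measurable_completion) simp
  have "\<phi> x *\<^sub>R F x = \<phi> x *\<^sub>R ?F x" for x using R[of x] by (cases "norm x \<le> R") auto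
  moreover have "integrable lebesgue (\<lambda>x. \<phi> x *\<^sub>R ?F x)"
  proof (rule Bochner_Integration.integrable_bound)
    show "integrable lebesgue (\<lambda>x. B *\<^sub>R ?F x)" using i by (rule integrable_scaleR_right)
    have "norm (\<phi> x *\<^sub>R ?F x) \<le> norm (B *\<^sub>R ?F x)" for x
    proof -
      have "\<bar>\<phi> x\<bar> * norm (?F x) \<le> \<bar>B\<bar> * norm (?F x)" using B[of x] by (intro mult_right_mono) auto
      then show ?thesis by (simp only: norm_scaleR)
    qed
    then show "AE x in lebesgue. norm (\<phi> x *\<^sub>R ?F x) \<le> norm (B *\<^sub>R ?F x)" by simp
    show "(\<lambda>x. \<phi> x *\<^sub>R ?F x) \<in> borel_measurable lebesgue" by measurable
  qed
  ultimately show ?thesis by (simp only:)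
qed

text \<open>The definition uses vector-valued integrals. Local integrability and compact support
  make their integrands integrable, which is required before a component may be taken inside the
  integral.\<close>

lemma weak_gradient_component:
  assumes w: "has_weak_gradient u G" and \<phi>: "\<phi> \<in> test_functions" and i: "i \<in> Basis"
  shows "(LINT x|lebesgue. u x * pd \<phi> i x) = - (LINT x|lebesgue. \<phi> x * (G x \<bullet> i))"
    "integrable lebesgue (\<lambda>x. \<phi> x * (G x \<bullet> i))"
proof -
  have G: "integrable lebesgue (\<lambda>x. \<phi> x *\<^sub>R G x)"
    using w by (intro absolutely_integrable_test \<phi>) (auto simp: has_weak_gradient_def)
  have "integrable lebesgue (\<lambda>x. pd \<phi> j x *\<^sub>R u x)" if "j \<in> Basis" for j
    using w by (intro absolutely_integrable_test test_pd \<phi> that) (auto simp: has_weak_gradient_def)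
  then have "integrable lebesgue (\<lambda>x. \<Sum>j\<in>Basis. (pd \<phi> j x *\<^sub>R u x) *\<^sub>R j)"
    by (intro Bochner_Integration.integrable_sum integrable_scaleR_left)
  then have u: "integrable lebesgue (\<lambda>x. u x *\<^sub>R gradient \<phi> x)"
    by (simp add: gradient_def scaleR_sum_right mult.commute)
  have eq: "(LINT x|lebesgue. u x *\<^sub>R gradient \<phi> x) = - (LINT x|lebesgue. \<phi> x *\<^sub>R G x)"
    using w \<phi> by (auto simp: has_weak_gradient_def)
  have "(LINT x|lebesgue. u x * pd \<phi> i x) = (LINT x|lebesgue. (u x *\<^sub>R gradient \<phi> x) \<bullet> i)"
    by (simp add: gradient_inner[OF i])
  also have "\<dots> = (LINT x|lebesgue. u x *\<^sub>R gradient \<phi> x) \<bullet> i" using u by (simp only: integral_inner_left)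
  also have "\<dots> = - ((LINT x|lebesgue. \<phi> x *\<^sub>R G x) \<bullet> i)" unfolding eq by simp
  also have "(LINT x|lebesgue. \<phi> x *\<^sub>R G x) \<bullet> i = (LINT x|lebesgue. (\<phi> x *\<^sub>R G x) \<bullet> i)"
    using G by (simp only: integral_inner_left)
  finally show "(LINT x|lebesgue. u x * pd \<phi> i x) = - (LINT x|lebesgue. \<phi> x * (G x \<bullet> i))" by simp
  have "integrable lebesgue (\<lambda>x. (\<phi> x *\<^sub>R G x) \<bullet> i)" using G by (rule integrable_inner_left)
  then show "integrable lebesgue (\<lambda>x. \<phi> x * (G x \<bullet> i))" by simp
qed

text \<open>The weak gradient in \<^const>\<open>weak_solution\<close> need not be the one in \<^const>\<open>D12\<close>; by this
  identity both pair alike with gradients of test functions.\<close>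

lemma weak_gradient_pairing:
  assumes w: "has_weak_gradient u G" and \<phi>: "\<phi> \<in> test_functions"
  shows "(LINT x|lebesgue. G x \<bullet> gradient \<phi> x) = - (\<Sum>i\<in>Basis. LINT x|lebesgue. u x * pd (pd \<phi> i) i x)"
proof -
  note c = weak_gradient_component[OF w test_pd[OF \<phi>]]
  have "G x \<bullet> gradient \<phi> x = (\<Sum>i\<in>Basis. pd \<phi> i x * (G x \<bullet> i))" for x
    by (simp add: gradient_def inner_sum_right)
  then have "(LINT x|lebesgue. G x \<bullet> gradient \<phi> x) = (\<Sum>i\<in>Basis. LINT x|lebesgue. pd \<phi> i x * (G x \<bullet> i))"
    using c(2) by (simp add: Bochner_Integration.integral_sum)
  also have "\<dots> = (\<Sum>i\<in>Basis. - (LINT x|lebesgue. u x * pd (pd \<phi> i) i x))"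
    by (intro sum.cong refl) (simp add: c(1))
  finally show ?thesis by (simp add: sum_negf)
qed

text \<open>Bridge from classes modulo null sets and Lebesgue measure to
  \<open>critical_equation\<close>: Borel representatives are chosen for \<open>u\<close> and its
  square-integrable gradient.\<close>

theorem no_weak_solution:
  fixes u :: "'a::euclidean_space \<Rightarrow> real"
  assumes dim: "DIM('a) \<ge> 3" and q: "q > critical_exponent DIM('a) - 1"
    and D: "u \<in> D12" and L: "u \<in> Lp (q + 1)" and pos: "AE x in lebesgue. u x > 0"
    and sol: "weak_solution \<mu> (\<lambda>t. t powr (critical_exponent DIM('a) - 1) - t powr q) u"
  shows False
proof -
  define \<beta> where "\<beta> = critical_exponent DIM('a)"
  obtain G where wG: "has_weak_gradient u G" and G2: "G \<in> Lp 2" and ub: "u \<in> Lp \<beta>"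
    using D by (auto simp: D12_def \<beta>_def)
  obtain G' where wG': "has_weak_gradient u G'" and eq: "\<And>\<phi>. \<phi> \<in> test_functions \<Longrightarrow>
     (LINT x|lebesgue. G' x \<bullet> gradient \<phi> x) - \<mu> * (LINT x|lebesgue. u x * \<phi> x / (norm x)\<^sup>2)
          = (LINT x|lebesgue. (u x powr (\<beta> - 1) - u x powr q) * \<phi> x)"
    using sol by (auto simp: weak_solution_def \<beta>_def)
  have um[measurable]: "u \<in> borel_measurable lebesgue" and Gm[measurable]: "G \<in> borel_measurable lebesgue"
    using ub G2 by (auto simp: Lp_def)
  obtain u1 where u1[measurable]: "u1 \<in> borel_measurable borel" and uu1: "AE x in lebesgue. u x = u1 x"
    using lebesgue_borel_representative[OF um] by metis
  obtain g where g[measurable]: "g \<in> borel_measurable borel" and Gg: "AE x in lebesgue. G x = g x"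
    using lebesgue_borel_representative_vector[OF Gm] by metis
  \<comment> \<open>The value 1 is arbitrary: it is taken only on a null set and makes positivity
    hold at every point.\<close>
  define v where "v = (\<lambda>x. if u1 x > 0 then u1 x else 1)"
  have [measurable]: "v \<in> borel_measurable borel" unfolding v_def by measurable
  have vp: "v x > 0" for x by (simp add: v_def)
  have uv: "AE x in lebesgue. u x = v x" using uu1 pos by eventually_elim (auto simp: v_def)
  have idm: "(\<lambda>x. x) \<in> borel_measurable (lebesgue :: 'a measure)"
    by (rule measurable_completion) simp
  have "critical_equation v g \<mu> q"
  proof (unfold critical_equation_def, fold \<beta>_def, intro conjI allI impI)
    show "3 \<le> DIM('a)" by (rule dim)
    show "\<beta> - 1 < q" using q by (simp add: \<beta>_def)
    show "v \<in> borel_measurable borel" "g \<in> borel_measurable borel" by measurable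
    show "0 < v x" for x by (rule vp)
    have int: "integrable lborel (\<lambda>x. v x powr r)" if "u \<in> Lp r" for r
    proof -
      have "integrable lebesgue (\<lambda>x. norm (u x) powr r) \<longleftrightarrow> integrable lborel (\<lambda>x. v x powr r)"
        by (rule lebesgue_integral_representative)
           (use uv in \<open>auto elim!: eventually_mono simp: abs_of_pos[OF vp]\<close>)
      then show ?thesis using that by (simp add: Lp_def)
    qed
    show "integrable lborel (\<lambda>x. v x powr \<beta>)" "integrable lborel (\<lambda>x. v x powr (q + 1))"
      using int ub L by auto
    have "integrable lebesgue (\<lambda>x. norm (G x) powr 2) \<longleftrightarrow> integrable lborel (\<lambda>x. (norm (g x))\<^sup>2)"
      by (rule lebesgue_integral_representative) (use Gg in \<open>auto elim!: eventually_mono\<close>)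
    then show "integrable lborel (\<lambda>x. (norm (g x))\<^sup>2)" using G2 by (simp add: Lp_def)
  next
    fix \<phi> :: "'a \<Rightarrow> real" and i :: 'a assume \<phi>: "\<phi> \<in> test_functions" and i: "i \<in> Basis"
    have \<phi>b[measurable]: "\<phi> \<in> borel_measurable borel" "pd \<phi> i \<in> borel_measurable borel"
      using \<phi> test_pd[OF \<phi> i] by (auto intro: smooth_measurable test_smooth)
    have \<phi>l[measurable]: "\<phi> \<in> borel_measurable lebesgue" "pd \<phi> i \<in> borel_measurable lebesgue"
      by (intro measurable_completion; simp)+
    have 1: "(LINT x|lebesgue. u x * pd \<phi> i x) = (LINT x|lborel. v x * pd \<phi> i x)"
      by (rule lebesgue_integral_representative) (use uv in \<open>auto elim!: eventually_mono\<close>)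
    have 2: "(LINT x|lebesgue. \<phi> x * (G x \<bullet> i)) = (LINT x|lborel. \<phi> x * (g x \<bullet> i))"
      by (rule lebesgue_integral_representative) (use Gg in \<open>auto elim!: eventually_mono\<close>)
    show "(LINT x|lborel. v x * pd \<phi> i x) = - (LINT x|lborel. \<phi> x * (g x \<bullet> i))"
      using weak_gradient_component(1)[OF wG \<phi> i] unfolding 1 2 .
  next
    fix \<phi> :: "'a \<Rightarrow> real" assume \<phi>: "\<phi> \<in> test_functions"
    have \<phi>b[measurable]: "\<phi> \<in> borel_measurable borel" "gradient \<phi> \<in> borel_measurable borel"
      using \<phi> by (auto intro: smooth_measurable gradient_measurable test_smooth)
    have \<phi>l[measurable]: "\<phi> \<in> borel_measurable lebesgue" "gradient \<phi> \<in> borel_measurable lebesgue"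
       "(\<lambda>x::'a. (norm x)\<^sup>2) \<in> borel_measurable lebesgue"
      by (intro measurable_completion; simp)+
    have 1: "(LINT x|lebesgue. G x \<bullet> gradient \<phi> x) = (LINT x|lborel. g x \<bullet> gradient \<phi> x)"
      by (rule lebesgue_integral_representative) (use Gg in \<open>auto elim!: eventually_mono\<close>)
    have 2: "(LINT x|lebesgue. u x * \<phi> x / (norm x)\<^sup>2) = (LINT x|lborel. v x * \<phi> x / (norm x)\<^sup>2)"
      by (rule lebesgue_integral_representative) (use uv in \<open>auto elim!: eventually_mono\<close>)
    have 3: "(LINT x|lebesgue. (u x powr (\<beta> - 1) - u x powr q) * \<phi> x) = (LINT x|lborel. (v x powr (\<beta> - 1) - v x powr q) * \<phi> x)"
      by (rule lebesgue_integral_representative) (use uv in \<open>auto elim!: eventually_mono\<close>)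
    show "(LINT x|lborel. g x \<bullet> gradient \<phi> x) - \<mu> * (LINT x|lborel. v x * \<phi> x / (norm x)\<^sup>2)
          = (LINT x|lborel. (v x powr (\<beta> - 1) - v x powr q) * \<phi> x)"
      \<comment> \<open>Exchanges the gradient supplied by the weak formulation for the
        square-integrable one from \<open>D12\<close>, through the common pairing of
        \<open>u\<close> with second derivatives.\<close>
      using eq[OF \<phi>] unfolding weak_gradient_pairing[OF wG' \<phi>] weak_gradient_pairing[OF wG \<phi>, symmetric] 1 2 3 .
  qed
  then show False by (rule critical_equation.no_solution)
qed

theorem theorem1p1:
  fixes \<mu> q :: real
  assumes "CARD('n::finite) \<ge> 3"
    and "0 \<le> \<mu>" and "\<mu> < ((real CARD('n) - 2) / 2)\<^sup>2"
    and "q > critical_exponent CARD('n) - 1"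
  shows "\<not> (\<exists>u :: real ^ 'n \<Rightarrow> real.
     u \<in> D12 \<and> u \<in> Lp (q + 1) \<and> (AE x in lebesgue. u x > 0) \<and>
     weak_solution \<mu> (\<lambda>t. t powr (critical_exponent CARD('n) - 1) - t powr q) u)"
  using no_weak_solution[where 'a = "real ^ 'n", of q _ \<mu>] assms by auto

end
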